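(* Let $\Bbbk$ be an infinite field, let $L$ be a (nonempty) affine linear subspace of dimension $d$ in $\mathbb{A}^n$, let $I(\widetilde{L})\subset S=\Bbbk[x_1,\dots,x_n,y_1,\dots,y_n]$ be the ideal of its closure in $(\mathbb{P}^1)^n$, and let $M$ be the matroid on $[n]$ associated to the linear part of $L$, of rank $r=n-d$. The non-zero multigraded Betti numbers of $S/I(\widetilde{L})$ are precisely $$\beta_{i,\mathbf{a}} (S/I(\widetilde{L})) = |\mu(F, \widehat{1})|$$ for each flat $F$ of $M$, where $i=r-r(F)$ and $\mathbf{a} = e_{[n]-F}$. Here $\mu$ is the Möbius function of the lattice of flats of $M$ and $\widehat1$ is its maximum element. Furthermore, all of the initial ideals have the same Betti numbers: $$\beta_{i,\mathbf{a}} (S/I(\widetilde{L})) = \beta_{i,\mathbf{a}} (S/\mathrm{in}_< I (\widetilde{L}))$$ for all $i$, all $\mathbf{a}$ and for every term order $<$.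
   Context: Closure. Fix coordinates on $\mathbb{A}^n=\mathbb{A}^1\times\cdots\times\mathbb{A}^1$; adding one point at infinity to each factor gives $\mathbb{A}^n\hookrightarrow(\mathbb{P}^1)^n$, and $\widetilde L$ is the scheme-theoretic closure of $L$. The $i$-th $\mathbb{P}^1$ has homogeneous coordinates $x_i,y_i$ with affine coordinate $x_i/y_i$. With $I(L)\subset\Bbbk[x_1,\dots,x_n]$ the ideal of $L$, one has $I(\widetilde L)=(f^h: f\in I(L))\subset S$, where $f^h$ is obtained by substituting $x_i\mapsto x_i/y_i$ in $f$ and clearing denominators. Matroid. Write $L=\{\vec x:A\vec x=\vec b\}$ with $A$ an $(n-d)\times n$ matrix of rank $n-d$. $M$ is the matroid on $[n]$ of linear independence of the columns of $A$ (the matroid of the vector subspace $A\vec x=\vec 0$); $r(\cdot)$ is its rank function. Grading. $S$ is $\mathbb{Z}^n$-graded by $\deg x_i=\deg y_i=e_i$, and $\beta_{i,\mathbf a}(N)=\dim_\Bbbk \mathrm{Tor}_i^S(N,\Bbbk)_{\mathbf a}$ for $\mathbf a\in\mathbb{Z}^n$. For $T\subseteq[n]$, $e_T=\sum_{i\in T}e_i$. Möbius function. On the lattice of flats of $M$ (ordered by inclusion), $\mu(x,x)=1$ and $\sum_{x\le z\le y}\mu(z,y)=0$ for $x<y$. Term orders $<$ are monomial term orders on $S$, and $\mathrm{in}_<J$ is the ideal generated by the leading terms of all elements of $J$. *)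

theory Defs
  imports "HOL-Analysis.Cartesian_Space" "HOL-Library.Poly_Mapping"
begin

abbreviation "keys \<equiv> Poly_Mapping.keys"
abbreviation "lookup \<equiv> Poly_Mapping.lookup"
abbreviation "single \<equiv> Poly_Mapping.single"

definition affine_subspace :: "('k::field ^ 'n::finite) set \<Rightarrow> nat \<Rightarrow> bool" where
  "affine_subspace L d \<longleftrightarrow>
     (\<exists>p V. vec.subspace V \<and> vec.dim V = d \<and> L = (\<lambda>v. p + v) ` V)"

text \<open>An \<open>r \<times> n\<close> matrix is given by its rows \<open>A 0, \<dots>, A (r - 1)\<close>; \<open>r = 0\<close> is allowed.\<close>

definition row_rank :: "nat \<Rightarrow> (nat \<Rightarrow> 'k::field ^ 'n::finite) \<Rightarrow> nat" where
  "row_rank r A = vec.dim (A ` {..<r})"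

definition solutions :: "nat \<Rightarrow> (nat \<Rightarrow> 'k::field ^ 'n::finite) \<Rightarrow> (nat \<Rightarrow> 'k) \<Rightarrow> ('k ^ 'n) set" where
  "solutions r A b = {x. \<forall>i<r. (\<Sum>j\<in>UNIV. A i $ j * x $ j) = b i}"

type_synonym ('v, 'k) mpoly = "('v \<Rightarrow>\<^sub>0 nat) \<Rightarrow>\<^sub>0 'k"

definition peval :: "('n, 'k::field) mpoly \<Rightarrow> 'k ^ 'n::finite \<Rightarrow> 'k" where
  "peval f p = (\<Sum>m\<in>keys f. lookup f m * (\<Prod>i\<in>UNIV. (p $ i) ^ lookup m i))"

definition vanishing_ideal :: "('k::field ^ 'n::finite) set \<Rightarrow> ('n, 'k) mpoly set" where
  "vanishing_ideal L = {f. \<forall>p\<in>L. peval f p = 0}"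

abbreviation ideal_gen :: "'a::comm_ring_1 set \<Rightarrow> 'a set" where
  "ideal_gen \<equiv> module.span (*)"

text \<open>In the polynomial ring \<open>S\<close> the variable \<open>x\<^sub>i\<close> is indexed by \<open>Inl i\<close> and \<open>y\<^sub>i\<close> by \<open>Inr i\<close>.\<close>

type_synonym 'n mon = "('n + 'n) \<Rightarrow>\<^sub>0 nat"
type_synonym ('n, 'k) S = "('n + 'n, 'k) mpoly"

definition var_degree :: "('n, 'k::field) mpoly \<Rightarrow> 'n \<Rightarrow> nat" where
  "var_degree f i = Max ((\<lambda>m. lookup m i) ` keys f)"

text \<open>Substituting \<open>x\<^sub>i \<mapsto> x\<^sub>i / y\<^sub>i\<close> in \<open>f\<close> and multiplying by \<open>y\<^sub>i\<close> to the power
  \<open>D i = var_degree f i\<close> (the least common denominator) turns the monomial with exponents \<open>m\<close>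
  into the product of all \<open>x\<^sub>i ^ m\<^sub>i * y\<^sub>i ^ (D i - m\<^sub>i)\<close>.\<close>

definition hom_mon :: "('n \<Rightarrow> nat) \<Rightarrow> ('n::finite \<Rightarrow>\<^sub>0 nat) \<Rightarrow> 'n mon" where
  "hom_mon D m = (\<Sum>i\<in>UNIV. single (Inl i) (lookup m i)
                          + single (Inr i) (D i - lookup m i))"

definition homogenize :: "('n::finite, 'k::field) mpoly \<Rightarrow> ('n, 'k) S" where
  "homogenize f = (\<Sum>m\<in>keys f. single (hom_mon (var_degree f) m) (lookup f m))"

definition closure_ideal :: "('k::field ^ 'n::finite) set \<Rightarrow> ('n, 'k) S set" where
  "closure_ideal L = ideal_gen (homogenize ` vanishing_ideal L)"

definition term_order :: "('n mon \<Rightarrow> 'n mon \<Rightarrow> bool) \<Rightarrow> bool" where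
  "term_order lt \<longleftrightarrow>
     (\<forall>s. \<not> lt s s) \<and>
     (\<forall>s t u. lt s t \<longrightarrow> lt t u \<longrightarrow> lt s u) \<and>
     (\<forall>s t. s \<noteq> t \<longrightarrow> lt s t \<or> lt t s) \<and>
     (\<forall>s t u. lt s t \<longrightarrow> lt (s + u) (t + u)) \<and>
     (\<forall>s. s \<noteq> 0 \<longrightarrow> lt 0 s)"

definition is_lead_mon :: "('n mon \<Rightarrow> 'n mon \<Rightarrow> bool) \<Rightarrow> ('n, 'k::field) S \<Rightarrow> 'n mon \<Rightarrow> bool" where
  "is_lead_mon lt f m \<longleftrightarrow> m \<in> keys f \<and> (\<forall>m'\<in>keys f. m' \<noteq> m \<longrightarrow> lt m' m)"

definition initial_ideal ::
    "('n mon \<Rightarrow> 'n mon \<Rightarrow> bool) \<Rightarrow> ('n, 'k::field) S set \<Rightarrow> ('n, 'k) S set" where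
  "initial_ideal lt J =
     ideal_gen {single m (lookup f m) | f m. f \<in> J \<and> is_lead_mon lt f m}"

definition mdeg :: "'n::finite mon \<Rightarrow> int ^ 'n" where
  "mdeg m = (\<chi> i. int (lookup m (Inl i) + lookup m (Inr i)))"

definition homogeneous :: "int ^ 'n::finite \<Rightarrow> ('n, 'k::field) S \<Rightarrow> bool" where
  "homogeneous a f \<longleftrightarrow> (\<forall>m\<in>keys f. mdeg m = a)"

text \<open>The free module with basis \<open>B \<subseteq> \<nat>\<close> over a ring is the set of finitely supported families
  \<open>v\<close> with \<open>keys v \<subseteq> B\<close>.  The linear map sending the basis element \<open>b\<close> to \<open>D b\<close> is
  \<open>lin_ext D\<close>.\<close>

definition fscale :: "'a::comm_ring_1 \<Rightarrow> (nat \<Rightarrow>\<^sub>0 'a) \<Rightarrow> (nat \<Rightarrow>\<^sub>0 'a)" where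
  "fscale c v = Poly_Mapping.map ((*) c) v"

definition free_on :: "nat set \<Rightarrow> (nat \<Rightarrow>\<^sub>0 'a::zero) set" where
  "free_on B = {v. keys v \<subseteq> B}"

definition lin_ext :: "(nat \<Rightarrow> (nat \<Rightarrow>\<^sub>0 'a::comm_ring_1)) \<Rightarrow> (nat \<Rightarrow>\<^sub>0 'a) \<Rightarrow> (nat \<Rightarrow>\<^sub>0 'a)" where
  "lin_ext D v = (\<Sum>b\<in>keys v. fscale (lookup v b) (D b))"

lemma lookup_fscale: "lookup (fscale c v) b = c * lookup v b"
  by (simp add: fscale_def map.rep_eq when_def)

global_interpretation fmod: module "fscale :: 'a::comm_ring_1 \<Rightarrow> _"
  by unfold_locales (auto intro!: poly_mapping_eqI simp: lookup_fscale lookup_add algebra_simps)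

global_interpretation fvs: vector_space "fscale :: 'a::field \<Rightarrow> _"
  by unfold_locales (auto intro!: poly_mapping_eqI simp: lookup_fscale lookup_add algebra_simps)

text \<open>A complex of graded free modules \<open>F\<^sub>0 \<leftarrow> F\<^sub>1 \<leftarrow> \<dots>\<close>: the module \<open>F\<^sub>i\<close> has the basis
  \<open>basis F i\<close>, its element \<open>b\<close> has degree \<open>bdeg F i b\<close>, and \<open>diff F i b\<close> is the image
  of the basis element \<open>b\<close> of \<open>F\<^sub>i\<^sub>+\<^sub>1\<close> in \<open>F\<^sub>i\<close>.  Finally, \<open>aug F b\<close> represents
  the image in \<open>S / J\<close> of the basis element \<open>b\<close> of \<open>F\<^sub>0\<close>.\<close>

record (overloaded) ('n, 'k) graded_complex =
  basis :: "nat \<Rightarrow> nat set"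
  bdeg :: "nat \<Rightarrow> nat \<Rightarrow> int ^ 'n"
  diff :: "nat \<Rightarrow> nat \<Rightarrow> (nat \<Rightarrow>\<^sub>0 ('n, 'k) S)"
  aug :: "nat \<Rightarrow> ('n, 'k) S"

definition aug_map ::
    "('n::finite, 'k::field) graded_complex \<Rightarrow> (nat \<Rightarrow>\<^sub>0 ('n, 'k) S) \<Rightarrow> ('n, 'k) S" where
  "aug_map F v = (\<Sum>b\<in>keys v. lookup v b * aug F b)"

text \<open>The first two conditions say that the maps are homogeneous of degree \<open>0\<close>, the others that
  \<open>\<dots> \<rightarrow> F\<^sub>1 \<rightarrow> F\<^sub>0 \<rightarrow> S / J \<rightarrow> 0\<close> is exact.\<close>

definition graded_free_resolution ::
    "('n::finite, 'k::field) S set \<Rightarrow> ('n, 'k) graded_complex \<Rightarrow> bool" where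
  "graded_free_resolution J F \<longleftrightarrow>
     (\<forall>b\<in>basis F 0. homogeneous (bdeg F 0 b) (aug F b)) \<and>
     (\<forall>i. \<forall>b\<in>basis F (Suc i). diff F i b \<in> free_on (basis F i) \<and>
        (\<forall>c\<in>basis F i. homogeneous (bdeg F (Suc i) b - bdeg F i c)
           (lookup (diff F i b) c))) \<and>
     (\<forall>s. \<exists>v\<in>free_on (basis F 0). s - aug_map F v \<in> J) \<and>
     {v \<in> free_on (basis F 0). aug_map F v \<in> J} = lin_ext (diff F 0) ` free_on (basis F 1) \<and>
     (\<forall>i. {v \<in> free_on (basis F (Suc i)). lin_ext (diff F i) v = 0} =
        lin_ext (diff F (Suc i)) ` free_on (basis F (Suc (Suc i))))"

text \<open>Since \<open>\<kk> = S / (x\<^sub>1, \<dots>, y\<^sub>n)\<close>, the complex \<open>F \<otimes> \<kk>\<close> consists of the vector spaces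
  with bases \<open>basis F i\<close>, and its differentials are obtained by taking constant coefficients.
  Its part of degree \<open>a\<close> is spanned by the basis elements of degree \<open>a\<close>.\<close>

definition tensor_diff ::
    "('n::finite, 'k::field) graded_complex \<Rightarrow> nat \<Rightarrow> (nat \<Rightarrow>\<^sub>0 'k) \<Rightarrow> (nat \<Rightarrow>\<^sub>0 'k)" where
  "tensor_diff F i = lin_ext (\<lambda>b. Poly_Mapping.map (\<lambda>s. lookup s 0) (diff F i b))"

definition tensor_part ::
    "('n::finite, 'k::field) graded_complex \<Rightarrow> nat \<Rightarrow> int ^ 'n \<Rightarrow> (nat \<Rightarrow>\<^sub>0 'k) set" where
  "tensor_part F i a = free_on {b \<in> basis F i. bdeg F i b = a}"

definition tor_cycles ::
    "('n::finite, 'k::field) graded_complex \<Rightarrow> nat \<Rightarrow> int ^ 'n \<Rightarrow> (nat \<Rightarrow>\<^sub>0 'k) set" where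
  "tor_cycles F i a =
     {v \<in> tensor_part F i a. case i of 0 \<Rightarrow> True | Suc j \<Rightarrow> tensor_diff F j v = 0}"

definition tor_boundaries ::
    "('n::finite, 'k::field) graded_complex \<Rightarrow> nat \<Rightarrow> int ^ 'n \<Rightarrow> (nat \<Rightarrow>\<^sub>0 'k) set" where
  "tor_boundaries F i a = tensor_diff F i ` tensor_part F (Suc i) a"

text \<open>\<open>quotient_basis V W B\<close>: the elements of \<open>B\<close> represent a basis of \<open>V / W\<close>.  As for the
  library's \<open>dim\<close>, the dimension of an infinite-dimensional quotient is \<open>0\<close> by convention.\<close>

definition quotient_basis ::
    "(nat \<Rightarrow>\<^sub>0 'k::field) set \<Rightarrow> (nat \<Rightarrow>\<^sub>0 'k) set \<Rightarrow> (nat \<Rightarrow>\<^sub>0 'k) set \<Rightarrow> bool" where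
  "quotient_basis V W B \<longleftrightarrow>
     B \<subseteq> V \<and> fmod.independent B \<and> fmod.span B \<inter> W = {0} \<and> V \<subseteq> fmod.span (B \<union> W)"

definition quotient_dim :: "(nat \<Rightarrow>\<^sub>0 'k::field) set \<Rightarrow> (nat \<Rightarrow>\<^sub>0 'k) set \<Rightarrow> nat" where
  "quotient_dim V W = card (SOME B. quotient_basis V W B)"

text \<open>\<open>betti J i a\<close> is the dimension of the degree \<open>a\<close> part of \<open>Tor\<^sub>i (S / J, \<kk>)\<close>,
  which does not depend on the resolution chosen.\<close>

definition betti :: "('n::finite, 'k::field) S set \<Rightarrow> nat \<Rightarrow> int ^ 'n \<Rightarrow> nat" where
  "betti J i a =
     (let F = (SOME F. graded_free_resolution J F)
      in quotient_dim (tor_cycles F i a) (tor_boundaries F i a))"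

definition column_indep :: "nat \<Rightarrow> (nat \<Rightarrow> 'k::field ^ 'n::finite) \<Rightarrow> 'n set \<Rightarrow> bool" where
  "column_indep r A T \<longleftrightarrow>
     (\<forall>c :: 'n \<Rightarrow> 'k. (\<forall>i<r. (\<Sum>j\<in>T. c j * A i $ j) = 0) \<longrightarrow> (\<forall>j\<in>T. c j = 0))"

definition matroid_rank :: "nat \<Rightarrow> (nat \<Rightarrow> 'k::field ^ 'n::finite) \<Rightarrow> 'n set \<Rightarrow> nat" where
  "matroid_rank r A T = Max {card U | U. U \<subseteq> T \<and> column_indep r A U}"

definition flats :: "nat \<Rightarrow> (nat \<Rightarrow> 'k::field ^ 'n::finite) \<Rightarrow> 'n set set" where
  "flats r A = {F. \<forall>j. j \<notin> F \<longrightarrow> matroid_rank r A F < matroid_rank r A (insert j F)}"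

text \<open>The Moebius function of a family \<open>P\<close> of subsets of a finite set, ordered by inclusion.
  Both arguments are meant to be members of \<open>P\<close>.\<close>

function moebius :: "'a::finite set set \<Rightarrow> 'a set \<Rightarrow> 'a set \<Rightarrow> int" where
  "moebius P X Y =
     (if X = Y then 1
      else if X \<subset> Y then - (\<Sum>Z\<in>{Z \<in> P. X \<subset> Z \<and> Z \<subseteq> Y}. moebius P Z Y)
      else 0)"
  by auto
termination
  by (relation "measure (\<lambda>(P, X, Y). card (Y - X))")
     (auto intro!: psubset_card_mono)

declare moebius.simps [simp del]

definition indicator_vec :: "'n set \<Rightarrow> int ^ 'n::finite" where
  "indicator_vec T = (\<chi> i. if i \<in> T then 1 else 0)"

end

theory Submission
  imports Defs "HOL-Computational_Algebra.Polynomial"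
begin

text \<open>
Write \<open>\<rho>\<close> for the rank function of the matroid \<open>M\<close>, call a set spanning if its rank is that of \<open>M\<close>,
and coindependent if its complement is spanning.  The theorem holds because the Betti numbers of
\<open>S / J\<close> are determined by very little information on \<open>J\<close>, which the ideal of the closure has and
which passes to its initial ideals.  Call a multigraded ideal \<open>J\<close> matroidal
(locale \<open>matroidal_ideal\<close>) if it contains a nonzero element of degree \<open>e\<^sub>T\<close> for every \<open>T\<close> that is not
coindependent, and if the dimension of \<open>S / J\<close> in degree \<open>a\<close> is at least the number of exponents
\<open>u \<le> a\<close> with coindependent support.  The ideal of the closure is matroidal
(\<open>matroidal_closure_ideal\<close>): a row relation supported in \<open>T\<close> gives the element of degree \<open>e\<^sub>T\<close>,
and the dimension is bounded below by deletion and contraction, applied to spaces of polynomial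
functions on \<open>L\<close>.  Passing to an initial ideal changes neither property
(\<open>matroidal_initial_ideal\<close>).  Hence the theorem follows from \<open>betti_matroidal\<close>, which computes the
Betti numbers of all matroidal ideals at once.

As \<open>\<kk>\<close> is infinite, there is a point \<open>c\<close> at which the finitely many
elements of degrees \<open>e\<^sub>T\<close> do not vanish when \<open>x\<^sub>i = 1\<close> and \<open>y\<^sub>i = c\<^sub>i\<close>.  Let \<open>l\<^sub>i = y\<^sub>i - c\<^sub>i x\<^sub>i\<close>.  Modulo the
\<open>l\<^sub>i\<close>, the ideal \<open>J\<close> contains the product of the \<open>x\<^sub>i\<close> with \<open>i \<in> T\<close> for every \<open>T\<close> that is not coindependent.
Therefore the products \<open>x\<^sup>u l\<^sup>w\<close> with \<open>u\<close> of coindependent support span \<open>S / J\<close>, and the lower bound on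
the dimension makes them a basis.  So \<open>l\<^sub>1, \<dots>, l\<^sub>n\<close> is a regular sequence on \<open>S / J\<close> (lemma \<open>regular\<close>),
and the quotient is \<open>\<kk>[x]\<close> modulo a squarefree monomial ideal, whose standard monomials are those
with coindependent support.  A graded free resolution of \<open>S / J\<close> thus remains exact modulo the \<open>l\<^sub>i\<close>, and since all
graded pieces of \<open>\<kk>[x]\<close> are at most one-dimensional, it becomes a complex of vector spaces with
bases that carry multidegrees.  The part spanned by the basis elements of degree at most \<open>a\<close> has
homology only in homological degree \<open>0\<close>, where it is \<open>\<kk>\<close> if \<open>a \<ge> 0\<close> has coindependent support and
\<open>0\<close> otherwise.

The part of \<open>Tor\<close> of degree \<open>a\<close> is the homology of the
subquotient spanned by the basis elements of degree exactly \<open>a\<close>.  The equality of degrees can be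
imposed on one coordinate \<open>v\<close> at a time: the subquotient of the elements of degree at most \<open>a\<close> that
agree with \<open>a\<close> on \<open>P\<close> is an extension of the one for \<open>P \<union> {v}\<close> by the one for \<open>P\<close> and \<open>a - e\<^sub>v\<close>.
If \<open>F\<close> is the set of zeros of \<open>a\<close>, then along this process all homology stays in homological degree
\<open>r - \<rho>(F)\<close>, and it vanishes once \<open>P\<close> contains some \<open>w\<close> with \<open>a\<^sub>w \<ge> 2\<close> or with \<open>a\<^sub>w = 1\<close> and
\<open>w\<close> in the closure of \<open>F\<close>.  So only the degrees \<open>e\<^bsub>[n] - F\<^esub>\<close> with \<open>F\<close> a flat remain.  The dimensions obey
the deletion-contraction recursion of the alternating number of spanning sets between \<open>F\<close> and
\<open>F \<union> P\<close>, which for \<open>P = [n]\<close> is \<open>\<mu>(F, 1)\<close> by Rota's formula; the same recursion shows that it does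
not vanish.
\<close>

section \<open>Spanning sets in a matroid and the Moebius function of its flats\<close>

locale rank_function =
  fixes \<rho> :: "'n::finite set \<Rightarrow> nat"
  assumes mono: "F \<subseteq> G \<Longrightarrow> \<rho> F \<le> \<rho> G"
    and insert_le: "\<rho> (insert w F) \<le> Suc (\<rho> F)"
    and closure_mono: "\<rho> (insert w F) = \<rho> F \<Longrightarrow> F \<subseteq> G \<Longrightarrow> \<rho> (insert w G) = \<rho> G"
begin

definition rk :: nat where "rk = \<rho> UNIV"

definition spanning :: "'n set \<Rightarrow> bool" where "spanning G \<longleftrightarrow> \<rho> G = rk"

definition flat :: "'n set \<Rightarrow> bool" where
  "flat F \<longleftrightarrow> (\<forall>w. w \<notin> F \<longrightarrow> \<rho> F < \<rho> (insert w F))"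

lemma le_rk: "\<rho> F \<le> rk"
  by (simp add: rk_def mono)

lemma spanning_mono: "spanning F \<Longrightarrow> F \<subseteq> G \<Longrightarrow> spanning G"
  using mono[of F G] le_rk[of G] by (simp add: spanning_def)

lemma rank_insert_cases: "\<rho> (insert w F) = \<rho> F \<or> \<rho> (insert w F) = Suc (\<rho> F)"
  using insert_le[of w F] mono[of F "insert w F", OF subset_insertI] by linarith

lemma rank_exchange:
  assumes "\<rho> (insert e F) = Suc (\<rho> F)" "\<rho> (insert w F) = Suc (\<rho> F)"
    and "\<rho> (insert w (insert e F)) = \<rho> (insert e F)"
  shows "\<rho> (insert e (insert w F)) = \<rho> (insert w F)"
  using assms by (simp add: insert_commute)

text \<open>For a flat \<open>F\<close> and \<open>K = UNIV\<close> this is Rota's formula for the Moebius function.  The upper end \<open>K\<close> is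
variable because deleting an element from it is one half of the recursion that both the signs and
the dimensions of homology obey.\<close>

definition span_sum :: "'n set \<Rightarrow> 'n set \<Rightarrow> int" where
  "span_sum F K = (\<Sum>G | F \<subseteq> G \<and> G \<subseteq> K \<and> spanning G. (-1) ^ card (G - F))"

lemma span_sum_refl: "span_sum F F = (if spanning F then 1 else 0)"
proof -
  have "{G. F \<subseteq> G \<and> G \<subseteq> F \<and> spanning G} = (if spanning F then {F} else {})" by auto
  then show ?thesis by (simp add: span_sum_def)
qed

text \<open>Deletion and contraction: the spanning sets are split by whether they contain \<open>v\<close>; for those that do,
passing from \<open>F\<close> to \<open>insert v F\<close> changes the sign.\<close>

lemma span_sum_insert:
  assumes "v \<notin> K" "F \<subseteq> K"
  shows "span_sum F (insert v K) = span_sum F K - span_sum (insert v F) (insert v K)"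
proof -
  let ?A = "{G. F \<subseteq> G \<and> G \<subseteq> K \<and> spanning G}"
  let ?B = "{G. insert v F \<subseteq> G \<and> G \<subseteq> insert v K \<and> spanning G}"
  have eq: "{G. F \<subseteq> G \<and> G \<subseteq> insert v K \<and> spanning G} = ?A \<union> ?B"
    using assms by auto
  have "v \<notin> F" using assms by auto
  have "card (G - F) = Suc (card (G - insert v F))" if "G \<in> ?B" for G
  proof -
    have "G - F = insert v (G - insert v F)" using that \<open>v \<notin> F\<close> by auto
    then show ?thesis by (simp add: card_insert_disjoint)
  qed
  then have "(\<Sum>G\<in>?B. (-1::int) ^ card (G - F)) = - (\<Sum>G\<in>?B. (-1) ^ card (G - insert v F))"
    by (simp add: sum_negf)
  moreover have "?A \<inter> ?B = {}" using assms by auto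
  ultimately show ?thesis
    unfolding span_sum_def eq by (subst sum.union_disjoint) (auto simp: span_sum_def)
qed

text \<open>If \<open>v\<close> lies in the closure of \<open>F\<close>, then adding or removing \<open>v\<close> does not affect whether a set above \<open>F\<close> is
spanning, so the terms cancel in pairs.\<close>

lemma span_sum_eq_0:
  assumes "v \<notin> F" "v \<in> K" "F \<subseteq> K" "\<rho> (insert v F) = \<rho> F"
  shows "span_sum F K = 0"
proof -
  define K' where "K' = K - {v}"
  have K: "K = insert v K'" "v \<notin> K'" "F \<subseteq> K'" using assms by (auto simp: K'_def)
  have "span_sum (insert v F) (insert v K') = span_sum F K'"
    unfolding span_sum_def
  proof (rule sum.reindex_bij_witness[where i = "insert v" and j = "\<lambda>G. G - {v}"])
    fix G assume G: "G \<in> {G. insert v F \<subseteq> G \<and> G \<subseteq> insert v K' \<and> spanning G}"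
    then have "\<rho> (insert v (G - {v})) = \<rho> (G - {v})"
      using assms by (intro closure_mono[OF assms(4)]) auto
    moreover have "insert v (G - {v}) = G" using G by auto
    ultimately show "G - {v} \<in> {G. F \<subseteq> G \<and> G \<subseteq> K' \<and> spanning G}"
      using G assms by (auto simp: spanning_def)
    show "insert v (G - {v}) = G" by fact
    have "G - {v} - F = G - insert v F" by auto
    then show "(-1) ^ card (G - {v} - F) = (-1::int) ^ card (G - insert v F)" by simp
  next
    fix G assume G: "G \<in> {G. F \<subseteq> G \<and> G \<subseteq> K' \<and> spanning G}"
    then show "insert v G - {v} = G" using K by auto
    show "insert v G \<in> {G. insert v F \<subseteq> G \<and> G \<subseteq> insert v K' \<and> spanning G}"
      using G K spanning_mono[of G "insert v G"] by auto
  qed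
  then show ?thesis using span_sum_insert[OF K(2,3)] K(1) by simp
qed

text \<open>The two terms of the recursion have the same sign, since contracting an element outside of the closure
of \<open>F\<close> lowers the corank by one.  Strict positivity is carried on by the deletion, except when the
deleted element is a coloop of \<open>K\<close>; then it is carried on by the contraction.\<close>

lemma span_sum_pos:
  assumes "F \<subseteq> K" "spanning K" "\<forall>w\<in>K - F. \<rho> F < \<rho> (insert w F)"
  shows "(-1) ^ (rk - \<rho> F) * span_sum F K > 0"
proof -
  have nn: "(-1) ^ (rk - \<rho> F) * span_sum F K \<ge> 0 \<and>
    (spanning K \<longrightarrow> (\<forall>w\<in>K - F. \<rho> F < \<rho> (insert w F)) \<longrightarrow> (-1) ^ (rk - \<rho> F) * span_sum F K > 0)"
    if "F \<subseteq> K" for F K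
    using that
  proof (induction "card (K - F)" arbitrary: F K)
    case 0
    then have "K = F" by auto
    then show ?case by (auto simp: span_sum_refl spanning_def)
  next
    case (Suc n)
    then obtain e where e: "e \<in> K - F" by (metis card.empty ex_in_conv nat.distinct(1))
    define K' where "K' = K - {e}"
    have K: "K = insert e K'" "e \<notin> K'" "F \<subseteq> K'" using Suc e by (auto simp: K'_def)
    show ?case
    proof (cases "\<rho> (insert e F) = \<rho> F")
      case True
      then have "span_sum F K = 0" using span_sum_eq_0[of e F K] e Suc.prems by auto
      moreover have "\<not> (\<forall>w\<in>K - F. \<rho> F < \<rho> (insert w F))" using True e by (metis less_irrefl)
      ultimately show ?thesis by simp
    next
      case False
      then have re: "\<rho> (insert e F) = Suc (\<rho> F)" using rank_insert_cases by blast
      then have "rk - \<rho> F = Suc (rk - \<rho> (insert e F))"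
        using le_rk[of "insert e F"] by linarith
      moreover have "span_sum F K' = span_sum F K + span_sum (insert e F) K"
        using span_sum_insert[OF K(2,3)] K(1) by simp
      ultimately have eq: "(-1) ^ (rk - \<rho> F) * span_sum F K =
          (-1) ^ (rk - \<rho> F) * span_sum F K' + (-1) ^ (rk - \<rho> (insert e F)) * span_sum (insert e F) K"
        by (simp add: algebra_simps)
      have "K - F = insert e (K' - F)" "K - insert e F = K' - F" using K e by auto
      then have card: "n = card (K' - F)" "n = card (K - insert e F)" using Suc(2) K(2)
        by (auto simp: card_insert_disjoint)
      note IH = Suc.hyps(1)[OF card(1) K(3)] Suc.hyps(1)[OF card(2)]
      have sub: "insert e F \<subseteq> K" using e Suc.prems by auto
      have "(-1) ^ (rk - \<rho> F) * span_sum F K > 0" if sp: "spanning K" and fl: "\<forall>w\<in>K - F. \<rho> F < \<rho> (insert w F)"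
      \<comment> \<open>If \<open>K'\<close> is not spanning, then \<open>e\<close> is a coloop, and \<open>insert e F\<close> is again closed in \<open>K\<close>: otherwise the
exchange property puts \<open>e\<close> into the closure of \<open>K'\<close>.\<close>
      proof (cases "spanning K'")
        case True
        then show ?thesis using IH sub eq fl K(1) by force
      next
        case nsp: False
        have "\<rho> (insert e F) < \<rho> (insert w (insert e F))" if w: "w \<in> K - insert e F" for w
        proof (rule ccontr)
          assume "\<not> ?thesis"
          then have 1: "\<rho> (insert w (insert e F)) = \<rho> (insert e F)"
            using rank_insert_cases[of w "insert e F"] by auto
          have "\<rho> F < \<rho> (insert w F)" using fl w by auto
          then have "\<rho> (insert w F) = Suc (\<rho> F)" using rank_insert_cases[of w F] by auto
          then have "\<rho> (insert e (insert w F)) = \<rho> (insert w F)"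
            using rank_exchange re 1 by blast
          then have "\<rho> (insert e K') = \<rho> K'"
            by (rule closure_mono) (use w K in auto)
          then show False using sp nsp K(1) by (simp add: spanning_def)
        qed
        then show ?thesis using IH sub eq sp by force
      qed
      moreover have "(-1) ^ (rk - \<rho> F) * span_sum F K \<ge> 0" using IH sub eq by linarith
      ultimately show ?thesis by blast
    qed
  qed
  then show ?thesis using assms by blast
qed

lemma alternating_sum_interval:
  assumes "F \<subset> (G::'n set)"
  shows "(\<Sum>X | F \<subseteq> X \<and> X \<subseteq> G. (-1::int) ^ card (G - X)) = 0"
proof -
  obtain v where v: "v \<in> G" "v \<notin> F" using assms by auto
  let ?A = "{X. F \<subseteq> X \<and> X \<subseteq> G \<and> v \<in> X}" and ?B = "{X. F \<subseteq> X \<and> X \<subseteq> G \<and> v \<notin> X}"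
  have "(\<Sum>X\<in>?B. (-1::int) ^ card (G - X)) = (\<Sum>X\<in>?A. - ((-1) ^ card (G - X)))"
  proof (rule sum.reindex_bij_witness[where i = "\<lambda>X. X - {v}" and j = "insert v"])
    fix X assume X: "X \<in> ?B"
    have "G - X = insert v (G - insert v X)" using X v by auto
    then have "card (G - X) = Suc (card (G - insert v X))"
      by (metis card_insert_disjoint finite Diff_iff insertI1)
    then show "- ((-1) ^ card (G - insert v X)) = (-1::int) ^ card (G - X)" by simp
  qed (use v in auto)
  moreover have "{X. F \<subseteq> X \<and> X \<subseteq> G} = ?A \<union> ?B" by auto
  ultimately show ?thesis
    by (simp only:) (subst sum.union_disjoint, auto simp: sum_negf)
qed

text \<open>Sets that are not flats may be added to the sum, as they contribute nothing.  After exchanging the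
order of summation, the inner sum over an interval of the Boolean lattice is \<open>0\<close> unless the interval
is a point.\<close>

lemma sum_span_sum_flats:
  assumes "flat F"
  shows "(\<Sum>Z | flat Z \<and> F \<subseteq> Z. span_sum Z UNIV) = (if F = UNIV then 1 else 0)"
proof -
  have "span_sum Z UNIV = 0" if "\<not> flat Z" for Z
    using that span_sum_eq_0[of _ Z UNIV] rank_insert_cases[of _ Z] unfolding flat_def by force
  then have "(\<Sum>Z | flat Z \<and> F \<subseteq> Z. span_sum Z UNIV) = (\<Sum>Z | F \<subseteq> Z. span_sum Z UNIV)"
    by (intro sum.mono_neutral_left) auto
  also have "\<dots> = (\<Sum>Z | F \<subseteq> Z. \<Sum>G | Z \<subseteq> G \<and> spanning G. (-1) ^ card (G - Z))"
    by (simp add: span_sum_def)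
  also have "\<dots> = (\<Sum>G | spanning G. \<Sum>Z | F \<subseteq> Z \<and> Z \<subseteq> G. (-1) ^ card (G - Z))"
    using sum.swap_restrict[of "{Z. F \<subseteq> Z}" "{G. spanning G}" "\<lambda>Z G. (-1) ^ card (G - Z)" "(\<subseteq>)"]
    by (simp add: conj_commute)
  also have "\<dots> = (\<Sum>G | spanning G. if G = F then 1 else 0)"
  proof (rule sum.cong[OF refl])
    fix G
    consider "G = F" | "F \<subset> G" | "\<not> F \<subseteq> G" by auto
    then show "(\<Sum>Z | F \<subseteq> Z \<and> Z \<subseteq> G. (-1::int) ^ card (G - Z)) = (if G = F then 1 else 0)"
    proof cases
      case 1
      then have "{Z. F \<subseteq> Z \<and> Z \<subseteq> G} = {F}" by auto
      then show ?thesis using 1 by simp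
    next
      case 2
      then show ?thesis using alternating_sum_interval by auto
    next
      case 3
      then have "{Z. F \<subseteq> Z \<and> Z \<subseteq> G} = {}" by auto
      then show ?thesis using 3 by (metis (no_types, lifting) order_refl sum.empty)
    qed
  qed
  also have "\<dots> = (if spanning F then 1 else 0)" by simp
  also have "spanning F \<longleftrightarrow> F = UNIV"
    using assms le_rk unfolding flat_def spanning_def rk_def
    by (metis UNIV_eq_I leD)
  finally show ?thesis by simp
qed

lemma moebius_eq_span_sum:
  assumes "flat F"
  shows "moebius {Z. flat Z} F UNIV = span_sum F UNIV"
  using assms
proof (induction "card (UNIV - F)" arbitrary: F rule: less_induct)
  case less
  show ?case
  proof (cases "F = UNIV")
    case True
    then show ?thesis by (simp add: moebius.simps span_sum_refl spanning_def rk_def)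
  next
    case False
    let ?A = "{Z. flat Z \<and> F \<subset> Z}"
    have "moebius {Z. flat Z} F UNIV = - (\<Sum>Z\<in>?A. moebius {Z. flat Z} Z UNIV)"
      using False by (subst moebius.simps) auto
    also have "(\<Sum>Z\<in>?A. moebius {Z. flat Z} Z UNIV) = (\<Sum>Z\<in>?A. span_sum Z UNIV)"
      by (intro sum.cong less) (auto intro!: psubset_card_mono)
    also have "{Z. flat Z \<and> F \<subseteq> Z} = insert F ?A" using less.prems by auto
    then have "- (\<Sum>Z\<in>?A. span_sum Z UNIV) = span_sum F UNIV"
      using sum_span_sum_flats[OF less.prems] False by simp
    finally show ?thesis .
  qed
qed

end

section \<open>Dimensions of quotients\<close>

definition restr :: "'a set \<Rightarrow> ('a \<Rightarrow>\<^sub>0 'b::zero) \<Rightarrow> ('a \<Rightarrow>\<^sub>0 'b)" where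
  "restr A v = Poly_Mapping.mapp (\<lambda>k x. x when k \<in> A) v"

lemma lookup_restr: "lookup (restr A v) k = (lookup v k when k \<in> A)"
  by (auto simp: restr_def lookup_mapp when_def in_keys_iff)

lemma keys_restr: "keys (restr A v) = keys v \<inter> A"
  by (auto simp: in_keys_iff lookup_restr)

lemma restr_add: "restr A (v + w) = restr A v + restr A w"
  by (rule poly_mapping_eqI) (simp add: lookup_restr lookup_add when_def)

lemma restr_fscale: "restr A (fscale c v) = fscale c (restr A v)"
  by (rule poly_mapping_eqI) (simp add: lookup_restr lookup_fscale when_def)

lemma restr_restr: "restr A (restr B v) = restr (A \<inter> B) v"
  by (rule poly_mapping_eqI) (simp add: lookup_restr when_def)

lemma restr_eq_self: "v \<in> free_on A \<Longrightarrow> restr A v = v"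
  by (rule poly_mapping_eqI) (auto simp: lookup_restr when_def free_on_def in_keys_iff)

lemma restr_eq_0: "v \<in> free_on B \<Longrightarrow> A \<inter> B = {} \<Longrightarrow> restr A v = 0"
  by (rule poly_mapping_eqI) (auto simp: lookup_restr when_def free_on_def in_keys_iff)

lemma restr_in_free_on: "restr A v \<in> free_on A"
  by (auto simp: free_on_def keys_restr)

lemma restr_Un: "A \<inter> B = {} \<Longrightarrow> restr (A \<union> B) v = restr A v + restr B v"
  by (rule poly_mapping_eqI) (auto simp: lookup_restr lookup_add when_def)

lemma free_on_add: "v \<in> free_on A \<Longrightarrow> w \<in> free_on A \<Longrightarrow> v + w \<in> free_on A"
  using keys_add[of v w] by (auto simp: free_on_def)

lemma subspace_free_on: "fmod.subspace (free_on A)"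
proof -
  have "keys (fscale c v) \<subseteq> keys v" for c :: 'a and v by (auto simp: in_keys_iff lookup_fscale)
  then show ?thesis
    by (intro fmod.subspaceI free_on_add) (auto simp: free_on_def)
qed

lemma lin_ext_superset:
  assumes "finite A" "keys v \<subseteq> A"
  shows "lin_ext D v = (\<Sum>b\<in>A. fscale (lookup v b) (D b))"
  unfolding lin_ext_def
  using assms by (intro sum.mono_neutral_left) (auto simp: in_keys_iff)

lemma lin_ext_add: "lin_ext D (v + w) = lin_ext D v + lin_ext D w"
  using keys_add[of v w]
  by (simp add: lin_ext_superset[where A = "keys v \<union> keys w"] lookup_add
      fmod.scale_left_distrib sum.distrib)

lemma lin_ext_fscale: "lin_ext D (fscale c v) = fscale c (lin_ext D v)"
proof -
  have "keys (fscale c v) \<subseteq> keys v" by (auto simp: in_keys_iff lookup_fscale)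
  then show ?thesis
    by (simp add: lin_ext_superset[where A = "keys v"] lookup_fscale fmod.scale_sum_right)
qed

lemma lin_ext_single: "lin_ext D (single b c) = fscale c (D b)"
  by (simp add: lin_ext_def)

lemma module_hom_lin_ext: "module_hom fscale fscale (lin_ext D)"
  by unfold_locales (auto simp: lin_ext_add lin_ext_fscale)

lemma lin_ext_diff: "lin_ext D (v - w) = lin_ext D v - lin_ext D w"
  by (rule module_hom.diff[OF module_hom_lin_ext])

lemma lin_ext_zero: "lin_ext D 0 = 0"
  by (simp add: lin_ext_def)

lemma keys_lin_ext: "keys (lin_ext D v) \<subseteq> (\<Union>b\<in>keys v. keys (D b))"
proof -
  have "keys (lin_ext D v) \<subseteq> (\<Union>b\<in>keys v. keys (fscale (lookup v b) (D b)))"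
    unfolding lin_ext_def by (rule keys_sum)
  also have "\<dots> \<subseteq> (\<Union>b\<in>keys v. keys (D b))"
    by (intro UN_mono) (auto simp: in_keys_iff lookup_fscale)
  finally show ?thesis .
qed

text \<open>\<open>V / (V \<inter> W)\<close> has dimension \<open>n\<close>.  The explicit family \<open>e\<close> makes it immediate to transport the
dimension along linear maps and to add dimensions in a tower.\<close>

definition rdim :: "(nat \<Rightarrow>\<^sub>0 'k::field) set \<Rightarrow> (nat \<Rightarrow>\<^sub>0 'k) set \<Rightarrow> nat \<Rightarrow> bool" where
  "rdim V W n \<longleftrightarrow> (\<exists>e. (\<forall>j<n. e j \<in> V) \<and>
     (\<forall>v\<in>V. \<exists>c. v - (\<Sum>j<n. fscale (c j) (e j)) \<in> W) \<and>
     (\<forall>c. (\<Sum>j<n. fscale (c j) (e j)) \<in> W \<longrightarrow> (\<forall>j<n. c j = 0)))"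

lemma rdimE:
  assumes "rdim V W n"
  obtains e where "\<And>j. j < n \<Longrightarrow> e j \<in> V"
      "\<And>v. v \<in> V \<Longrightarrow> \<exists>c. v - (\<Sum>j<n. fscale (c j) (e j)) \<in> W"
      "\<And>c j. (\<Sum>j<n. fscale (c j) (e j)) \<in> W \<Longrightarrow> j < n \<Longrightarrow> c j = 0"
  using assms that unfolding rdim_def by (elim exE conjE) blast

lemma rdim_0: "V \<subseteq> W \<Longrightarrow> rdim V W 0"
  unfolding rdim_def by auto

lemma span_image_sum:
  assumes "finite I" "x \<in> fmod.span (e ` I)"
  shows "\<exists>c. x = (\<Sum>i\<in>I. fscale (c i) (e i))"
proof -
  have sub: "fmod.subspace {x. \<exists>c. x = (\<Sum>i\<in>I. fscale (c i) (e i))}" (is "fmod.subspace ?X")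
  proof (rule fmod.subspaceI)
    show "0 \<in> ?X" by (auto intro!: exI[of _ "\<lambda>_. 0"])
    fix x y assume "x \<in> ?X" "y \<in> ?X"
    then obtain c d where "x = (\<Sum>i\<in>I. fscale (c i) (e i))" "y = (\<Sum>i\<in>I. fscale (d i) (e i))" by auto
    then have "x + y = (\<Sum>i\<in>I. fscale (c i + d i) (e i))"
      by (simp only: fmod.scale_left_distrib sum.distrib)
    then show "x + y \<in> ?X" by (intro CollectI exI)
  next
    fix a x assume "x \<in> ?X"
    then obtain c where "x = (\<Sum>i\<in>I. fscale (c i) (e i))" by auto
    then have "fscale a x = (\<Sum>i\<in>I. fscale (a * c i) (e i))"
      by (simp only: fmod.scale_sum_right fmod.scale_scale)
    then show "fscale a x \<in> ?X" by (intro CollectI exI)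
  qed
  moreover have "e ` I \<subseteq> ?X"
  proof
    fix x assume "x \<in> e ` I"
    then obtain i where i: "i \<in> I" "x = e i" by auto
    have "x = (\<Sum>j\<in>I. fscale (if j = i then 1 else 0) (e j))"
      using i assms(1) by (subst sum.remove[of _ i]) (auto intro!: sum.neutral)
    then show "x \<in> ?X" by (intro CollectI exI)
  qed
  ultimately have "fmod.span (e ` I) \<subseteq> ?X" by (intro fmod.span_minimal)
  then show ?thesis using assms(2) by auto
qed

text \<open>A linear map that sends the given family to unit vectors and kills \<open>W\<close> takes every basis of the
quotient bijectively to a basis of the span of these unit vectors, so that all of them have \<open>n\<close>
elements.\<close>

lemma rdim_quotient_dim:
  assumes V: "fmod.subspace V" and W: "fmod.subspace W" "W \<subseteq> V" and dim: "rdim V W n"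
  shows "quotient_dim V W = n"
proof -
  obtain e where e: "\<And>j. j < n \<Longrightarrow> e j \<in> V"
      "\<And>v. v \<in> V \<Longrightarrow> \<exists>c. v - (\<Sum>j<n. fscale (c j) (e j)) \<in> W"
      "\<And>c j. (\<Sum>j<n. fscale (c j) (e j)) \<in> W \<Longrightarrow> j < n \<Longrightarrow> c j = 0"
    using rdimE[OF dim] by blast
  obtain BW where BW: "BW \<subseteq> W" "fmod.independent BW" "W \<subseteq> fmod.span BW"
    by (metis fvs.maximal_independent_subset)
  have spBW: "fmod.span BW = W" using BW W by (metis fmod.span_minimal subset_antisym)
  have notin: "(\<Sum>j<m. fscale (c j) (e j)) + w \<noteq> e m" if "m < n" "w \<in> W" for m c w
  proof
    assume eq: "(\<Sum>j<m. fscale (c j) (e j)) + w = e m"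
    define c' where "c' j = (if j < m then - c j else if j = m then 1 else 0)" for j
    have "(\<Sum>j<n. fscale (c' j) (e j)) = (\<Sum>j<Suc m. fscale (c' j) (e j))"
      using that by (intro sum.mono_neutral_right) (auto simp: c'_def)
    also have "\<dots> = e m - (\<Sum>j<m. fscale (c j) (e j))"
      by (simp add: c'_def sum_negf)
    also have "\<dots> = w" using eq by (simp add: algebra_simps)
    finally have "c' m = 0" using e(3)[of c' m] that by simp
    then show False by (simp add: c'_def)
  qed
  have ind: "fmod.independent (e ` {..<m} \<union> BW) \<and> inj_on e {..<m} \<and> e ` {..<m} \<inter> W = {}"
    if "m \<le> n" for m
    using that
  proof (induction m)
    case 0
    then show ?case using BW by simp
  next
    case (Suc m)
    have "e m \<notin> fmod.span (e ` {..<m} \<union> BW)"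
    proof
      assume "e m \<in> fmod.span (e ` {..<m} \<union> BW)"
      then obtain x w where "e m = x + w" "x \<in> fmod.span (e ` {..<m})" "w \<in> W"
        unfolding fmod.span_Un spBW by auto
      then show False using span_image_sum[of "{..<m}" x e] notin[of m w] Suc.prems by auto
    qed
    moreover have "e m \<notin> W"
      using notin[of m "e m" "\<lambda>_. 0"] Suc.prems by auto
    ultimately show ?case
      using Suc fvs.independent_insert[of "e m" "e ` {..<m} \<union> BW"] fmod.span_superset[of "e ` {..<m} \<union> BW"]
      by (auto simp: lessThan_Suc)
  qed
  define E where "E = e ` {..<n}"
  have indE: "fmod.independent (E \<union> BW)" "inj_on e {..<n}" "E \<inter> W = {}"
    using ind[of n] by (auto simp: E_def)
  have "E \<subseteq> V" using e(1) by (auto simp: E_def)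
  have qb: "quotient_basis V W E"
    unfolding quotient_basis_def
  proof (intro conjI)
    show "E \<subseteq> V" by fact
    show "fmod.independent E" using indE fmod.independent_mono by blast
    have "x = 0" if "x \<in> fmod.span E" "x \<in> W" for x
    proof -
      obtain c where c: "x = (\<Sum>j<n. fscale (c j) (e j))"
        using span_image_sum[of "{..<n}" x e] \<open>x \<in> fmod.span E\<close> by (auto simp: E_def)
      then show ?thesis using e(3)[of c] that by simp
    qed
    then show "fmod.span E \<inter> W = {0}"
      using fmod.span_zero fmod.subspace_0[OF W(1)] by auto
    show "V \<subseteq> fmod.span (E \<union> W)"
    proof
      fix v assume "v \<in> V"
      then obtain c where c: "v - (\<Sum>j<n. fscale (c j) (e j)) \<in> W" using e(2) by blast
      have "(\<Sum>j<n. fscale (c j) (e j)) \<in> fmod.span (E \<union> W)"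
        by (intro fmod.span_sum fmod.span_scale fmod.span_base) (auto simp: E_def)
      from fmod.span_add[OF fmod.span_base this] c
      show "v \<in> fmod.span (E \<union> W)" by (metis UnI2 diff_add_cancel)
    qed
  qed
  interpret vp: vector_space_pair "fscale :: 'a \<Rightarrow> _" "fscale :: 'a \<Rightarrow> (nat \<Rightarrow>\<^sub>0 'a) \<Rightarrow> _" ..
  \<comment> \<open>\<open>g\<close> extends the map \<open>e j \<mapsto> single j 1\<close> by \<open>0\<close> on \<open>W\<close>.\<close>
  define g0 where "g0 x = (if x \<in> E then single (the_inv_into {..<n} e x) (1::'a) else 0)" for x
  obtain g where g: "Vector_Spaces.linear fscale fscale g" "\<And>x. x \<in> E \<union> BW \<Longrightarrow> g x = g0 x"
    using vp.linear_independent_extend[OF indE(1), of g0] by blast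
  interpret g: Vector_Spaces.linear fscale fscale g by fact
  have ge: "g (e j) = single j 1" if "j < n" for j
    using that g(2)[of "e j"] indE(2) by (auto simp: g0_def E_def the_inv_into_f_f)
  have gW: "g w = 0" if "w \<in> W" for w
  proof -
    have "w \<in> fmod.span BW" using that spBW by simp
    moreover have "g x = 0" if "x \<in> BW" for x
      using that g(2)[of x] BW(1) indE(3) by (auto simp: g0_def)
    ultimately show ?thesis using vp.linear_eq_0_on_span[OF g(1), of BW w] by blast
  qed
  have card: "card B = n" if B: "quotient_basis V W B" for B
  proof -
    have B': "B \<subseteq> V" "fmod.independent B" "fmod.span B \<inter> W = {0}" "V \<subseteq> fmod.span (B \<union> W)"
      using B by (auto simp: quotient_basis_def)
    have spB: "fmod.span B \<subseteq> V" by (meson B'(1) V fmod.span_minimal)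
    have gsum: "g (\<Sum>j<n. fscale (c j) (e j)) = (\<Sum>j<n. single j (c j))" for c
      by (simp add: g.sum g.scale ge) (intro sum.cong refl poly_mapping_eqI, simp add: lookup_fscale lookup_single when_def)
    have gV: "\<exists>c. v - (\<Sum>j<n. fscale (c j) (e j)) \<in> W \<and> g v = (\<Sum>j<n. single j (c j))" if "v \<in> V" for v
    proof -
      obtain c where c: "v - (\<Sum>j<n. fscale (c j) (e j)) \<in> W" using e(2) \<open>v \<in> V\<close> by blast
      then have "g v = g (\<Sum>j<n. fscale (c j) (e j))" using gW[OF c] by (simp add: g.diff)
      with c gsum show ?thesis by auto
    qed
    have inj: "inj_on g (fmod.span B)"
    proof (subst g.inj_on_iff_eq_0[OF fmod.subspace_span], intro ballI impI)
      fix x assume x: "x \<in> fmod.span B" "g x = 0"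
      then obtain c where c: "x - (\<Sum>j<n. fscale (c j) (e j)) \<in> W" "g x = (\<Sum>j<n. single j (c j))"
        using gV spB by blast
      have "c i = 0" if "i < n" for i
      proof -
        have "lookup (\<Sum>j<n. single j (c j)) i = c i"
          using that by (simp add: lookup_sum lookup_single when_def)
        then show ?thesis using c(2) x by simp
      qed
      then have "x \<in> W" using c(1) by simp
      then show "x = 0" using x B'(3) by blast
    qed
    let ?U = "(\<lambda>j. single j (1::'a)) ` {..<n}"
    have "fmod.span (g ` B) = fmod.span ?U"
    proof (intro subset_antisym fmod.span_minimal fmod.subspace_span)
      show "g ` B \<subseteq> fmod.span ?U"
      proof safe
        fix b assume "b \<in> B"
        then obtain c where c: "g b = (\<Sum>j<n. single j (c j))" using gV B'(1) by blast
        have "(\<Sum>j<n. single j (c j)) = (\<Sum>j<n. fscale (c j) (single j 1))"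
          by (intro sum.cong refl poly_mapping_eqI, simp add: lookup_fscale lookup_single when_def)
        also have "\<dots> \<in> fmod.span ?U"
          by (intro fmod.span_sum fmod.span_scale fmod.span_base) auto
        finally show "g b \<in> fmod.span ?U" using c by simp
      qed
      show "?U \<subseteq> fmod.span (g ` B)"
      proof safe
        fix j assume j: "j < n"
        then have "e j \<in> fmod.span (B \<union> W)" using e(1) B'(4) by blast
        then obtain x w where xw: "e j = x + w" "x \<in> fmod.span B" "w \<in> W"
          unfolding fmod.span_Un fmod.span_eq_iff[THEN iffD2, OF W(1)] by auto
        then have "single j 1 = g x" using ge[OF j] gW[of w] by (simp add: g.add)
        also have "\<dots> \<in> fmod.span (g ` B)" using xw(2) by (simp add: g.span_image)
        finally show "single j (1::'a) \<in> fmod.span (g ` B)" .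
      qed
    qed
    moreover have "fmod.independent (g ` B)"
      using g.independent_injective_image[OF B'(2) inj] .
    moreover have "fmod.independent ?U"
    proof -
      have "\<forall>x\<in>?U. c x = 0" if "(\<Sum>x\<in>?U. fscale (c x) x) = 0" for c
      proof safe
        fix j assume "j < n"
        have "inj_on (\<lambda>j. single j (1::'a)) {..<n}" by (auto simp: inj_on_def dest!: arg_cong[where f = keys])
        then have "(\<Sum>x\<in>?U. fscale (c x) x) = (\<Sum>j<n. fscale (c (single j 1)) (single j 1))"
          by (simp add: sum.reindex)
        then have "lookup (\<Sum>j<n. fscale (c (single j 1)) (single j 1)) j = 0" using that by simp
        then show "c (single j 1) = 0" using \<open>j < n\<close>
          by (simp add: lookup_sum lookup_fscale lookup_single when_def if_distrib cong: if_cong)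
      qed
      then show ?thesis unfolding fmod.dependent_finite[OF finite_imageI[OF finite_lessThan]] by blast
    qed
    ultimately have "card (g ` B) = card ?U"
      by (metis fvs.dim_span_eq_card_independent)
    moreover have "card (g ` B) = card B" using inj fmod.span_superset by (intro card_image) (rule inj_on_subset)
    moreover have "card ?U = n" by (subst card_image) (auto simp: inj_on_def dest!: arg_cong[where f = keys])
    ultimately show ?thesis by simp
  qed
  show ?thesis unfolding quotient_dim_def using card someI_ex[of "quotient_basis V W"] qb by blast
qed

lemma rdim_tower:
  assumes W: "fmod.subspace W" and sub: "W \<subseteq> U" "U \<subseteq> V" and U: "fmod.subspace U"
    and "rdim U W n" "rdim V U m"
  shows "rdim V W (n + m)"
proof -
  obtain e where e: "\<And>j. j < n \<Longrightarrow> e j \<in> U"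
      "\<And>v. v \<in> U \<Longrightarrow> \<exists>c. v - (\<Sum>j<n. fscale (c j) (e j)) \<in> W"
      "\<And>c j. (\<Sum>j<n. fscale (c j) (e j)) \<in> W \<Longrightarrow> j < n \<Longrightarrow> c j = 0"
    using rdimE[OF \<open>rdim U W n\<close>] by blast
  obtain f where f: "\<And>j. j < m \<Longrightarrow> f j \<in> V"
      "\<And>v. v \<in> V \<Longrightarrow> \<exists>c. v - (\<Sum>j<m. fscale (c j) (f j)) \<in> U"
      "\<And>c j. (\<Sum>j<m. fscale (c j) (f j)) \<in> U \<Longrightarrow> j < m \<Longrightarrow> c j = 0"
    using rdimE[OF \<open>rdim V U m\<close>] by blast
  have split: "(\<Sum>j<n + m. g j) = (\<Sum>j<n. g j) + (\<Sum>j<m. g (n + j))" for g :: "nat \<Rightarrow> nat \<Rightarrow>\<^sub>0 'a"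
    by (induction m) (auto simp: add.assoc)
  define h where "h j = (if j < n then e j else f (j - n))" for j
  have hsum: "(\<Sum>j<n + m. fscale (c j) (h j)) =
      (\<Sum>j<n. fscale (c j) (e j)) + (\<Sum>j<m. fscale (c (n + j)) (f j))" for c
    by (simp add: split h_def)
  show ?thesis
    unfolding rdim_def
  proof (intro exI[of _ h] conjI allI ballI impI)
    fix j assume "j < n + m"
    then show "h j \<in> V" using e(1) f(1) sub by (auto simp: h_def)
  next
    fix v assume "v \<in> V"
    then obtain c where c: "v - (\<Sum>j<m. fscale (c j) (f j)) \<in> U" using f(2) by blast
    then obtain d where d: "v - (\<Sum>j<m. fscale (c j) (f j)) - (\<Sum>j<n. fscale (d j) (e j)) \<in> W"
      using e(2) by blast
    have "(\<Sum>j<n + m. fscale (if j < n then d j else c (j - n)) (h j)) =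
        (\<Sum>j<n. fscale (d j) (e j)) + (\<Sum>j<m. fscale (c j) (f j))"
      by (simp add: hsum)
    with d have "v - (\<Sum>j<n + m. fscale (if j < n then d j else c (j - n)) (h j)) \<in> W"
      by (simp only:) (simp add: algebra_simps)
    then show "\<exists>c. v - (\<Sum>j<n + m. fscale (c j) (h j)) \<in> W"
      by (rule exI[where x = "\<lambda>j. if j < n then d j else c (j - n)"])
  next
    fix c j assume c: "(\<Sum>j<n + m. fscale (c j) (h j)) \<in> W" and j: "j < n + m"
    have eU: "(\<Sum>j<n. fscale (c j) (e j)) \<in> U"
      by (intro fmod.subspace_sum[OF U] fmod.subspace_scale[OF U]) (use e(1) in auto)
    have "(\<Sum>j<m. fscale (c (n + j)) (f j)) \<in> U"
      using fmod.subspace_diff[OF U subsetD[OF sub(1) c] eU] by (simp add: hsum)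
    from f(3)[OF this] have 0: "c (n + j) = 0" if "j < m" for j using that by auto
    then have "(\<Sum>j<n. fscale (c j) (e j)) \<in> W" using c by (simp add: hsum)
    with e(3) 0[of "j - n"] j show "c j = 0"
      by (cases "j < n") auto
  qed
qed

lemma rdim_image:
  assumes f: "module_hom fscale fscale f" and "\<And>v. v \<in> V \<Longrightarrow> f v \<in> V'"
    and "\<And>v'. v' \<in> V' \<Longrightarrow> \<exists>v\<in>V. f v = v'" and "fmod.subspace V"
    and W: "\<And>v. v \<in> V \<Longrightarrow> f v \<in> W' \<longleftrightarrow> v \<in> W" and "rdim V W n"
  shows "rdim V' W' n"
proof -
  interpret f: module_hom fscale fscale f by fact
  obtain e where e: "\<And>j. j < n \<Longrightarrow> e j \<in> V"
      "\<And>v. v \<in> V \<Longrightarrow> \<exists>c. v - (\<Sum>j<n. fscale (c j) (e j)) \<in> W"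
      "\<And>c j. (\<Sum>j<n. fscale (c j) (e j)) \<in> W \<Longrightarrow> j < n \<Longrightarrow> c j = 0"
    using rdimE[OF \<open>rdim V W n\<close>] by blast
  have sumV: "(\<Sum>j<n. fscale (c j) (e j)) \<in> V" for c
    by (intro fmod.subspace_sum[OF \<open>fmod.subspace V\<close>] fmod.subspace_scale[OF \<open>fmod.subspace V\<close>]) (use e(1) in auto)
  have fsum: "f (\<Sum>j<n. fscale (c j) (e j)) = (\<Sum>j<n. fscale (c j) (f (e j)))" for c
    by (simp add: f.sum f.scale)
  show ?thesis
    unfolding rdim_def
  proof (intro exI[of _ "\<lambda>j. f (e j)"] conjI allI ballI impI)
    fix v' assume "v' \<in> V'"
    then obtain v where v: "v \<in> V" "f v = v'" using assms(3) by blast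
    then obtain c where "v - (\<Sum>j<n. fscale (c j) (e j)) \<in> W" using e(2) by blast
    then have "f (v - (\<Sum>j<n. fscale (c j) (e j))) \<in> W'"
      using W fmod.subspace_diff[OF \<open>fmod.subspace V\<close> v(1) sumV] by blast
    then show "\<exists>c. v' - (\<Sum>j<n. fscale (c j) (f (e j))) \<in> W'" using v by (auto simp: f.diff fsum)
  next
    fix c j assume "(\<Sum>j<n. fscale (c j) (f (e j))) \<in> W'" "j < n"
    then show "c j = 0" using e(3)[of c j] W[OF sumV, of c] by (simp add: fsum)
  qed (use assms e in auto)
qed

text \<open>Preimages of the given family exist only up to \<open>W'\<close>, but since \<open>W\<close> is the full preimage of \<open>W'\<close>, they
still represent a basis.\<close>

lemma rdim_preimage:
  assumes f: "module_hom fscale fscale f" and "\<And>v. v \<in> V \<Longrightarrow> f v \<in> V'"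
    and onto: "\<And>v'. v' \<in> V' \<Longrightarrow> \<exists>v\<in>V. f v - v' \<in> W'"
    and V: "fmod.subspace V" and W': "fmod.subspace W'"
    and W: "\<And>v. v \<in> V \<Longrightarrow> f v \<in> W' \<longleftrightarrow> v \<in> W" and "rdim V' W' n"
  shows "rdim V W n"
proof -
  interpret f: module_hom fscale fscale f by fact
  obtain e' where e': "\<And>j. j < n \<Longrightarrow> e' j \<in> V'"
      "\<And>v. v \<in> V' \<Longrightarrow> \<exists>c. v - (\<Sum>j<n. fscale (c j) (e' j)) \<in> W'"
      "\<And>c j. (\<Sum>j<n. fscale (c j) (e' j)) \<in> W' \<Longrightarrow> j < n \<Longrightarrow> c j = 0"
    using rdimE[OF \<open>rdim V' W' n\<close>] by blast
  obtain e where e: "\<And>j. j < n \<Longrightarrow> e j \<in> V" "\<And>j. j < n \<Longrightarrow> f (e j) - e' j \<in> W'"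
    using onto[OF e'(1)] by metis
  have sumV: "(\<Sum>j<n. fscale (c j) (e j)) \<in> V" for c
    by (intro fmod.subspace_sum[OF V] fmod.subspace_scale[OF V]) (use e(1) in auto)
  have fsum: "f (\<Sum>j<n. fscale (c j) (e j)) - (\<Sum>j<n. fscale (c j) (e' j)) \<in> W'" for c
  proof -
    have "f (\<Sum>j<n. fscale (c j) (e j)) - (\<Sum>j<n. fscale (c j) (e' j)) =
        (\<Sum>j<n. fscale (c j) (f (e j) - e' j))"
      by (simp add: f.sum f.scale sum_subtractf fmod.scale_right_diff_distrib)
    also have "\<dots> \<in> W'"
      by (intro fmod.subspace_sum[OF W'] fmod.subspace_scale[OF W']) (use e(2) in auto)
    finally show ?thesis .
  qed
  show ?thesis
    unfolding rdim_def
  proof (intro exI[of _ e] conjI allI ballI impI)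
    fix v assume v: "v \<in> V"
    then obtain c where c: "f v - (\<Sum>j<n. fscale (c j) (e' j)) \<in> W'" using e'(2) assms(2) by blast
    have "f (v - (\<Sum>j<n. fscale (c j) (e j))) \<in> W'"
      using fmod.subspace_diff[OF W' c fsum[of c]] by (simp add: f.diff)
    then show "\<exists>c. v - (\<Sum>j<n. fscale (c j) (e j)) \<in> W"
      using W fmod.subspace_diff[OF V v sumV] by blast
  next
    fix c j assume "(\<Sum>j<n. fscale (c j) (e j)) \<in> W" and j: "j < n"
    then have "f (\<Sum>j<n. fscale (c j) (e j)) \<in> W'" using W sumV by blast
    from fmod.subspace_diff[OF W' this fsum[of c]] have "(\<Sum>j<n. fscale (c j) (e' j)) \<in> W'" by simp
    with e'(3) j show "c j = 0" by blast
  qed (use e in auto)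
qed

section \<open>Short exact sequences of complexes of based vector spaces\<close>

text \<open>A family \<open>X\<close> of subsets of the bases describes a subquotient of a complex; its differential is
that of the complex followed by the projection to the span of \<open>X\<close>.  In homological degree \<open>0\<close> the
differential is \<open>0\<close>, so that cycles have a uniform description.\<close>

definition dX :: "(nat \<Rightarrow> nat \<Rightarrow> (nat \<Rightarrow>\<^sub>0 'k::field)) \<Rightarrow> (nat \<Rightarrow> nat set) \<Rightarrow> nat \<Rightarrow>
    (nat \<Rightarrow>\<^sub>0 'k) \<Rightarrow> (nat \<Rightarrow>\<^sub>0 'k)" where
  "dX D X i v = (case i of 0 \<Rightarrow> 0 | Suc j \<Rightarrow> restr (X j) (lin_ext (D j) v))"

definition cyc where "cyc D X i = {v \<in> free_on (X i). dX D X i v = 0}"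

definition bnd where "bnd D X i = dX D X (Suc i) ` free_on (X (Suc i))"

abbreviation "exact_at D X i \<equiv> cyc D X i \<subseteq> bnd D X i"

lemma module_hom_dX: "module_hom fscale fscale (dX D X i)"
  by unfold_locales (auto simp: dX_def lin_ext_add lin_ext_fscale restr_add restr_fscale split: nat.splits)

lemmas dX_add = module_hom.add[OF module_hom_dX]
lemmas dX_diff = module_hom.diff[OF module_hom_dX]
lemmas dX_neg = module_hom.neg[OF module_hom_dX]

lemma dX_in: "dX D X (Suc i) v \<in> free_on (X i)"
  by (simp add: dX_def restr_in_free_on)

lemma subspace_cyc: "fmod.subspace (cyc D X i)"
proof -
  have "cyc D X i = free_on (X i) \<inter> dX D X i -` {0}" by (auto simp: cyc_def)
  then show ?thesis
    using module_hom.subspace_vimage[OF module_hom_dX, of "{0}" D X i]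
    by (auto intro!: fmod.subspace_inter subspace_free_on)
qed

lemma subspace_bnd: "fmod.subspace (bnd D X i)"
  unfolding bnd_def by (intro module_hom.subspace_image[OF module_hom_dX] subspace_free_on)

text \<open>The subquotient on \<open>X\<close> is an extension of the one on \<open>Q\<close> by the one on \<open>A\<close>: the differential maps the
span of \<open>A\<close> to itself.\<close>

locale short_exact =
  fixes D :: "nat \<Rightarrow> nat \<Rightarrow> (nat \<Rightarrow>\<^sub>0 'k::field)" and X A Q :: "nat \<Rightarrow> nat set"
  assumes Un: "X i = A i \<union> Q i" and disj: "A i \<inter> Q i = {}"
    and subcomplex: "v \<in> free_on (A i) \<Longrightarrow> dX D Q i v = 0"
    and complex: "v \<in> free_on (X (Suc i)) \<Longrightarrow> dX D X i (dX D X (Suc i) v) = 0"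
begin

lemma freeA: "v \<in> free_on (A i) \<Longrightarrow> v \<in> free_on (X i)"
  and freeQ: "v \<in> free_on (Q i) \<Longrightarrow> v \<in> free_on (X i)"
  using Un by (auto simp: free_on_def)

lemma dX_split: "dX D X i v = dX D A i v + dX D Q i v"
  by (cases i) (simp_all add: dX_def Un restr_Un[OF disj])

lemma dX_A: "v \<in> free_on (A i) \<Longrightarrow> dX D X i v = dX D A i v"
  by (simp add: dX_split subcomplex)

lemma split: "v \<in> free_on (X i) \<Longrightarrow> v = restr (A i) v + restr (Q i) v"
  using restr_Un[OF disj, of i v] restr_eq_self[of v "X i"] by (simp add: Un)

lemma dX_Q: "dX D Q (Suc i) v = restr (Q i) (dX D X (Suc i) v)"
proof -
  have "Q i \<inter> X i = Q i" using Un by auto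
  then show ?thesis by (simp add: dX_def restr_restr)
qed

lemma dX_Q_restr:
  assumes "v \<in> free_on (X i)" shows "dX D Q i (restr (Q i) v) = dX D Q i v"
  using split[OF assms] subcomplex[OF restr_in_free_on[of "A i" v]] dX_add[of D Q i]
  by (metis add_0)

lemma bnd_cyc_X: "bnd D X i \<subseteq> cyc D X i"
  using complex dX_in by (auto simp: bnd_def cyc_def)

lemma cycQ_dX: "v \<in> cyc D Q i \<Longrightarrow> dX D X i v = dX D A i v"
  by (simp add: cyc_def dX_split)

lemma connecting_cycle:
  assumes "v \<in> cyc D Q (Suc j)" shows "dX D A (Suc j) v \<in> cyc D A j"
proof -
  have "v \<in> free_on (X (Suc j))" using assms freeQ by (auto simp: cyc_def)
  from complex[OF this] have "dX D X j (dX D A (Suc j) v) = 0" by (simp add: cycQ_dX[OF assms])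
  then show ?thesis using dX_A[of "dX D A (Suc j) v" j] dX_in[of D A j v] by (simp add: cyc_def)
qed

text \<open>The connecting map sends a cycle \<open>v\<close> of \<open>Q\<close> to \<open>dX D A i v\<close>.  If this is a boundary of \<open>A\<close>, then \<open>v\<close> is
the image of a cycle of \<open>X\<close>.\<close>

lemma lift_cycle:
  assumes v: "v \<in> cyc D Q i" and u: "u \<in> free_on (A i)" and eq: "dX D A i v = dX D A i u"
  shows "v - u \<in> cyc D X i" "restr (Q i) (v - u) = v"
proof -
  have "v \<in> free_on (Q i)" using v by (auto simp: cyc_def)
  then have "v - u \<in> free_on (X i)"
    using fmod.subspace_diff[OF subspace_free_on freeQ freeA] u by blast
  moreover have "dX D X i (v - u) = 0"
    by (simp add: dX_diff cycQ_dX[OF v] dX_A[OF u] eq)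
  ultimately show "v - u \<in> cyc D X i" by (simp add: cyc_def)
  have "restr (Q i) (v - u) = restr (Q i) (v - u + u) - restr (Q i) u"
    unfolding restr_add by simp
  also have "\<dots> = v"
    using restr_eq_self[OF \<open>v \<in> free_on (Q i)\<close>] restr_eq_0[OF u, of "Q i"] disj[of i] by (simp add: Int_commute)
  finally show "restr (Q i) (v - u) = v" .
qed

lemma restr_bnd: "x \<in> bnd D X i \<Longrightarrow> restr (Q i) x \<in> bnd D Q i"
proof -
  assume "x \<in> bnd D X i"
  then obtain t where t: "t \<in> free_on (X (Suc i))" "x = dX D X (Suc i) t" by (auto simp: bnd_def)
  have "dX D Q (Suc i) (restr (Q (Suc i)) t) = dX D Q (Suc i) t" by (rule dX_Q_restr[OF t(1)])
  also have "\<dots> = restr (Q i) x" by (simp add: dX_Q t(2))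
  finally have "restr (Q i) x = dX D Q (Suc i) (restr (Q (Suc i)) t)" ..
  then show ?thesis using restr_in_free_on by (auto simp: bnd_def)
qed

text \<open>The part \<open>H\<^sub>i(X) \<rightarrow> H\<^sub>i(Q) \<rightarrow> H\<^sub>i\<^sub>-\<^sub>1(A)\<close> of the long exact sequence.\<close>

lemma exact_quotient:
  assumes X: "exact_at D X i" and A: "\<And>j. i = Suc j \<Longrightarrow> exact_at D A j"
  shows "exact_at D Q i"
proof
  fix v assume v: "v \<in> cyc D Q i"
  have "\<exists>u\<in>free_on (A i). dX D A i v = dX D A i u"
  proof (cases i)
    case 0
    then show ?thesis by (auto simp: dX_def free_on_def intro: exI[of _ 0])
  next
    case (Suc j)
    then have "dX D A i v \<in> bnd D A j" using A[OF Suc] connecting_cycle v by blast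
    then show ?thesis using Suc by (auto simp: bnd_def)
  qed
  then obtain u where u: "u \<in> free_on (A i)" "dX D A i v = dX D A i u" by blast
  from lift_cycle[OF v u] show "v \<in> bnd D Q i" using X restr_bnd by (metis subsetD)
qed

text \<open>When \<open>H\<^sub>i(A)\<close> and \<open>H\<^sub>i\<^sub>-\<^sub>1(X)\<close> vanish, the long exact sequence contains the short exact sequence
\<open>0 \<rightarrow> H\<^sub>i(X) \<rightarrow> H\<^sub>i(Q) \<rightarrow> H\<^sub>i\<^sub>-\<^sub>1(A) \<rightarrow> 0\<close>.  The tower used is that of the boundaries of \<open>Q\<close>, the images of
cycles of \<open>X\<close>, and all cycles of \<open>Q\<close>.\<close>

lemma rdim_quotient:
  assumes n: "rdim (cyc D X i) (bnd D X i) n" and A: "exact_at D A i"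
    and m0: "i = 0 \<Longrightarrow> m = 0"
    and m: "\<And>j. i = Suc j \<Longrightarrow> rdim (cyc D A j) (bnd D A j) m"
    and X: "\<And>j. i = Suc j \<Longrightarrow> exact_at D X j"
  shows "rdim (cyc D Q i) (bnd D Q i) (n + m)"
proof -
  define U where "U = restr (Q i) ` cyc D X i"
  have homQ: "module_hom fscale fscale (restr (Q i) :: (nat \<Rightarrow>\<^sub>0 'k) \<Rightarrow> _)"
    by unfold_locales (auto simp: restr_add restr_fscale)
  have UV: "U \<subseteq> cyc D Q i"
  proof -
    have "dX D Q i (restr (Q i) x) = 0" if "x \<in> cyc D X i" for x
    proof -
      have "dX D Q i x = 0"
        using that dX_Q restr_eq_0[of 0 "{}"] by (cases i) (auto simp: cyc_def dX_def free_on_def)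
      then show ?thesis using dX_Q_restr[of x i] that by (simp add: cyc_def)
    qed
    then show ?thesis by (auto simp: U_def cyc_def restr_in_free_on)
  qed
  have WU: "bnd D Q i \<subseteq> U"
  proof
    fix x assume "x \<in> bnd D Q i"
    then obtain u where u: "u \<in> free_on (Q (Suc i))" "x = dX D Q (Suc i) u" by (auto simp: bnd_def)
    then have "x = restr (Q i) (dX D X (Suc i) u)" by (simp add: dX_Q)
    moreover have "dX D X (Suc i) u \<in> cyc D X i" using freeQ[OF u(1)] bnd_cyc_X[of i] unfolding bnd_def by blast
    ultimately show "x \<in> U" by (auto simp: U_def)
  qed
  have subU: "fmod.subspace U"
    unfolding U_def by (intro module_hom.subspace_image[OF homQ] subspace_cyc)
  have mem: "restr (Q i) x \<in> bnd D Q i \<longleftrightarrow> x \<in> bnd D X i" if x: "x \<in> cyc D X i" for x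
  proof
    assume "restr (Q i) x \<in> bnd D Q i"
    then obtain t where t: "t \<in> free_on (Q (Suc i))" "restr (Q i) x = dX D Q (Suc i) t" by (auto simp: bnd_def)
    let ?y = "x - dX D X (Suc i) t"
    have "?y \<in> cyc D X i"
      using fmod.subspace_diff[OF subspace_cyc x] bnd_cyc_X freeQ[OF t(1)] by (auto simp: bnd_def)
    then have y: "?y \<in> free_on (X i)" "dX D X i ?y = 0" by (auto simp: cyc_def)
    have "restr (Q i) ?y = 0"
      using t(2) by (simp add: module_hom.diff[OF homQ] dX_Q)
    then have "?y = restr (A i) ?y" using split[OF y(1)] by simp
    then have yA: "?y \<in> free_on (A i)" using restr_in_free_on by metis
    then have "?y \<in> cyc D A i" using y(2) dX_A[OF yA] by (simp add: cyc_def)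
    then obtain s where s: "s \<in> free_on (A (Suc i))" "?y = dX D A (Suc i) s"
      using A by (auto simp: bnd_def)
    then have "x = dX D X (Suc i) (t + s)" using dX_A[OF s(1)] by (simp add: dX_add algebra_simps)
    then show "x \<in> bnd D X i"
      unfolding bnd_def using free_on_add[OF freeQ[OF t(1)] freeA[OF s(1)]] by blast
  qed (rule restr_bnd)
  have "rdim U (bnd D Q i) n"
    by (rule rdim_image[OF homQ _ _ subspace_cyc mem n]) (auto simp: U_def)
  moreover have "rdim (cyc D Q i) U m"
  proof (cases i)
    case 0
    have "v \<in> U" if "v \<in> cyc D Q i" for v
    proof -
      have "v \<in> free_on (Q i)" using that by (simp add: cyc_def)
      then have "v = restr (Q i) v" "v \<in> cyc D X i"
        using freeQ 0 by (auto simp: restr_eq_self cyc_def dX_def)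
      then show ?thesis by (auto simp: U_def)
    qed
    then show ?thesis using m0[OF 0] by (auto intro: rdim_0)
  next
    case (Suc j)
    show ?thesis
    proof (rule rdim_preimage[OF module_hom_dX[of D A i] _ _ subspace_cyc subspace_bnd _ m[OF Suc]])
      fix v assume v: "v \<in> cyc D Q i"
      show "dX D A i v \<in> cyc D A j" using connecting_cycle v Suc by simp
      show "dX D A i v \<in> bnd D A j \<longleftrightarrow> v \<in> U"
      proof
        assume "dX D A i v \<in> bnd D A j"
        then obtain u where "u \<in> free_on (A i)" "dX D A i v = dX D A i u" by (auto simp: bnd_def Suc)
        from lift_cycle[OF v this] show "v \<in> U" unfolding U_def by (metis imageI)
      next
        assume "v \<in> U"
        then obtain x where x: "x \<in> cyc D X i" "v = restr (Q i) x" by (auto simp: U_def)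
        then have "dX D X i (restr (A i) x) + dX D X i v = 0"
          using split[of x i] dX_add[of D X i "restr (A i) x" v] by (simp add: cyc_def)
        then have "dX D A i v = dX D A i (- restr (A i) x)"
          by (simp add: dX_A[OF restr_in_free_on] cycQ_dX[OF v] dX_neg eq_neg_iff_add_eq_0 add.commute)
        moreover have "- restr (A i) x \<in> free_on (A i)"
          by (intro fmod.subspace_neg[OF subspace_free_on] restr_in_free_on)
        ultimately show "dX D A i v \<in> bnd D A j" unfolding bnd_def Suc by blast
      qed
    next
      fix w assume w: "w \<in> cyc D A j"
      then have wA: "w \<in> free_on (A j)" "dX D A j w = 0" by (auto simp: cyc_def)
      then have "w \<in> cyc D X j" using freeA dX_A by (auto simp: cyc_def)
      then obtain u where u: "u \<in> free_on (X i)" "w = dX D X i u" using X[OF Suc] by (auto simp: bnd_def Suc)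
      let ?v = "restr (Q i) u"
      have "dX D Q i u = restr (Q j) w" using dX_Q[of j u] u Suc by simp
      also have "\<dots> = 0" using restr_eq_0[OF wA(1)] disj by (simp add: Int_commute)
      finally have v: "?v \<in> cyc D Q i"
        by (simp add: cyc_def restr_in_free_on dX_Q_restr[OF u(1)])
      have "w = dX D A i (restr (A i) u) + dX D A i ?v"
        using split[OF u(1)] u(2) dX_add[of D X i "restr (A i) u" ?v] cycQ_dX[OF v] dX_A[OF restr_in_free_on, of i u]
        by simp
      then have "dX D A i ?v - w = dX D A i (- restr (A i) u)" by (simp add: dX_neg)
      moreover have "- restr (A i) u \<in> free_on (A i)"
        by (intro fmod.subspace_neg[OF subspace_free_on] restr_in_free_on)
      ultimately show "\<exists>v\<in>cyc D Q i. dX D A i v - w \<in> bnd D A j"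
        using v unfolding bnd_def Suc by blast
    qed
  qed
  ultimately show ?thesis by (intro rdim_tower[OF subspace_bnd WU UV subU])
qed

end

section \<open>Complexes filtered by multidegrees\<close>

definition zeros :: "int ^ 'n \<Rightarrow> 'n set" where "zeros a = {j. a $ j = 0}"

lemma zeros_indicator [simp]: "zeros (indicator_vec (UNIV - F)) = F"
  by (auto simp: zeros_def indicator_vec_def)

text \<open>The complex arises from a graded free complex over \<open>\<kk>[x]\<close> by setting all \<open>x\<^sub>i\<close> to \<open>1\<close>.  The grading
survives as the condition that matrix entries are nonzero only between elements of comparable
degrees.\<close>

locale filtered_complex = rank_function \<rho> for \<rho> :: "'n::finite set \<Rightarrow> nat" +
  fixes Bs :: "nat \<Rightarrow> nat set" and dg :: "nat \<Rightarrow> nat \<Rightarrow> int ^ 'n"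
    and D :: "nat \<Rightarrow> nat \<Rightarrow> (nat \<Rightarrow>\<^sub>0 'k::field)"
  assumes D_le: "b \<in> Bs (Suc i) \<Longrightarrow> c \<in> keys (D i b) \<Longrightarrow> c \<in> Bs i \<and> (\<forall>j. dg i c $ j \<le> dg (Suc i) b $ j)"
    and D_D: "b \<in> Bs (Suc (Suc i)) \<Longrightarrow> lin_ext (D i) (D (Suc i) b) = 0"
begin

text \<open>For \<open>P = {}\<close> this is the degree \<open>a\<close> part of the complex over \<open>\<kk>[x]\<close>, and for \<open>P = UNIV\<close> it is the degree
\<open>a\<close> part of its reduction modulo all \<open>x\<^sub>i\<close>.  In between, only the \<open>x\<^sub>i\<close> with \<open>i \<in> P\<close> are divided out.\<close>

definition Level :: "'n set \<Rightarrow> int ^ 'n \<Rightarrow> nat \<Rightarrow> nat set" where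
  "Level P a i = {b \<in> Bs i. (\<forall>j. dg i b $ j \<le> a $ j) \<and> (\<forall>j\<in>P. dg i b $ j = a $ j)}"

text \<open>The degrees in which \<open>\<kk>[x]\<close> modulo the squarefree monomial ideal of the matroid is nonzero.\<close>

definition H0_degree :: "int ^ 'n \<Rightarrow> bool" where
  "H0_degree a \<longleftrightarrow> (\<forall>j. 0 \<le> a $ j) \<and> spanning (zeros a)"

lemma lin_ext_lin_ext_eq_0:
  assumes "v \<in> free_on (Bs (Suc (Suc i)))"
  shows "lin_ext (D i) (lin_ext (D (Suc i)) v) = 0"
proof -
  interpret h: module_hom "fscale :: 'k \<Rightarrow> _" fscale "lin_ext (D i)" by (rule module_hom_lin_ext)
  have "lin_ext (D i) (lin_ext (D (Suc i)) v) = (\<Sum>b\<in>keys v. fscale (lookup v b) (lin_ext (D i) (D (Suc i) b)))"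
    by (simp add: lin_ext_def[of "D (Suc i)"] h.sum h.scale)
  also have "\<dots> = 0" using assms D_D by (intro sum.neutral) (auto simp: free_on_def)
  finally show ?thesis .
qed

lemma Level_complex:
  assumes x: "x \<in> free_on (Level P a (Suc i))"
  shows "dX D (Level P a) i (dX D (Level P a) (Suc i) x) = 0"
proof (cases i)
  case (Suc j)
  let ?L = "Level P a"
  \<comment> \<open>The part of \<open>y\<close> outside of \<open>?L i\<close> has degree smaller than \<open>a\<close> at some coordinate in \<open>P\<close>, which remains so
after another differential.\<close>
  define y where "y = lin_ext (D i) x"
  have xB: "x \<in> free_on (Bs (Suc (Suc j)))" using x by (auto simp: free_on_def Level_def Suc)
  have "y = restr (?L i) y + restr (- ?L i) y"
    using restr_Un[of "?L i" "- ?L i" y] by (simp add: restr_eq_self free_on_def)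
  then have "lin_ext (D j) (restr (?L i) y) + lin_ext (D j) (restr (- ?L i) y) = 0"
    using lin_ext_lin_ext_eq_0[OF xB] by (metis lin_ext_add Suc y_def)
  moreover have "restr (?L j) (lin_ext (D j) (restr (- ?L i) y)) = 0"
  proof -
    have "e \<notin> ?L j" if "e \<in> keys (lin_ext (D j) (restr (- ?L i) y))" for e
    proof -
      obtain c where c: "c \<in> keys y" "c \<notin> ?L i" "e \<in> keys (D j c)"
        using \<open>e \<in> _\<close> keys_lin_ext by (fastforce simp: keys_restr)
      obtain b where b: "b \<in> keys x" "c \<in> keys (D i b)" using c keys_lin_ext y_def by blast
      then have "b \<in> ?L (Suc i)" using x by (auto simp: free_on_def)
      then have c': "c \<in> Bs i" "\<And>l. dg i c $ l \<le> a $ l"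
        using D_le[of b i c] b unfolding Level_def by (auto intro: order_trans)
      then obtain l where l: "l \<in> P" "dg i c $ l < a $ l"
        using c(2) unfolding Level_def by (auto simp: order_less_le)
      moreover have "dg j e $ l \<le> dg i c $ l" using D_le[of c j e] c c' Suc by auto
      ultimately show ?thesis by (auto simp: Level_def)
    qed
    then have "keys (restr (?L j) (lin_ext (D j) (restr (- ?L i) y))) = {}" by (auto simp: keys_restr)
    then show ?thesis by simp
  qed
  ultimately have "restr (?L j) (lin_ext (D j) (restr (?L i) y)) = restr (?L j) 0"
    by (metis add.right_neutral restr_add)
  also have "\<dots> = 0" by (intro poly_mapping_eqI) (simp add: lookup_restr)
  finally have "restr (?L j) (lin_ext (D j) (restr (?L i) y)) = 0" .
  then show ?thesis by (simp add: Suc dX_def y_def)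
qed (simp add: dX_def)

text \<open>Multiplication by \<open>x\<^sub>v\<close> is the inclusion of the part in degree \<open>a - e\<^sub>v\<close> into the one in degree \<open>a\<close>.\<close>

lemma short_exact_Level:
  assumes "v \<notin> P"
  shows "short_exact D (Level P a) (Level P (a - axis v 1)) (Level (insert v P) a)"
proof
  fix i
  show "Level P a i = Level P (a - axis v 1) i \<union> Level (insert v P) a i"
    using assms by (auto simp: Level_def axis_def order_less_le)
  show "Level P (a - axis v 1) i \<inter> Level (insert v P) a i = {}"
    by (force simp: Level_def axis_def)
next
  fix i and x :: "nat \<Rightarrow>\<^sub>0 'k" assume x: "x \<in> free_on (Level P (a - axis v 1) i)"
  show "dX D (Level (insert v P) a) i x = 0"
  proof (cases i)
    case (Suc j)
    have "c \<notin> Level (insert v P) a j" if "c \<in> keys (lin_ext (D j) x)" for c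
    proof -
      obtain b where b: "b \<in> keys x" "c \<in> keys (D j b)" using \<open>c \<in> _\<close> keys_lin_ext by blast
      then have "b \<in> Level P (a - axis v 1) (Suc j)" using x Suc by (auto simp: free_on_def)
      then have "b \<in> Bs (Suc j)" "dg (Suc j) b $ v \<le> a $ v - 1"
        unfolding Level_def by (auto simp: axis_def dest: spec[of _ v])
      moreover have "dg j c $ v \<le> dg (Suc j) b $ v" using D_le b calculation by blast
      ultimately show ?thesis by (auto simp: Level_def)
    qed
    then have "keys (restr (Level (insert v P) a j) (lin_ext (D j) x)) = {}" by (auto simp: keys_restr)
    then show ?thesis by (simp add: Suc dX_def)
  qed (simp add: dX_def)
qed (rule Level_complex)

end

text \<open>The complex resolves \<open>\<kk>[x]\<close> modulo the squarefree monomial ideal of the matroid: its homology in degree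
\<open>a\<close> is \<open>\<kk>\<close>, in homological degree \<open>0\<close>, for the degrees described by \<open>H0_degree\<close>, and \<open>0\<close>
otherwise.  The functional \<open>\<epsilon>\<close> identifies all these one-dimensional spaces, compatibly with the
inclusions between different degrees.\<close>

locale filtered_resolution = filtered_complex \<rho> Bs dg D
  for \<rho> :: "'n::finite set \<Rightarrow> nat" and Bs :: "nat \<Rightarrow> nat set" and dg :: "nat \<Rightarrow> nat \<Rightarrow> int ^ 'n"
    and D :: "nat \<Rightarrow> nat \<Rightarrow> (nat \<Rightarrow>\<^sub>0 'k::field)" +
  fixes \<epsilon> :: "(nat \<Rightarrow>\<^sub>0 'k) \<Rightarrow> 'k"
  assumes eps: "module_hom fscale (*) \<epsilon>"
    and exact_pos: "exact_at D (Level {} a) (Suc i)"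
    and exact_0: "\<not> H0_degree a \<Longrightarrow> exact_at D (Level {} a) 0"
    and bnd_0: "H0_degree a \<Longrightarrow> v \<in> free_on (Level {} a 0) \<Longrightarrow> v \<in> bnd D (Level {} a) 0 \<longleftrightarrow> \<epsilon> v = 0"
    and eps_onto: "H0_degree a \<Longrightarrow> \<exists>v\<in>free_on (Level {} a 0). \<epsilon> v = 1"
begin

lemma exact_not_H0_degree: "\<not> H0_degree a \<Longrightarrow> exact_at D (Level {} a) i"
  using exact_pos exact_0 by (cases i) auto

text \<open>In a degree with a negative coordinate there is no homology to begin with, and none is created by
the long exact sequences, as these only involve smaller degrees.\<close>

lemma exact_negative:
  assumes "a $ l < 0" shows "exact_at D (Level P a) i"
  using finite[of P] assms
proof (induction P arbitrary: a i)
  case empty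
  then show ?case by (intro exact_not_H0_degree) (auto simp: H0_degree_def not_le)
next
  case (insert v P)
  interpret short_exact D "Level P a" "Level P (a - axis v 1)" "Level (insert v P) a"
    by (rule short_exact_Level) fact
  have "(a - axis v 1) $ l < 0" using insert.prems by (auto simp: axis_def)
  then show ?case using insert by (intro exact_quotient) auto
qed

text \<open>Passing from \<open>a - e\<^sub>w\<close> to \<open>a\<close> does not change the rank of the set of zeros, so \<open>x\<^sub>w\<close> acts as an isomorphism
between the homologies in these two degrees.\<close>

definition removable :: "'n \<Rightarrow> int ^ 'n \<Rightarrow> bool" where
  "removable w a \<longleftrightarrow> a $ w \<ge> 2 \<or> a $ w = 1 \<and> \<rho> (insert w (zeros a)) = \<rho> (zeros a)"

lemma rank_zeros_removable:
  assumes "removable w a" shows "\<rho> (zeros (a - axis w 1)) = \<rho> (zeros a)"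
proof (cases "a $ w = 1")
  case True
  then have "zeros (a - axis w 1) = insert w (zeros a)" by (auto simp: zeros_def axis_def)
  then show ?thesis using assms True by (simp add: removable_def)
next
  case False
  then have "a $ w \<ge> 2" using assms by (simp add: removable_def)
  then have "zeros (a - axis w 1) = zeros a" by (auto simp: zeros_def axis_def)
  then show ?thesis by simp
qed

lemma H0_degree_removable:
  assumes "removable w a" shows "H0_degree (a - axis w 1) \<longleftrightarrow> H0_degree a"
proof -
  have "a $ w \<ge> 1" using assms by (auto simp: removable_def)
  then have "0 \<le> (a - axis w 1) $ j \<longleftrightarrow> 0 \<le> a $ j" for j by (simp add: axis_def)
  then show ?thesis using rank_zeros_removable[OF assms] by (simp add: H0_degree_def spanning_def)
qed

text \<open>Dividing out \<open>x\<^sub>w\<close> kills all homology, since \<open>x\<^sub>w\<close> acts as an isomorphism.  In homological degrees \<open>0\<close> and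
\<open>1\<close> this uses that \<open>\<epsilon>\<close> is compatible with the inclusion.\<close>

lemma exact_removable_single:
  assumes "removable w a" shows "exact_at D (Level {w} a) i"
proof -
  interpret short_exact D "Level {} a" "Level {} (a - axis w 1)" "Level {w} a"
    using short_exact_Level[of w "{}" a] by simp
  show ?thesis
  proof (cases "H0_degree a")
    case False
    then show ?thesis using H0_degree_removable[OF assms] by (intro exact_quotient exact_not_H0_degree) auto
  next
    case H0_degree: True
    then have H0_degree': "H0_degree (a - axis w 1)" using H0_degree_removable[OF assms] by simp
    interpret eps: module_hom fscale "(*)" \<epsilon> by (rule eps)
    consider "i = 0" | "i = 1" | j where "i = Suc (Suc j)" by (metis One_nat_def not0_implies_Suc)
    then show ?thesis
    proof cases
      case 1
      show ?thesis
      proof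
        fix v assume v: "v \<in> cyc D (Level {w} a) i"
        obtain u where u: "u \<in> free_on (Level {} (a - axis w 1) 0)" "\<epsilon> u = 1" using eps_onto[OF H0_degree'] by blast
        have u': "fscale (\<epsilon> v) u \<in> free_on (Level {} (a - axis w 1) i)"
          using u(1) 1 fmod.subspace_scale[OF subspace_free_on] by blast
        from lift_cycle[OF v u'] have c: "v - fscale (\<epsilon> v) u \<in> cyc D (Level {} a) i"
          "restr (Level {w} a i) (v - fscale (\<epsilon> v) u) = v" by (auto simp: 1 dX_def)
        have "\<epsilon> (v - fscale (\<epsilon> v) u) = 0" by (simp add: eps.diff eps.scale u)
        then have "v - fscale (\<epsilon> v) u \<in> bnd D (Level {} a) i" using c(1) bnd_0[OF H0_degree] 1 by (simp add: cyc_def)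
        then show "v \<in> bnd D (Level {w} a) i" using c(2) restr_bnd by metis
      qed
    next
      case 2
      show ?thesis
      proof
        fix v assume v: "v \<in> cyc D (Level {w} a) i"
        let ?w = "dX D (Level {} (a - axis w 1)) i v"
        have "?w \<in> bnd D (Level {} a) 0"
          using cycQ_dX[OF v] freeQ v 2 unfolding bnd_def cyc_def by (metis (mono_tags, lifting) One_nat_def image_eqI mem_Collect_eq)
        moreover have w: "?w \<in> free_on (Level {} (a - axis w 1) 0)" using 2 dX_in[of _ _ 0] by simp
        ultimately have "\<epsilon> ?w = 0" using bnd_0[OF H0_degree] freeA by blast
        then have "?w \<in> bnd D (Level {} (a - axis w 1)) 0" using bnd_0[OF H0_degree' w] by simp
        then obtain u where u: "u \<in> free_on (Level {} (a - axis w 1) i)" "?w = dX D (Level {} (a - axis w 1)) i u"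
          using 2 by (auto simp: bnd_def)
        from lift_cycle[OF v u] exact_pos[of a 0] 2 show "v \<in> bnd D (Level {w} a) i"
          using restr_bnd by (metis One_nat_def subsetD)
      qed
    next
      case 3
      then show ?thesis using exact_pos by (intro exact_quotient) blast+
    qed
  qed
qed

text \<open>Exactness persists when more variables \<open>x\<^sub>v\<close> are divided out, because \<open>w\<close> stays removable when \<open>a\<close> is
lowered at \<open>v\<close>: closures grow with the set.\<close>

lemma exact_removable:
  assumes "w \<in> P" "removable w a" shows "exact_at D (Level P a) i"
proof -
  have "exact_at D (Level (insert w R) a) i" if "w \<notin> R" "removable w a" for R a i
    using finite[of R] that
  proof (induction R arbitrary: a i)
    case empty
    then show ?case by (simp add: exact_removable_single)
  next
    case (insert v R)
    interpret short_exact D "Level (insert w R) a" "Level (insert w R) (a - axis v 1)" "Level (insert v (insert w R)) a"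
      by (rule short_exact_Level) (use insert in auto)
    have A: "exact_at D (Level (insert w R) (a - axis v 1)) j" for j
    proof (cases "a $ v \<le> 0")
      case True
      then show ?thesis by (intro exact_negative[of _ v]) (simp add: axis_def)
    next
      case False
      have "v \<noteq> w" using insert by auto
      have "zeros a \<subseteq> zeros (a - axis v 1)" using False by (auto simp: zeros_def axis_def)
      then have "removable w (a - axis v 1)"
        using insert.prems(2) \<open>v \<noteq> w\<close> closure_mono[of w "zeros a" "zeros (a - axis v 1)"]
        by (auto simp: removable_def axis_def)
      then show ?thesis using insert by auto
    qed
    have "exact_at D (Level (insert v (insert w R)) a) i"
      using insert A by (intro exact_quotient) auto
    then show ?case by (simp add: insert_commute)
  qed
  from this[of "P - {w}" a i] assms show ?thesis by (simp add: insert_absorb)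
qed

text \<open>The corank of the set of zeros of \<open>a\<close> is preserved by both outer terms of the long exact sequence.
Lowering \<open>a\<close> at \<open>v\<close> adds \<open>v\<close> to the set of zeros; unless \<open>v\<close> is removable, in which case the homology
vanishes anyway, this decreases the corank by one, just as the connecting map decreases the
homological degree.\<close>

lemma homology_concentrated:
  assumes "\<not> exact_at D (Level P a) i"
  shows "(\<forall>j. 0 \<le> a $ j) \<and> i = rk - \<rho> (zeros a)"
  using finite[of P] assms
proof (induction P arbitrary: a i)
  case empty
  then have "i = 0" "H0_degree a" using exact_pos exact_not_H0_degree by (metis not0_implies_Suc)+
  then show ?case by (simp add: H0_degree_def spanning_def)
next
  case (insert v P)
  interpret short_exact D "Level P a" "Level P (a - axis v 1)" "Level (insert v P) a"
    by (rule short_exact_Level) fact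
  have nr: "\<not> removable v a" using exact_removable insert.prems by blast
  from insert.prems exact_quotient consider "\<not> exact_at D (Level P a) i"
    | j where "i = Suc j" "\<not> exact_at D (Level P (a - axis v 1)) j" by blast
  then show ?case
  proof cases
    case 1
    then show ?thesis by (rule insert.IH)
  next
    case 2
    from insert.IH[OF 2(2)] have IH: "\<And>l. 0 \<le> (a - axis v 1) $ l" "j = rk - \<rho> (zeros (a - axis v 1))" by auto
    have "a $ v \<ge> 1" using IH(1)[of v] by (simp add: axis_def)
    then have v: "a $ v = 1" "\<rho> (insert v (zeros a)) = Suc (\<rho> (zeros a))"
      using nr rank_insert_cases[of v "zeros a"] by (auto simp: removable_def)
    have "zeros (a - axis v 1) = insert v (zeros a)" using v(1) by (auto simp: zeros_def axis_def)
    then have "i = rk - \<rho> (zeros a)" using IH(2) 2(1) v(2) le_rk[of "insert v (zeros a)"] by simp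
    moreover have "0 \<le> a $ l" for l using IH(1)[of l] by (simp add: axis_def split: if_splits)
    ultimately show ?thesis by blast
  qed
qed

lemma rdim_base:
  assumes "H0_degree a" shows "rdim (cyc D (Level {} a) 0) (bnd D (Level {} a) 0) 1"
proof -
  interpret eps: module_hom fscale "(*)" \<epsilon> by (rule eps)
  obtain u where u: "u \<in> free_on (Level {} a 0)" "\<epsilon> u = 1" using eps_onto[OF assms] by blast
  show ?thesis
    unfolding rdim_def
  proof (intro exI[of _ "\<lambda>_. u"] conjI allI ballI impI)
    show "u \<in> cyc D (Level {} a) 0" using u by (simp add: cyc_def dX_def)
    fix v assume "v \<in> cyc D (Level {} a) 0"
    then have "v - fscale (\<epsilon> v) u \<in> free_on (Level {} a 0)"
      by (intro fmod.subspace_diff[OF subspace_free_on] fmod.subspace_scale[OF subspace_free_on])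
        (auto simp: cyc_def u)
    moreover have "\<epsilon> (v - fscale (\<epsilon> v) u) = 0" by (simp add: eps.diff eps.scale u)
    ultimately have "v - fscale (\<epsilon> v) u \<in> bnd D (Level {} a) 0" using bnd_0[OF assms] by blast
    then show "\<exists>c. v - (\<Sum>j<1::nat. fscale (c j) u) \<in> bnd D (Level {} a) 0"
      by (intro exI[of _ "\<lambda>_. \<epsilon> v"]) (simp only: One_nat_def sum.lessThan_Suc lessThan_0 sum.empty add_0)
  next
    fix c :: "nat \<Rightarrow> 'k" and j :: nat assume c: "(\<Sum>j<1::nat. fscale (c j) u) \<in> bnd D (Level {} a) 0" "j < 1"
    have "fscale (c 0) u \<in> free_on (Level {} a 0)" using u(1) fmod.subspace_scale[OF subspace_free_on] by blast
    then have "\<epsilon> (fscale (c 0) u) = 0" using c(1) bnd_0[OF assms] by simp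
    then show "c j = 0" using c(2) by (simp add: eps.scale u)
  qed
qed

text \<open>Homology being concentrated, the long exact sequence makes dimensions additive, which is the recursion
\<open>span_sum_insert\<close> up to sign.\<close>

lemma rdim_Level:
  "\<exists>n. rdim (cyc D (Level P (indicator_vec (UNIV - F))) (rk - \<rho> F))
          (bnd D (Level P (indicator_vec (UNIV - F))) (rk - \<rho> F)) n \<and>
       int n = (-1) ^ (rk - \<rho> F) * span_sum F (F \<union> P)"
  using finite[of P]
proof (induction P arbitrary: F)
  case empty
  have "H0_degree (indicator_vec (UNIV - F)) \<longleftrightarrow> spanning F"
    by (simp add: H0_degree_def) (simp add: indicator_vec_def)
  then show ?case
    using rdim_base[of "indicator_vec (UNIV - F)"] exact_not_H0_degree[THEN rdim_0, of "indicator_vec (UNIV - F)"]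
    by (cases "spanning F") (auto simp: span_sum_refl spanning_def)
next
  case (insert v P)
  let ?a = "indicator_vec (UNIV - F)"
  interpret short_exact D "Level P ?a" "Level P (?a - axis v 1)" "Level (insert v P) ?a"
    by (rule short_exact_Level) fact
  have X: "exact_at D (Level P ?a) j" if "rk - \<rho> F \<noteq> j" for j
    using homology_concentrated[of P ?a j] that by auto
  obtain n where n: "rdim (cyc D (Level P ?a) (rk - \<rho> F)) (bnd D (Level P ?a) (rk - \<rho> F)) n"
      "int n = (-1) ^ (rk - \<rho> F) * span_sum F (F \<union> P)"
    using insert.IH by blast
  consider "v \<in> F" | "v \<notin> F" "\<rho> (insert v F) = \<rho> F" | "v \<notin> F" "\<rho> (insert v F) = Suc (\<rho> F)"
    using rank_insert_cases by blast
  then show ?case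
  proof cases
    case 1
    then have neg: "exact_at D (Level P (?a - axis v 1)) j" for j
      by (intro exact_negative[of _ v]) (simp add: indicator_vec_def axis_def)
    have "rdim (cyc D (Level (insert v P) ?a) (rk - \<rho> F)) (bnd D (Level (insert v P) ?a) (rk - \<rho> F)) (n + 0)"
      by (rule rdim_quotient[OF n(1) neg _ rdim_0[OF neg] X]) auto
    moreover have "F \<union> insert v P = F \<union> P" using 1 by auto
    ultimately show ?thesis using n(2) by auto
  next
    case 2
    then have "removable v ?a" by (simp add: removable_def) (simp add: indicator_vec_def)
    moreover have "span_sum F (F \<union> insert v P) = 0" using 2 by (intro span_sum_eq_0[of v]) auto
    ultimately show ?thesis
      using rdim_0[OF exact_removable[of v "insert v P" ?a "rk - \<rho> F"]] by auto
  next
    case 3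
    define j where "j = rk - \<rho> (insert v F)"
    have i: "rk - \<rho> F = Suc j" using 3(2) le_rk[of "insert v F"] by (simp add: j_def)
    have a: "?a - axis v 1 = indicator_vec (UNIV - insert v F)"
      using 3(1) by (simp add: vec_eq_iff indicator_vec_def axis_def)
    obtain m where m: "rdim (cyc D (Level P (?a - axis v 1)) j) (bnd D (Level P (?a - axis v 1)) j) m"
        "int m = (-1) ^ j * span_sum (insert v F) (insert v F \<union> P)"
      unfolding a j_def using insert.IH by blast
    have A: "exact_at D (Level P (?a - axis v 1)) (rk - \<rho> F)"
      using homology_concentrated[of P "?a - axis v 1" "rk - \<rho> F"] i unfolding a by (auto simp: j_def)
    have "rdim (cyc D (Level (insert v P) ?a) (rk - \<rho> F)) (bnd D (Level (insert v P) ?a) (rk - \<rho> F)) (n + m)"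
      by (rule rdim_quotient[OF n(1) A]) (use i m X in auto)
    moreover have "span_sum F (F \<union> P) = span_sum F (F \<union> insert v P) + span_sum (insert v F) (insert v F \<union> P)"
      using span_sum_insert[of v "F \<union> P" F] 3(1) insert.hyps by simp
    then have "int (n + m) = (-1) ^ (rk - \<rho> F) * span_sum F (F \<union> insert v P)"
      using n(2) m(2) i by (simp add: algebra_simps)
    ultimately show ?thesis by blast
  qed
qed

lemma rdim_Level_UNIV:
  "rdim (cyc D (Level UNIV a) i) (bnd D (Level UNIV a) i)
     (if flat (zeros a) \<and> a = indicator_vec (UNIV - zeros a) \<and> i = rk - \<rho> (zeros a)
      then nat \<bar>moebius {Z. flat Z} (zeros a) UNIV\<bar> else 0)" (is "rdim _ _ (if ?c then _ else _)")
proof (cases ?c)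
  case True
  obtain n where n: "rdim (cyc D (Level UNIV a) i) (bnd D (Level UNIV a) i) n"
      "int n = (-1) ^ i * span_sum (zeros a) UNIV"
    using rdim_Level[of UNIV "zeros a"] True by auto
  have "\<bar>int n\<bar> = \<bar>span_sum (zeros a) UNIV\<bar>" unfolding n(2) by (simp add: abs_mult power_abs)
  then have "n = nat \<bar>moebius {Z. flat Z} (zeros a) UNIV\<bar>"
    using moebius_eq_span_sum True by simp
  with n(1) True show ?thesis by simp
next
  case False
  have "exact_at D (Level UNIV a) i"
  proof (rule ccontr)
    assume ne: "\<not> ?thesis"
    then have c: "\<And>j. 0 \<le> a $ j" "i = rk - \<rho> (zeros a)" and nr: "\<And>w. \<not> removable w a"
      using homology_concentrated exact_removable by blast+
    have 01: "a $ j = 0 \<or> a $ j = 1" for j using c(1)[of j] nr[of j] by (auto simp: removable_def)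
    then have "a = indicator_vec (UNIV - zeros a)" by (auto simp: vec_eq_iff indicator_vec_def zeros_def)
    moreover have "flat (zeros a)"
      unfolding flat_def
    proof (intro allI impI)
      fix w assume "w \<notin> zeros a"
      then have "a $ w = 1" using 01 by (auto simp: zeros_def)
      then show "\<rho> (zeros a) < \<rho> (insert w (zeros a))"
        using nr[of w] rank_insert_cases[of w "zeros a"] by (auto simp: removable_def)
    qed
    ultimately show False using False c(2) by blast
  qed
  then show ?thesis using False by (auto intro: rdim_0)
qed

end

section \<open>The polynomial ring\<close>

global_interpretation idl: module "(*) :: 'a::comm_ring_1 \<Rightarrow> 'a \<Rightarrow> 'a"
  by unfold_locales (simp_all add: algebra_simps)

text \<open>As a simplification rule, this would reassociate products to the left, against \<open>mult.assoc\<close>.\<close>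

declare idl.scale_scale [simp del]

abbreviation const :: "'k::zero \<Rightarrow> 'm::zero \<Rightarrow>\<^sub>0 'k" where "const \<equiv> single 0"

lemma const_add: "const (a + b) = const a + const b" by (rule single_add)
lemma const_mult: "const (a * b) = const a * (const b :: 'm::comm_monoid_add \<Rightarrow>\<^sub>0 'k::field)" by (simp add: mult_single)

lemma lookup_const_mult: "lookup (const k * s) m = (k::'k::field) * lookup (s :: 'm::comm_monoid_add \<Rightarrow>\<^sub>0 'k) m"
  by (simp add: mult_map_scale_conv_mult[symmetric] map.rep_eq when_def)

lemma const_mult_single: "const k * single m x = single m ((k::'k::field) * x :: 'k)" for m :: "'m::comm_monoid_add"
  by (simp add: mult_single)

lemma sum_monomials: "(\<Sum>m\<in>keys s. single m (lookup s m)) = s"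
  by (rule poly_mapping_eqI) (simp add: lookup_sum lookup_single when_def in_keys_iff)

lemma lookup_single_mult: "lookup (single n (1::'k::field) * s) (n + m) = lookup s m" for n :: "'n mon"
proof -
  have "lookup (single n (1::'k) * s) (n + m) = (\<Sum>m'\<in>keys s. lookup (single n 1 * single m' (lookup s m')) (n + m))"
    by (simp only: lookup_sum[symmetric] sum_distrib_left[symmetric] sum_monomials)
  also have "\<dots> = (\<Sum>m'\<in>keys s. if m' = m then lookup s m else 0)"
    by (intro sum.cong) (auto simp: mult_single lookup_single when_def)
  also have "\<dots> = lookup s m" by (simp add: in_keys_iff)
  finally show ?thesis .
qed

text \<open>The homomorphism from a polynomial ring given by its values on constants and on monomials.\<close>

locale monomial_hom =
  fixes e :: "'k::field \<Rightarrow> 'r::comm_ring_1" and M :: "'m::comm_monoid_add \<Rightarrow> 'r"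
  assumes e_add: "e (a + b) = e a + e b" and e_mult: "e (a * b) = e a * e b" and e_one: "e 1 = 1"
    and M_0: "M 0 = 1" and M_add: "M (m + m') = M m * M m'"
begin

definition lift :: "('m \<Rightarrow>\<^sub>0 'k) \<Rightarrow> 'r" where
  "lift s = (\<Sum>m\<in>keys s. e (lookup s m) * M m)"

lemma e_zero: "e 0 = 0"
  using e_add[of 0 0] by simp

lemma lift_superset: "finite A \<Longrightarrow> keys s \<subseteq> A \<Longrightarrow> lift s = (\<Sum>m\<in>A. e (lookup s m) * M m)"
  unfolding lift_def by (intro sum.mono_neutral_left) (auto simp: in_keys_iff e_zero)

lemma lift_add: "lift (s + t) = lift s + lift t"
  using keys_add[of s t]
  by (simp add: lift_superset[where A = "keys s \<union> keys t"] lookup_add e_add distrib_right sum.distrib)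

lemma lift_zero: "lift 0 = 0" by (simp add: lift_def)

lemma lift_single: "lift (single m k) = e k * M m"
  by (simp add: lift_def e_zero)

lemma lift_sum: "lift (sum f A) = (\<Sum>x\<in>A. lift (f x))"
  by (induction A rule: infinite_finite_induct) (simp_all add: lift_zero lift_add)

lemma lift_mult: "lift (s * t) = lift s * lift t"
proof -
  have 1: "lift (single m k * t) = lift (single m k) * lift t" for m k
  proof -
    have "single m k * t = (\<Sum>n\<in>keys t. single m k * single n (lookup t n))"
      by (subst sum_distrib_left[symmetric]) (simp add: sum_monomials)
    also have "lift \<dots> = (\<Sum>n\<in>keys t. e k * M m * (e (lookup t n) * M n))"
      by (simp only: lift_sum mult_single lift_single e_mult M_add) (simp add: algebra_simps)
    also have "\<dots> = e k * M m * lift t" by (simp add: lift_def sum_distrib_left)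
    finally show ?thesis by (simp add: lift_single)
  qed
  have "s * t = (\<Sum>m\<in>keys s. single m (lookup s m) * t)"
    by (subst sum_distrib_right[symmetric]) (simp add: sum_monomials)
  also have "lift \<dots> = (\<Sum>m\<in>keys s. lift (single m (lookup s m))) * lift t"
    by (simp only: lift_sum 1 sum_distrib_right)
  also have "\<dots> = lift s * lift t" by (simp only: lift_sum[symmetric] sum_monomials)
  finally show ?thesis .
qed

lemma lift_minus: "lift (- s) = - lift s"
  using lift_add[of s "- s"] by (simp add: lift_zero add_eq_0_iff2 minus_unique)

lemma lift_diff: "lift (s - t) = lift s - lift t"
  using lift_add[of s "- t"] by (simp add: lift_minus)

lemma lift_one: "lift 1 = 1"
  using lift_single[of 0 1] by (simp add: e_one M_0)

lemma lift_power: "lift (s ^ n) = lift s ^ n"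
  by (induction n) (simp_all add: lift_one lift_mult)

lemma lift_prod: "lift (prod f A) = (\<Prod>x\<in>A. lift (f x))"
  by (induction A rule: infinite_finite_induct) (simp_all add: lift_one lift_mult)

end

definition X :: "'n \<Rightarrow> ('n, 'k::field) S" where "X i = single (single (Inl i) 1) 1"
definition Y :: "'n \<Rightarrow> ('n, 'k::field) S" where "Y i = single (single (Inr i) 1) 1"

lemma X_power: "X i ^ n = single (single (Inl i) n) 1"
  by (induction n) (simp_all add: X_def mult_single single_add[symmetric])

lemma Y_power: "Y i ^ n = single (single (Inr i) n) 1"
  by (induction n) (simp_all add: Y_def mult_single single_add[symmetric])

lemma prod_single: "(\<Prod>i\<in>A. single (f i) (1::'k::field)) = single (\<Sum>i\<in>A. f i) 1"
  for f :: "'i \<Rightarrow> 'm::comm_monoid_add"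
  by (induction A rule: infinite_finite_induct) (simp_all add: mult_single)

lemma monomial_eq_prod:
  "single m (1::'k::field) = (\<Prod>i\<in>UNIV. X i ^ lookup m (Inl i) * Y i ^ lookup m (Inr i))" for m :: "'n::finite mon"
proof -
  have "m = (\<Sum>i\<in>UNIV. single (Inl i) (lookup m (Inl i)) + single (Inr i) (lookup m (Inr i)))"
  proof (rule poly_mapping_eqI)
    fix k show "lookup m k = lookup (\<Sum>i\<in>UNIV. single (Inl i) (lookup m (Inl i)) + single (Inr i) (lookup m (Inr i))) k"
      by (cases k) (simp_all add: lookup_sum lookup_add lookup_single when_def)
  qed
  then show ?thesis
    by (simp add: X_power Y_power mult_single prod_single)
qed

subsection \<open>The grading\<close>

lemma lookup_mdeg: "mdeg m $ i = int (lookup m (Inl i)) + int (lookup m (Inr i))"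
  by (simp add: mdeg_def)

lemma mdeg_add: "mdeg (m + m') = mdeg m + mdeg m'"
  by (simp add: vec_eq_iff lookup_mdeg lookup_add)

lemma mdeg_zero: "mdeg 0 = 0"
  by (simp add: vec_eq_iff lookup_mdeg)

lemma homogeneous_add: "homogeneous a s \<Longrightarrow> homogeneous a t \<Longrightarrow> homogeneous a (s + t)"
  using keys_add[of s t] by (auto simp: homogeneous_def)

lemma homogeneous_zero: "homogeneous a 0" by (simp add: homogeneous_def)

lemma homogeneous_sum: "(\<And>x. x \<in> A \<Longrightarrow> homogeneous a (f x)) \<Longrightarrow> homogeneous a (sum f A)"
  by (induction A rule: infinite_finite_induct) (auto simp: homogeneous_zero homogeneous_add)

lemma homogeneous_mult: "homogeneous a s \<Longrightarrow> homogeneous b t \<Longrightarrow> homogeneous (a + b) (s * t)"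
  using keys_mult[of s t] by (fastforce simp: homogeneous_def mdeg_add)

lemma homogeneous_minus: "homogeneous a s \<Longrightarrow> homogeneous a (- s)"
  by (auto simp: homogeneous_def)

lemma homogeneous_diff: "homogeneous a s \<Longrightarrow> homogeneous a t \<Longrightarrow> homogeneous a (s - t)"
  using homogeneous_add[OF _ homogeneous_minus] by force

lemma homogeneous_single: "homogeneous (mdeg m) (single m k)"
  by (simp add: homogeneous_def)

lemma homogeneous_const: "homogeneous 0 (const k)"
  using homogeneous_single[of 0] by (simp add: mdeg_zero)

lemma homogeneous_one: "homogeneous 0 1"
  using homogeneous_const[of 1] by simp

lemma homogeneous_const_mult: "homogeneous a s \<Longrightarrow> homogeneous a (const k * s)"
  using homogeneous_mult[OF homogeneous_const] by fastforce

lemma homogeneous_power: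
  assumes "homogeneous a s" shows "homogeneous (\<chi> j. int n * a $ j) (s ^ n)"
proof (induction n)
  case 0
  have "(\<chi> j. int 0 * a $ j) = 0" by (simp add: vec_eq_iff)
  then show ?case by (simp add: homogeneous_one)
next
  case (Suc n)
  have "(\<chi> j. int (Suc n) * a $ j) = a + (\<chi> j. int n * a $ j)" by (simp add: vec_eq_iff algebra_simps)
  then show ?case using homogeneous_mult[OF assms Suc] by simp
qed

lemma homogeneous_prod: "(\<And>x. x \<in> A \<Longrightarrow> homogeneous (d x) (f x)) \<Longrightarrow> homogeneous (sum d A) (prod f A)"
  by (induction A rule: infinite_finite_induct) (auto simp: homogeneous_one homogeneous_mult)

lemma homogeneous_X: "homogeneous (axis i 1) (X i)"
  and homogeneous_Y: "homogeneous (axis i 1) (Y i)"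
  by (auto simp: homogeneous_def X_def Y_def vec_eq_iff lookup_mdeg axis_def lookup_single when_def)

lemma homogeneous_negative: "homogeneous a s \<Longrightarrow> a $ i < 0 \<Longrightarrow> s = 0"
  unfolding homogeneous_def
  by (metis ex_in_conv keys_eq_empty lookup_mdeg add_nonneg_nonneg of_nat_0_le_iff not_le)

definition hpart :: "int ^ 'n \<Rightarrow> ('n::finite, 'k::field) S \<Rightarrow> ('n, 'k) S" where
  "hpart a s = restr {m. mdeg m = a} s"

lemma hpart_add: "hpart a (s + t) = hpart a s + hpart a t"
  by (simp add: hpart_def restr_add)

lemma hpart_zero: "hpart a 0 = 0"
  by (rule poly_mapping_eqI) (simp add: hpart_def lookup_restr)

lemma hpart_sum: "hpart a (sum f A) = (\<Sum>x\<in>A. hpart a (f x))"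
  by (induction A rule: infinite_finite_induct) (simp_all add: hpart_zero hpart_add)

lemma hpart_minus: "hpart a (- s) = - hpart a s"
  by (rule poly_mapping_eqI) (simp add: hpart_def lookup_restr when_def)

lemma hpart_diff: "hpart a (s - t) = hpart a s - hpart a t"
  using hpart_add[of a s "- t"] by (simp add: hpart_minus)

lemma homogeneous_hpart: "homogeneous a (hpart a s)"
  by (auto simp: homogeneous_def hpart_def keys_restr)

lemma hpart_homogeneous: "homogeneous b s \<Longrightarrow> hpart a s = (if a = b then s else 0)"
  by (rule poly_mapping_eqI) (auto simp: hpart_def lookup_restr when_def homogeneous_def in_keys_iff)

lemma hpart_mult:
  assumes "homogeneous b t" shows "hpart a (s * t) = hpart (a - b) s * t"
proof -
  have "s * t = (\<Sum>m\<in>keys s. single m (lookup s m) * t)"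
    by (subst sum_distrib_right[symmetric]) (simp add: sum_monomials)
  then have "hpart a (s * t) = (\<Sum>m\<in>keys s. hpart a (single m (lookup s m) * t))"
    by (simp add: hpart_sum)
  also have "\<dots> = (\<Sum>m\<in>keys s. hpart (a - b) (single m (lookup s m)) * t)"
  proof (rule sum.cong[OF refl])
    fix m
    have "homogeneous (mdeg m + b) (single m (lookup s m) * t)"
      by (intro homogeneous_mult homogeneous_single assms)
    then show "hpart a (single m (lookup s m) * t) = hpart (a - b) (single m (lookup s m)) * t"
      by (subst hpart_homogeneous, assumption, subst hpart_homogeneous[OF homogeneous_single])
        (auto simp: diff_eq_eq)
  qed
  also have "\<dots> = hpart (a - b) s * t"
    by (simp only: hpart_sum[symmetric] sum_distrib_right[symmetric] sum_monomials)
  finally show ?thesis .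
qed

lemma hpart_const_mult: "hpart a (const k * s) = const k * hpart a s"
proof -
  have "hpart a (const k * s) = hpart a (s * const k)" by (simp add: mult.commute)
  also have "\<dots> = hpart a s * const k" using hpart_mult[OF homogeneous_const, of a s k] by simp
  finally show ?thesis by (simp add: mult.commute)
qed

lemma sum_hpart: "finite A \<Longrightarrow> mdeg ` keys s \<subseteq> A \<Longrightarrow> (\<Sum>a\<in>A. hpart a s) = s"
proof (rule poly_mapping_eqI)
  fix m assume A: "finite A" "mdeg ` keys s \<subseteq> A"
  have "lookup (\<Sum>a\<in>A. hpart a s) m = (\<Sum>a\<in>A. if a = mdeg m then lookup s m else 0)"
    by (auto simp: lookup_sum hpart_def lookup_restr when_def intro!: sum.cong)
  also have "\<dots> = lookup s m" using A by (auto simp: in_keys_iff image_subset_iff)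
  finally show "lookup (\<Sum>a\<in>A. hpart a s) m = lookup s m" .
qed

lemma graded_span:
  assumes "\<And>g. g \<in> G \<Longrightarrow> \<exists>b. homogeneous b g" and "x \<in> idl.span G"
  shows "hpart a x \<in> idl.span G"
  using assms(2)
proof (induction rule: idl.span_induct_alt)
  case (step c g y)
  then obtain b where "homogeneous b g" using assms(1) by blast
  then have "hpart a (c * g + y) = hpart (a - b) c * g + hpart a y" by (simp add: hpart_add hpart_mult)
  then show ?case using step by (simp add: idl.span_add idl.span_scale idl.span_base)
qed (simp add: hpart_zero idl.span_zero)

definition xm :: "int ^ 'n \<Rightarrow> ('n::finite, 'k::field) S" where
  "xm a = (\<Prod>i\<in>UNIV. X i ^ nat (a $ i))"

lemma homogeneous_xm:
  assumes "\<And>i. 0 \<le> a $ i" shows "homogeneous a (xm a)"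
proof -
  have "homogeneous (\<Sum>i\<in>UNIV. \<chi> j. int (nat (a $ i)) * axis i 1 $ j) (xm a)"
    unfolding xm_def by (intro homogeneous_prod homogeneous_power homogeneous_X)
  moreover have "(\<Sum>i\<in>UNIV. \<chi> j. int (nat (a $ i)) * axis i 1 $ j) = a"
    by (simp add: vec_eq_iff axis_def assms if_distrib cong: if_cong)
  ultimately show ?thesis by simp
qed

subsection \<open>Specialising the variables \<open>y\<^sub>i\<close>\<close>

text \<open>Dividing out the linear forms \<open>l\<^sub>i = y\<^sub>i - c\<^sub>i x\<^sub>i\<close> leaves the polynomial ring in the \<open>x\<^sub>i\<close>.  Each of its
graded pieces is spanned by one monomial, so that a homogeneous element is determined by its degree
and by its value \<open>ev\<close> at \<open>x\<^sub>i = 1\<close>, \<open>y\<^sub>i = c\<^sub>i\<close>.\<close>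

locale specialisation =
  fixes c :: "'n::finite \<Rightarrow> 'k::field"
begin

definition l :: "'n \<Rightarrow> ('n, 'k) S" where "l i = Y i - const (c i) * X i"

definition lin_ideal :: "'n set \<Rightarrow> ('n, 'k) S set" where "lin_ideal P = idl.span (l ` P)"

sublocale ev: monomial_hom "\<lambda>k. k" "\<lambda>m :: 'n mon. \<Prod>i\<in>UNIV. c i ^ lookup m (Inr i)"
  by unfold_locales (simp_all add: lookup_add power_add prod.distrib)

abbreviation ev :: "('n, 'k) S \<Rightarrow> 'k" where "ev \<equiv> ev.lift"

lemma ev_X: "ev (X i) = 1" and ev_Y: "ev (Y i) = c i"
  by (simp_all add: X_def Y_def ev.lift_single lookup_single when_def if_distrib cong: if_cong)

lemma ev_const: "ev (const k) = k"
  by (simp add: ev.lift_single)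

lemma ev_l: "ev (l i) = 0"
  by (simp add: l_def ev.lift_diff ev.lift_mult ev_X ev_Y ev_const)

lemma ev_xm: "ev (xm a) = 1"
  by (simp add: xm_def ev.lift_prod ev.lift_power ev_X)

lemma homogeneous_l: "homogeneous (axis i 1) (l i)"
  unfolding l_def by (intro homogeneous_diff homogeneous_Y homogeneous_const_mult homogeneous_X)

definition y_image :: "'n set \<Rightarrow> 'n \<Rightarrow> ('n, 'k) S" where
  "y_image P i = (if i \<in> P then const (c i) * X i else Y i)"

lemma monomial_hom_subst:
  "monomial_hom (const :: 'k \<Rightarrow> ('n, 'k) S) (\<lambda>m. \<Prod>i\<in>UNIV. X i ^ lookup m (Inl i) * y_image P i ^ lookup m (Inr i))"
  by unfold_locales (simp_all add: const_add const_mult lookup_add power_add prod.distrib ac_simps)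

text \<open>The substitution \<open>y\<^sub>i \<mapsto> c\<^sub>i x\<^sub>i\<close> for \<open>i \<in> P\<close>.  It is there because its kernel is \<open>lin_ideal P\<close>, which
turns questions of divisibility into computations in \<open>S\<close>.\<close>

definition \<theta> :: "'n set \<Rightarrow> ('n, 'k) S \<Rightarrow> ('n, 'k) S" where
  "\<theta> P = monomial_hom.lift const (\<lambda>m. \<Prod>i\<in>UNIV. X i ^ lookup m (Inl i) * y_image P i ^ lookup m (Inr i))"

lemmas \<theta>_simps = monomial_hom.lift_add[OF monomial_hom_subst, folded \<theta>_def]
  monomial_hom.lift_mult[OF monomial_hom_subst, folded \<theta>_def]
  monomial_hom.lift_diff[OF monomial_hom_subst, folded \<theta>_def]
  monomial_hom.lift_zero[OF monomial_hom_subst, folded \<theta>_def]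
lemmas \<theta>_sum = monomial_hom.lift_sum[OF monomial_hom_subst, folded \<theta>_def]
lemmas \<theta>_single = monomial_hom.lift_single[OF monomial_hom_subst, folded \<theta>_def]

lemma \<theta>_const: "\<theta> P (const k) = const k"
  by (simp add: \<theta>_single)

lemma \<theta>_X: "\<theta> P (X i) = X i"
proof -
  have "(\<Prod>j\<in>UNIV. X j ^ lookup (single (Inl i) (1::nat)) (Inl j) * y_image P j ^ lookup (single (Inl i) (1::nat)) (Inr j))
      = (\<Prod>j\<in>UNIV. if j = i then X i else 1)"
    by (intro prod.cong) (auto simp: lookup_single when_def)
  then show ?thesis unfolding X_def[of i] \<theta>_single by (simp add: X_def)
qed

lemma \<theta>_Y: "\<theta> P (Y i) = y_image P i"
proof -
  have "(\<Prod>j\<in>UNIV. X j ^ lookup (single (Inr i) (1::nat)) (Inl j) * y_image P j ^ lookup (single (Inr i) (1::nat)) (Inr j))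
      = (\<Prod>j\<in>UNIV. if j = i then y_image P i else 1)"
    by (intro prod.cong) (auto simp: lookup_single when_def)
  then show ?thesis unfolding Y_def[of i] \<theta>_single by simp
qed

lemma \<theta>_l: "\<theta> P (l i) = (if i \<in> P then 0 else l i)"
  by (simp add: l_def \<theta>_simps \<theta>_const \<theta>_X \<theta>_Y y_image_def)

lemma cong_mult:
  assumes "idl.subspace I" "x - y \<in> I" "x' - y' \<in> I" shows "x * x' - y * y' \<in> (I :: ('n, 'k) S set)"
proof -
  have "x * x' - y * y' = x' * (x - y) + y * (x' - y')" by (simp add: algebra_simps)
  then show ?thesis using assms by (simp add: idl.subspace_add idl.subspace_scale)
qed

lemma cong_power:
  assumes "idl.subspace I" "x - y \<in> I" shows "x ^ n - y ^ n \<in> (I :: ('n, 'k) S set)"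
  by (induction n) (auto intro: cong_mult assms simp: idl.subspace_0[OF assms(1)])

lemma cong_prod:
  assumes "idl.subspace I" "\<And>i. i \<in> A \<Longrightarrow> f i - g i \<in> I" shows "prod f A - prod g A \<in> (I :: ('n, 'k) S set)"
  using assms(2)
  by (induction A rule: infinite_finite_induct) (auto intro!: cong_mult assms(1) simp: idl.subspace_0[OF assms(1)])

lemma subspace_lin_ideal: "idl.subspace (lin_ideal P)"
  by (simp add: lin_ideal_def)

lemma diff_\<theta>_in_lin_ideal: "s - \<theta> P s \<in> lin_ideal P"
proof -
  have 1: "single m k - \<theta> P (single m k) \<in> lin_ideal P" for m k
  proof -
    have "Y i - y_image P i \<in> lin_ideal P" for i
    proof (cases "i \<in> P")
      case True
      then have "Y i - y_image P i = l i" by (simp add: y_image_def l_def)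
      then show ?thesis using True by (simp add: lin_ideal_def idl.span_base)
    qed (simp add: y_image_def idl.subspace_0[OF subspace_lin_ideal])
    then have "single m 1 - (\<Prod>i\<in>UNIV. X i ^ lookup m (Inl i) * y_image P i ^ lookup m (Inr i)) \<in> lin_ideal P"
      unfolding monomial_eq_prod
      by (intro cong_prod cong_mult cong_power subspace_lin_ideal) (simp add: idl.subspace_0[OF subspace_lin_ideal])
    from idl.subspace_scale[OF subspace_lin_ideal this, of "const k"] show ?thesis
      by (simp add: \<theta>_single right_diff_distrib const_mult_single)
  qed
  have "s - \<theta> P s = (\<Sum>m\<in>keys s. single m (lookup s m) - \<theta> P (single m (lookup s m)))"
    by (simp only: sum_subtractf \<theta>_sum[symmetric] sum_monomials)
  then show ?thesis by (simp add: idl.subspace_sum[OF subspace_lin_ideal 1])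
qed

lemma lin_ideal_iff: "s \<in> lin_ideal P \<longleftrightarrow> \<theta> P s = 0"
proof
  assume "s \<in> lin_ideal P"
  then have "s \<in> idl.span (l ` P)" by (simp add: lin_ideal_def)
  then show "\<theta> P s = 0"
    by (induction rule: idl.span_induct_alt) (auto simp: \<theta>_simps \<theta>_l)
next
  assume "\<theta> P s = 0"
  then show "s \<in> lin_ideal P" using diff_\<theta>_in_lin_ideal[of s P] by simp
qed

text \<open>\<open>l\<^sub>v\<close> is monic in \<open>y\<^sub>v\<close>: a monomial of \<open>s\<close> in which \<open>y\<^sub>v\<close> has the largest exponent yields one of the
product.\<close>

lemma l_mult_eq_0:
  assumes "l v * s = 0" shows "s = 0"
proof (rule ccontr)
  assume "s \<noteq> 0"
  then have "keys s \<noteq> {}" by simp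
  define h where "h = Max ((\<lambda>m. lookup m (Inr v)) ` keys s)"
  have "h \<in> (\<lambda>m. lookup m (Inr v)) ` keys s" unfolding h_def by (intro Max_in) (use \<open>keys s \<noteq> {}\<close> in auto)
  then obtain m where m: "m \<in> keys s" "lookup m (Inr v) = h" by auto
  have max: "lookup m' (Inr v) \<le> h" if "m' \<in> keys s" for m' unfolding h_def using that by (intro Max_ge) auto
  let ?y = "single (Inr v) (1::nat)"
  have "?y + m \<notin> keys (X v * s)"
  proof
    assume "?y + m \<in> keys (X v * s)"
    then obtain m' where m': "m' \<in> keys s" "?y + m = single (Inl v) 1 + m'"
      using keys_mult[of "X v" s] by (auto simp: X_def)
    then have "lookup (?y + m) (Inr v) = lookup (single (Inl v) 1 + m') (Inr v)" by simp
    then have "Suc h = lookup m' (Inr v)" using m by (simp add: lookup_add lookup_single)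
    then show False using max[OF m'(1)] by simp
  qed
  then have "lookup (X v * s) (?y + m) = 0" by (simp add: in_keys_iff)
  then have "lookup (l v * s) (?y + m) = lookup s m"
    using lookup_single_mult[of ?y s m] by (simp add: l_def left_diff_distrib lookup_minus mult.assoc lookup_const_mult Y_def)
  then show False using assms m by (simp add: in_keys_iff)
qed

lemma lin_ideal_prime:
  assumes "v \<notin> P" "l v * s \<in> lin_ideal P" shows "s \<in> lin_ideal P"
  using assms l_mult_eq_0[of v "\<theta> P s"] by (simp add: lin_ideal_iff \<theta>_simps \<theta>_l)

lemma lin_ideal_insert: "s \<in> lin_ideal (insert v P) \<longleftrightarrow> (\<exists>t. s - t * l v \<in> lin_ideal P)"
  by (simp add: lin_ideal_def idl.span_breakdown_eq)

lemma graded_lin_ideal: "s \<in> lin_ideal P \<Longrightarrow> hpart a s \<in> lin_ideal P"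
  unfolding lin_ideal_def using homogeneous_l by (intro graded_span) auto

text \<open>Modulo all \<open>l\<^sub>i\<close>, a monomial of degree \<open>a\<close> is a multiple of \<open>x\<^sup>a\<close>; the factor is its value under \<open>ev\<close>.\<close>

lemma homogeneous_minus_xm_in_lin_ideal:
  assumes "homogeneous a f" shows "f - const (ev f) * xm a \<in> lin_ideal UNIV"
proof -
  have "\<theta> UNIV (single m k) = const (k * (\<Prod>i\<in>UNIV. c i ^ lookup m (Inr i))) * xm (mdeg m)" for m k
  proof -
    have "(\<Prod>i\<in>UNIV. X i ^ lookup m (Inl i) * y_image UNIV i ^ lookup m (Inr i)) =
        (\<Prod>i\<in>UNIV. const (c i) ^ lookup m (Inr i)) * (xm (mdeg m) :: ('n, 'k) S)"
      unfolding xm_def prod.distrib[symmetric]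
      by (intro prod.cong refl) (simp add: y_image_def lookup_mdeg power_mult_distrib power_add nat_add_distrib algebra_simps)
    also have "(\<Prod>i\<in>UNIV. const (c i) ^ lookup m (Inr i)) = (const (\<Prod>i\<in>UNIV. c i ^ lookup m (Inr i)) :: ('n, 'k) S)"
    proof -
      have pow: "const (x :: 'k) ^ n = (const (x ^ n) :: ('n, 'k) S)" for x n
        by (induction n) (simp_all add: const_mult)
      have "prod (\<lambda>i. const (g i)) A = (const (prod g A) :: ('n, 'k) S)" for g and A :: "'n set"
        by (induction A rule: infinite_finite_induct) (simp_all add: const_mult)
      then show ?thesis by (simp add: pow)
    qed
    finally show ?thesis by (simp add: \<theta>_single const_mult mult.assoc)
  qed
  then have "\<theta> UNIV f = (\<Sum>m\<in>keys f. const (lookup f m * (\<Prod>i\<in>UNIV. c i ^ lookup m (Inr i))) * xm (mdeg m))"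
    by (subst sum_monomials[of f, symmetric]) (simp only: \<theta>_sum)
  also have "\<dots> = (\<Sum>m\<in>keys f. const (lookup f m * (\<Prod>i\<in>UNIV. c i ^ lookup m (Inr i))) * xm a)"
    using assms by (intro sum.cong) (auto simp: homogeneous_def)
  also have "\<dots> = const (ev f) * xm a"
  proof -
    have "const (sum g A) = (\<Sum>x\<in>A. const (g x) :: ('n, 'k) S)" for g :: "'n mon \<Rightarrow> 'k" and A
      by (induction A rule: infinite_finite_induct) (simp_all add: const_add)
    then show ?thesis by (simp add: ev.lift_def sum_distrib_right)
  qed
  finally show ?thesis using diff_\<theta>_in_lin_ideal[of f UNIV] by simp
qed

text \<open>The coefficient of \<open>x\<^sup>a\<close> in the class of \<open>s\<close> modulo the \<open>l\<^sub>i\<close>.\<close>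

definition ev_deg :: "int ^ 'n \<Rightarrow> ('n, 'k) S \<Rightarrow> 'k" where "ev_deg a s = ev (hpart a s)"

lemma ev_deg_add: "ev_deg a (s + t) = ev_deg a s + ev_deg a t"
  by (simp add: ev_deg_def hpart_add ev.lift_add)

lemma ev_deg_zero: "ev_deg a 0 = 0"
  by (simp add: ev_deg_def hpart_zero ev.lift_zero)

lemma ev_deg_sum: "ev_deg a (sum f A) = (\<Sum>x\<in>A. ev_deg a (f x))"
  by (induction A rule: infinite_finite_induct) (simp_all add: ev_deg_zero ev_deg_add)

lemma ev_deg_mult: "homogeneous b t \<Longrightarrow> ev_deg a (s * t) = ev_deg (a - b) s * ev t"
  by (simp add: ev_deg_def hpart_mult ev.lift_mult)

lemma ev_deg_negative: "a $ i < 0 \<Longrightarrow> ev_deg a s = 0"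
  using homogeneous_negative[OF homogeneous_hpart, of a i s] by (simp add: ev_deg_def ev.lift_zero)

lemma ev_deg_homogeneous: "homogeneous a s \<Longrightarrow> ev_deg a s = ev s"
  by (simp add: ev_deg_def hpart_homogeneous)

lemma ev_deg_lin_ideal:
  assumes "s \<in> lin_ideal UNIV" shows "ev_deg a s = 0"
proof -
  have "s \<in> idl.span (range l)" using assms by (simp add: lin_ideal_def)
  then show ?thesis
    by (induction rule: idl.span_induct_alt)
      (auto simp: ev_deg_zero ev_deg_add ev_deg_mult[OF homogeneous_l] ev_l)
qed

lemma lin_ideal_UNIV_homogeneous: "homogeneous a s \<Longrightarrow> s \<in> lin_ideal UNIV \<longleftrightarrow> ev s = 0"
  using homogeneous_minus_xm_in_lin_ideal[of a s] ev_deg_lin_ideal[of s a] ev_deg_homogeneous[of a s] by auto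

end

section \<open>Ideals with the Hilbert function of a matroid\<close>

definition cscale :: "'k::field \<Rightarrow> ('m::comm_monoid_add \<Rightarrow>\<^sub>0 'k) \<Rightarrow> ('m \<Rightarrow>\<^sub>0 'k)" where
  "cscale k s = const k * s"

global_interpretation cv: vector_space cscale
  by unfold_locales (simp_all add: cscale_def const_add const_mult algebra_simps)

lemma cscale_mult_right: "x * cscale k y = cscale k (x * y)"
  by (simp add: cscale_def algebra_simps)

lemma lookup_cscale: "lookup (cscale k s) m = k * lookup s m"
  by (simp add: cscale_def lookup_const_mult)

lemma hpart_cscale: "hpart a (cscale k s) = cscale k (hpart a s)"
  by (simp add: cscale_def hpart_const_mult)

lemma cscale_in_ideal: "idl.subspace J \<Longrightarrow> s \<in> J \<Longrightarrow> cscale k s \<in> J"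
  by (simp add: cscale_def idl.subspace_scale)

text \<open>The dimension of \<open>S / J\<close> in degree \<open>a\<close> is at least \<open>n\<close>.\<close>

definition indep_mod :: "('n::finite, 'k::field) S set \<Rightarrow> int ^ 'n \<Rightarrow> nat \<Rightarrow> bool" where
  "indep_mod J a n \<longleftrightarrow> (\<exists>s. (\<forall>j<n. homogeneous a (s j)) \<and>
     (\<forall>k. (\<Sum>j<n. cscale (k j) (s j)) \<in> J \<longrightarrow> (\<forall>j<n. k j = 0)))"

lemma family_dependent:
  fixes h :: "nat \<Rightarrow> ('m::comm_monoid_add \<Rightarrow>\<^sub>0 'k::field)"
  assumes "finite G" "card G < n" "\<And>j. j < n \<Longrightarrow> h j \<in> cv.span G"
  shows "\<exists>k. (\<exists>j<n. k j \<noteq> 0) \<and> (\<Sum>j<n. cscale (k j) (h j)) = 0"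
proof (cases "inj_on h {..<n}")
  case True
  have "\<not> cv.independent (h ` {..<n})"
  proof
    assume "cv.independent (h ` {..<n})"
    then have "card (h ` {..<n}) \<le> card G"
      using cv.independent_span_bound[OF assms(1), of "h ` {..<n}"] assms(3) by blast
    then show False using assms(2) True by (simp add: card_image)
  qed
  then obtain u where u: "\<exists>v\<in>h ` {..<n}. u v \<noteq> 0" "(\<Sum>v\<in>h ` {..<n}. cscale (u v) v) = 0"
    using cv.dependent_finite[of "h ` {..<n}"] by blast
  have "(\<Sum>j<n. cscale (u (h j)) (h j)) = 0" using u(2) True by (simp add: sum.reindex)
  moreover obtain j where "j < n" "u (h j) \<noteq> 0" using u(1) by auto
  ultimately show ?thesis by (intro exI[of _ "\<lambda>j. u (h j)"]) auto
next
  case False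
  then obtain i j where ij: "i < n" "j < n" "i \<noteq> j" "h i = h j" by (auto simp: inj_on_def)
  define k where "k t = (if t = i then 1 else if t = j then - 1 else (0::'k))" for t
  have "(\<Sum>t<n. cscale (k t) (h t)) = (\<Sum>t\<in>{i, j}. cscale (k t) (h t))"
    using ij by (intro sum.mono_neutral_right) (auto simp: k_def)
  also have "\<dots> = 0" using ij by (simp add: k_def)
  finally have "(\<Sum>t<n. cscale (k t) (h t)) = 0" .
  moreover have "k i \<noteq> 0" by (simp add: k_def)
  ultimately show ?thesis using ij(1) by blast
qed

lemma indep_mod_le_card:
  assumes J: "idl.subspace J" and "indep_mod J a n" and G: "finite G"
    and span: "\<And>f. homogeneous a f \<Longrightarrow> \<exists>h\<in>cv.span G. f - h \<in> J"
  shows "n \<le> card G"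
proof (rule ccontr)
  assume "\<not> n \<le> card G"
  obtain s where s: "\<And>j. j < n \<Longrightarrow> homogeneous a (s j)"
      "\<And>k j. (\<Sum>j<n. cscale (k j) (s j)) \<in> J \<Longrightarrow> j < n \<Longrightarrow> k j = 0"
    using \<open>indep_mod J a n\<close> that unfolding indep_mod_def by (elim exE conjE) blast
  have "\<exists>h. \<forall>j. j < n \<longrightarrow> h j \<in> cv.span G \<and> s j - h j \<in> J"
    using span[OF s(1)] by (intro choice allI) blast
  then obtain h where h: "\<And>j. j < n \<Longrightarrow> h j \<in> cv.span G" "\<And>j. j < n \<Longrightarrow> s j - h j \<in> J" by blast
  obtain k where k: "\<exists>j<n. k j \<noteq> 0" "(\<Sum>j<n. cscale (k j) (h j)) = 0"
    using family_dependent[OF G, of n h] h(1) \<open>\<not> n \<le> card G\<close> by auto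
  have "(\<Sum>j<n. cscale (k j) (s j)) = (\<Sum>j<n. cscale (k j) (s j - h j))"
    using k(2) by (simp add: cv.scale_right_diff_distrib sum_subtractf)
  also have "\<dots> \<in> J" using h(2) by (intro idl.subspace_sum[OF J] cscale_in_ideal[OF J]) auto
  finally show False using s(2) k(1) by blast
qed

text \<open>In the last condition, \<open>u\<close> ranges over the exponents up to \<open>a\<close> with coindependent support.  Together
with the condition before, over an infinite field, it forces the Hilbert function of \<open>S / J\<close> to be that of \<open>S\<close> modulo the
ideal of \<open>\<kk>[x]\<close> generated by the products of \<open>x\<^sub>i\<close> over sets that are not coindependent.\<close>

locale matroidal_ideal = rank_function \<rho> for \<rho> :: "'n::finite set \<Rightarrow> nat" +
  fixes J :: "('n, 'k::field) S set"
  assumes ideal: "idl.subspace J"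
    and graded: "f \<in> J \<Longrightarrow> hpart a f \<in> J"
    and witness: "\<not> spanning (UNIV - T) \<Longrightarrow> \<exists>f\<in>J. f \<noteq> 0 \<and> homogeneous (indicator_vec T) f"
    and count: "indep_mod J a (card {u. (\<forall>i. int (u i) \<le> a $ i) \<and> spanning {i. u i = 0}})"

text \<open>Finitely many nonzero polynomials that are affine in every variable have a common point where none of
them vanishes.  The coordinates are chosen one after another: for each polynomial and each monomial
in the other variables, at most one value of the new variable makes its coefficient vanish.\<close>

lemma exists_nonzero_point:
  fixes \<alpha> :: "'t \<Rightarrow> 'n::finite set \<Rightarrow> 'k::field"
  assumes inf: "infinite (UNIV :: 'k set)" and "finite I" and "finite E"
    and "\<And>t. t \<in> I \<Longrightarrow> \<exists>U\<in>Pow E. \<alpha> t U \<noteq> 0"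
  shows "\<exists>c. \<forall>t\<in>I. (\<Sum>U\<in>Pow E. \<alpha> t U * (\<Prod>i\<in>U. c i)) \<noteq> 0"
  using assms(3,4)
proof (induction E arbitrary: \<alpha> rule: finite_induct)
  case empty
  then show ?case by auto
next
  case (insert v E)
  define bad where "bad = (\<Union>t\<in>I. \<Union>U\<in>Pow E. {- \<alpha> t U / \<alpha> t (insert v U)})"
  have "finite bad" using insert.hyps \<open>finite I\<close> by (auto simp: bad_def)
  then obtain x where x: "x \<notin> bad" using inf by (metis ex_new_if_finite)
  define \<alpha>' where "\<alpha>' t U = \<alpha> t U + x * \<alpha> t (insert v U)" for t U
  have "\<exists>U\<in>Pow E. \<alpha>' t U \<noteq> 0" if t: "t \<in> I" for t
  proof -
    obtain U where U: "U \<subseteq> insert v E" "\<alpha> t U \<noteq> 0" using insert.prems[OF t] by auto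
    show ?thesis
    proof (cases "\<alpha> t (insert v (U - {v})) = 0")
      case True
      then have "v \<notin> U" using U by (metis insert_Diff)
      then show ?thesis using U True by (intro bexI[of _ U]) (auto simp: \<alpha>'_def)
    next
      case False
      have "U - {v} \<in> Pow E" using U by auto
      then have "x \<noteq> - \<alpha> t (U - {v}) / \<alpha> t (insert v (U - {v}))" using x t unfolding bad_def by blast
      then have "x * \<alpha> t (insert v (U - {v})) \<noteq> - \<alpha> t (U - {v})" using False by (auto simp: field_simps)
      then have "\<alpha>' t (U - {v}) \<noteq> 0" by (simp add: \<alpha>'_def add_eq_0_iff)
      then show ?thesis using \<open>U - {v} \<in> Pow E\<close> by blast
    qed
  qed
  from insert.IH[of \<alpha>', OF this] obtain c where c: "\<And>t. t \<in> I \<Longrightarrow> (\<Sum>U\<in>Pow E. \<alpha>' t U * (\<Prod>i\<in>U. c i)) \<noteq> 0"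
    by blast
  have "(\<Sum>U\<in>Pow (insert v E). \<alpha> t U * (\<Prod>i\<in>U. (c(v := x)) i)) = (\<Sum>U\<in>Pow E. \<alpha>' t U * (\<Prod>i\<in>U. c i))" for t
  proof -
    have inj: "inj_on (insert v) (Pow E)" using insert.hyps by (auto simp: inj_on_def)
    have "(\<Sum>U\<in>Pow (insert v E). \<alpha> t U * (\<Prod>i\<in>U. (c(v := x)) i)) =
        (\<Sum>U\<in>Pow E. \<alpha> t U * (\<Prod>i\<in>U. (c(v := x)) i)) + (\<Sum>U\<in>Pow E. \<alpha> t (insert v U) * (\<Prod>i\<in>insert v U. (c(v := x)) i))"
      unfolding Pow_insert using insert.hyps inj
      by (subst sum.union_disjoint) (auto simp: sum.reindex)
    also have "\<dots> = (\<Sum>U\<in>Pow E. \<alpha>' t U * (\<Prod>i\<in>U. c i))"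
      unfolding sum.distrib[symmetric]
    proof (intro sum.cong refl)
      fix U assume "U \<in> Pow E"
      then have vU: "v \<notin> U" and fin: "finite U" using insert.hyps by auto
      then have "(\<Prod>i\<in>U. (c(v := x)) i) = (\<Prod>i\<in>U. c i)" by (intro prod.cong) auto
      then show "\<alpha> t U * (\<Prod>i\<in>U. (c(v := x)) i) + \<alpha> t (insert v U) * (\<Prod>i\<in>insert v U. (c(v := x)) i) =
          \<alpha>' t U * (\<Prod>i\<in>U. c i)"
        using vU fin by (simp add: \<alpha>'_def algebra_simps)
    qed
    finally show ?thesis .
  qed
  then show ?case using c by metis
qed

locale specialised_ideal = matroidal_ideal \<rho> J + specialisation c
  for \<rho> :: "'n::finite set \<Rightarrow> nat" and J :: "('n, 'k::field) S set" and c :: "'n \<Rightarrow> 'k" +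
  assumes ev_witness: "\<not> spanning (UNIV - T) \<Longrightarrow> \<exists>f\<in>J. homogeneous (indicator_vec T) f \<and> ev f \<noteq> 0"

text \<open>An element of degree \<open>e\<^sub>T\<close> becomes affine in every \<open>y\<^sub>i\<close> when the \<open>x\<^sub>i\<close> are set to \<open>1\<close>, and stays nonzero
since its monomials are determined by the set of the \<open>y\<^sub>i\<close> occurring in them.\<close>

lemma (in matroidal_ideal) exists_specialisation:
  assumes "infinite (UNIV :: 'k set)"
  shows "\<exists>c. specialised_ideal \<rho> J c"
proof -
  define I where "I = {T. \<not> spanning (UNIV - T)}"
  have "\<exists>f. \<forall>T. T \<in> I \<longrightarrow> f T \<in> J \<and> f T \<noteq> 0 \<and> homogeneous (indicator_vec T) (f T)"
    using witness by (intro choice) (auto simp: I_def)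
  then obtain f where f: "\<And>T. T \<in> I \<Longrightarrow> f T \<in> J" "\<And>T. T \<in> I \<Longrightarrow> f T \<noteq> 0"
      "\<And>T. T \<in> I \<Longrightarrow> homogeneous (indicator_vec T) (f T)" by blast
  define ys where "ys m = {i. lookup m (Inr i) = 1}" for m :: "'n mon"
  define \<alpha> where "\<alpha> T U = (\<Sum>m | m \<in> keys (f T) \<and> ys m = U. lookup (f T) m)" for T U
  have deg: "lookup m (Inl i) + lookup m (Inr i) = (if i \<in> T then 1 else 0)"
    if "T \<in> I" "m \<in> keys (f T)" for T m i
  proof -
    have "mdeg m $ i = indicator_vec T $ i" using f(3)[OF that(1)] that(2) by (simp add: homogeneous_def)
    then show ?thesis by (auto simp: lookup_mdeg indicator_vec_def split: if_splits)
  qed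
  have inj: "inj_on ys (keys (f T))" if T: "T \<in> I" for T
  proof
    fix m m' assume m: "m \<in> keys (f T)" "m' \<in> keys (f T)" "ys m = ys m'"
    show "m = m'"
    proof (rule poly_mapping_eqI)
      fix v
      have "lookup m (Inr i) = lookup m' (Inr i)" for i
      proof -
        have "lookup m (Inr i) \<le> 1" "lookup m' (Inr i) \<le> 1"
          using deg[OF T m(1), of i] deg[OF T m(2), of i] by (auto split: if_splits)
        moreover have "lookup m (Inr i) = 1 \<longleftrightarrow> lookup m' (Inr i) = 1"
          using m(3) by (auto simp: ys_def)
        ultimately show ?thesis by linarith
      qed
      then show "lookup m v = lookup m' v"
        using deg[OF T m(1)] deg[OF T m(2)] by (cases v) (simp, metis add_right_imp_eq, simp)
    qed
  qed
  have "\<exists>U\<in>Pow UNIV. \<alpha> T U \<noteq> 0" if T: "T \<in> I" for T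
  proof -
    obtain m where m: "m \<in> keys (f T)" using f(2)[OF T] by (metis ex_in_conv keys_eq_empty)
    then have "{m'. m' \<in> keys (f T) \<and> ys m' = ys m} = {m}" using inj[OF T] by (auto simp: inj_on_def)
    then have "\<alpha> T (ys m) = lookup (f T) m" by (simp add: \<alpha>_def)
    then show ?thesis using m by (intro bexI[of _ "ys m"]) (auto simp: in_keys_iff)
  qed
  then obtain c where c: "\<And>T. T \<in> I \<Longrightarrow> (\<Sum>U\<in>Pow UNIV. \<alpha> T U * (\<Prod>i\<in>U. c i)) \<noteq> 0"
    using exists_nonzero_point[OF assms, of I UNIV \<alpha>] by auto
  interpret specialisation c .
  have "ev (f T) \<noteq> 0" if T: "T \<in> I" for T
  proof -
    have "ev (f T) = (\<Sum>m\<in>keys (f T). lookup (f T) m * (\<Prod>i\<in>ys m. c i))"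
      unfolding ev.lift_def
    proof (intro sum.cong refl arg_cong2[where f = "(*)"])
      fix m assume m: "m \<in> keys (f T)"
      have "(\<Prod>i\<in>UNIV. c i ^ lookup m (Inr i)) = (\<Prod>i\<in>UNIV. if i \<in> ys m then c i else 1)"
        using deg[OF T m] by (intro prod.cong) (auto simp: ys_def, metis One_nat_def add_is_1 add_is_0 power_0 add_is_1)
      also have "\<dots> = (\<Prod>i\<in>ys m. c i)" by (subst prod.inter_restrict[symmetric]) auto
      finally show "(\<Prod>i\<in>UNIV. c i ^ lookup m (Inr i)) = (\<Prod>i\<in>ys m. c i)" .
    qed
    also have "\<dots> = (\<Sum>U\<in>UNIV. \<Sum>m | m \<in> keys (f T) \<and> ys m = U. lookup (f T) m * (\<Prod>i\<in>ys m. c i))"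
      by (subst sum.group[symmetric, of "keys (f T)" UNIV ys]) auto
    also have "\<dots> = (\<Sum>U\<in>Pow UNIV. \<alpha> T U * (\<Prod>i\<in>U. c i))"
      unfolding \<alpha>_def Pow_UNIV sum_distrib_right by (intro sum.cong refl) auto
    finally show ?thesis using c[OF T] by simp
  qed
  then have "specialised_ideal \<rho> J c"
    using f(1,3) by unfold_locales (auto simp: I_def)
  then show ?thesis by (rule exI[of _ c])
qed

context specialised_ideal
begin

definition wgen :: "('n \<Rightarrow> nat) \<Rightarrow> ('n \<Rightarrow> nat) \<Rightarrow> ('n, 'k) S" where
  "wgen u w = (\<Prod>i\<in>UNIV. X i ^ u i) * (\<Prod>i\<in>UNIV. l i ^ w i)"

text \<open>The products with coindependent exponents of the \<open>x\<^sub>i\<close>; their span \<open>W\<close> turns out to be a complement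
of \<open>J\<close> that is closed under multiplication by the \<open>l\<^sub>i\<close>.\<close>

definition W :: "('n, 'k) S set" where
  "W = cv.span {wgen u w | u w. spanning {i. u i = 0}}"

definition Wgens :: "int ^ 'n \<Rightarrow> ('n, 'k) S set" where
  "Wgens a = {wgen u w | u w. spanning {i. u i = 0} \<and> (\<forall>i. int (u i) + int (w i) = a $ i)}"

lemma subspace_W: "cv.subspace W"
  by (simp add: W_def)

lemma l_wgen: "l v * wgen u w = wgen u (w(v := Suc (w v)))"
proof -
  have "(\<Prod>i\<in>UNIV. l i ^ (w(v := Suc (w v))) i) = l v ^ Suc (w v) * (\<Prod>i\<in>UNIV - {v}. l i ^ w i)"
    by (subst prod.remove[of _ v]) auto
  also have "\<dots> = l v * (\<Prod>i\<in>UNIV. l i ^ w i)"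
    by (subst (2) prod.remove[of _ v]) (auto simp: mult.assoc)
  finally show ?thesis by (simp add: wgen_def algebra_simps)
qed

lemma l_mult_W:
  assumes "s \<in> W" shows "l v * s \<in> W"
proof -
  have "s \<in> cv.span {wgen u w | u w. spanning {i. u i = 0}}" using assms by (simp add: W_def)
  then show ?thesis
  proof (induction rule: cv.span_induct_alt)
    case base
    then show ?case by (simp add: cv.subspace_0[OF subspace_W])
  next
    case (step k g y)
    then obtain u w where "g = wgen u w" "spanning {i. u i = 0}" by blast
    then have "l v * g \<in> W" unfolding W_def by (auto simp: l_wgen intro!: cv.span_base)
    then show ?case using step
      by (simp add: distrib_left cscale_mult_right cv.subspace_add[OF subspace_W] cv.subspace_scale[OF subspace_W])
  qed
qed

lemma homogeneous_wgen: "homogeneous (\<chi> i. int (u i) + int (w i)) (wgen u w)"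
proof -
  have "homogeneous ((\<Sum>i\<in>UNIV. \<chi> j. int (u i) * axis i 1 $ j) + (\<Sum>i\<in>UNIV. \<chi> j. int (w i) * axis i 1 $ j)) (wgen u w)"
    unfolding wgen_def
    by (intro homogeneous_mult homogeneous_prod homogeneous_power homogeneous_X homogeneous_l)
  moreover have "(\<Sum>i\<in>UNIV. \<chi> j. int (f i) * axis i 1 $ j) = (\<chi> i. int (f i))" for f :: "'n \<Rightarrow> nat"
    by (simp add: vec_eq_iff axis_def if_distrib cong: if_cong)
  moreover have "(\<chi> i. int (u i)) + (\<chi> i. int (w i)) = (\<chi> i. int (u i) + int (w i))"
    by (simp add: vec_eq_iff)
  ultimately show ?thesis by simp
qed

lemma hpart_W:
  assumes "s \<in> W" shows "hpart a s \<in> cv.span (Wgens a)"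
proof -
  have "s \<in> cv.span {wgen u w | u w. spanning {i. u i = 0}}" using assms by (simp add: W_def)
  then show ?thesis
  proof (induction rule: cv.span_induct_alt)
    case base
    then show ?case by (simp add: hpart_zero cv.span_zero)
  next
    case (step k g y)
    then obtain u w where g: "g = wgen u w" "spanning {i. u i = 0}" by blast
    have "hpart a g \<in> cv.span (Wgens a)"
    proof (cases "a = (\<chi> i. int (u i) + int (w i))")
      case True
      then have "g \<in> Wgens a" using g by (auto simp: Wgens_def)
      then show ?thesis using hpart_homogeneous[OF homogeneous_wgen, of a u w] True g(1)
        by (simp add: cv.span_base)
    next
      case False
      then show ?thesis using hpart_homogeneous[OF homogeneous_wgen, of a u w] g(1) by (simp add: cv.span_zero)
    qed
    then show ?case using step by (simp add: hpart_add hpart_cscale cv.span_add cv.span_scale)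
  qed
qed

lemma xm_W:
  assumes "\<And>i. 0 \<le> a $ i" "spanning (zeros a)" shows "xm a \<in> W"
proof -
  have "xm a = wgen (\<lambda>i. nat (a $ i)) (\<lambda>_. 0)" by (simp add: wgen_def xm_def)
  moreover have "{i. nat (a $ i) = 0} = zeros a" using assms(1) by (auto simp: zeros_def order_antisym)
  ultimately show ?thesis using assms(2) unfolding W_def by (auto intro!: cv.span_base)
qed

lemma finite_Wgens: "finite (Wgens a)"
  and card_Wgens: "card (Wgens a) \<le> card {u. (\<forall>i. int (u i) \<le> a $ i) \<and> spanning {i. u i = 0}}"
proof -
  let ?N = "{u :: 'n \<Rightarrow> nat. (\<forall>i. int (u i) \<le> a $ i) \<and> spanning {i. u i = 0}}"
  have "?N \<subseteq> (\<Pi>\<^sub>E i\<in>UNIV. {..nat (a $ i)})"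
    by (auto simp: PiE_iff) (metis nat_int nat_mono)
  then have fin: "finite ?N" by (rule finite_subset) (auto intro!: finite_PiE)
  have sub: "Wgens a \<subseteq> (\<lambda>u. wgen u (\<lambda>i. nat (a $ i - int (u i)))) ` ?N"
  proof
    fix g assume "g \<in> Wgens a"
    then obtain u w where g: "g = wgen u w" "spanning {i. u i = 0}" "\<And>i. int (u i) + int (w i) = a $ i"
      by (auto simp: Wgens_def)
    have "w = (\<lambda>i. nat (a $ i - int (u i)))" by (auto simp: g(3)[symmetric])
    moreover have "int (u i) \<le> a $ i" for i using g(3)[of i] by linarith
    ultimately show "g \<in> (\<lambda>u. wgen u (\<lambda>i. nat (a $ i - int (u i)))) ` ?N" using g by auto
  qed
  show "finite (Wgens a)" using sub fin by (meson finite_imageI finite_subset)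
  show "card (Wgens a) \<le> card ?N" using sub fin by (meson card_image_le card_mono finite_imageI le_trans)
qed

text \<open>Each coefficient in a representation by the \<open>l\<^sub>i\<close> may be replaced by its component of the right
degree.\<close>

lemma homogeneous_lin_ideal_sum:
  assumes "finite P" "s \<in> lin_ideal P" "homogeneous a s"
  shows "\<exists>t. (\<forall>i\<in>P. homogeneous (a - axis i 1) (t i)) \<and> s = (\<Sum>i\<in>P. l i * t i)"
  using assms
proof (induction P arbitrary: s rule: finite_induct)
  case empty
  then show ?case by (simp add: lin_ideal_def)
next
  case (insert v P)
  then obtain k where "s - k * l v \<in> lin_ideal P" by (auto simp: lin_ideal_insert)
  then have "hpart a (s - k * l v) \<in> lin_ideal P" by (rule graded_lin_ideal)
  then have 1: "s - hpart (a - axis v 1) k * l v \<in> lin_ideal P"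
    using insert.prems(2) by (simp add: hpart_diff hpart_mult[OF homogeneous_l] hpart_homogeneous)
  have "homogeneous a (hpart (a - axis v 1) k * l v)"
    using homogeneous_mult[OF homogeneous_hpart[of "a - axis v 1" k] homogeneous_l[of v]] by simp
  from insert.IH[OF 1 homogeneous_diff[OF insert.prems(2) this]]
  obtain t where t: "\<And>i. i \<in> P \<Longrightarrow> homogeneous (a - axis i 1) (t i)"
      "s - hpart (a - axis v 1) k * l v = (\<Sum>i\<in>P. l i * t i)" by blast
  define t' where "t' = t(v := hpart (a - axis v 1) k)"
  have "(\<Sum>i\<in>P. l i * t i) = (\<Sum>i\<in>P. l i * t' i)"
    using insert.hyps by (intro sum.cong) (auto simp: t'_def)
  then have "s = (\<Sum>i\<in>insert v P. l i * t' i)"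
    using t(2) insert.hyps by (simp add: t'_def algebra_simps)
  moreover have "homogeneous (a - axis i 1) (t' i)" if "i \<in> insert v P" for i
    using that t(1) by (auto simp: t'_def homogeneous_hpart)
  ultimately show ?case by blast
qed

definition JW :: "('n, 'k) S set" where "JW = {s. \<exists>g\<in>J. s - g \<in> W}"

lemma JW_add: "s \<in> JW \<Longrightarrow> t \<in> JW \<Longrightarrow> s + t \<in> JW"
  unfolding JW_def using idl.subspace_add[OF ideal] cv.subspace_add[OF subspace_W]
  by simp (metis add_diff_add)

lemma JW_cscale: "s \<in> JW \<Longrightarrow> cscale k s \<in> JW"
  unfolding JW_def using cscale_in_ideal[OF ideal] cv.subspace_scale[OF subspace_W]
  by simp (metis cv.scale_right_diff_distrib)

lemma JW_l: "s \<in> JW \<Longrightarrow> l v * s \<in> JW"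
  unfolding JW_def using idl.subspace_scale[OF ideal] l_mult_W
  by simp (metis right_diff_distrib)

lemma J_JW: "s \<in> J \<Longrightarrow> s \<in> JW"
  unfolding JW_def using cv.subspace_0[OF subspace_W] by (auto intro!: bexI[of _ s])

lemma W_JW: "s \<in> W \<Longrightarrow> s \<in> JW"
  unfolding JW_def using idl.subspace_0[OF ideal] by (auto intro!: bexI[of _ 0])

lemma subspace_JW: "cv.subspace JW"
  using J_JW[OF idl.subspace_0[OF ideal]] by (intro cv.subspaceI JW_add JW_cscale)

text \<open>If the support of \<open>a\<close> is not coindependent, then \<open>J\<close> contains an element whose degree is the indicator
of this support and whose value under \<open>ev\<close> is nonzero; the rest of \<open>x\<^sup>a\<close> is supplied by a factor.\<close>

lemma xm_J_lin_ideal: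
  assumes a: "\<And>i. 0 \<le> a $ i" and "\<not> spanning (zeros a)"
  shows "\<exists>g\<in>J. homogeneous a g \<and> xm a - g \<in> lin_ideal UNIV"
proof -
  let ?T = "UNIV - zeros a"
  obtain f where f: "f \<in> J" "homogeneous (indicator_vec ?T) f" "ev f \<noteq> 0"
    using ev_witness[of ?T] assms(2) by (auto simp: double_diff)
  define b where "b = a - indicator_vec ?T"
  have b: "0 \<le> b $ i" for i
    using a[of i] by (auto simp: b_def indicator_vec_def zeros_def)
  define g where "g = const (inverse (ev f)) * (xm b * f)"
  have "homogeneous (b + indicator_vec ?T) (xm b * f)"
    by (intro homogeneous_mult homogeneous_xm f b)
  then have hg: "homogeneous a g" by (simp add: g_def homogeneous_const_mult b_def)
  have "g \<in> J" unfolding g_def by (intro idl.subspace_scale[OF ideal] f)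
  have "ev g = 1" using f(3) by (simp add: g_def ev.lift_mult ev_const ev_xm)
  then have "ev (xm a - g) = 0" by (simp add: ev.lift_diff ev_xm)
  then have "xm a - g \<in> lin_ideal UNIV"
    using lin_ideal_UNIV_homogeneous[OF homogeneous_diff[OF homogeneous_xm[OF a] hg]] by simp
  then show ?thesis using \<open>g \<in> J\<close> hg by blast
qed

text \<open>Induction on the total degree, as in Nakayama's lemma: modulo the \<open>l\<^sub>i\<close> only multiples of \<open>x\<^sup>a\<close> have to be
reached, and these lie in \<open>W\<close> or, up to the \<open>l\<^sub>i\<close>, in \<open>J\<close>.\<close>

lemma homogeneous_JW:
  assumes "homogeneous a f" shows "f \<in> JW"
proof -
  have "\<forall>a f. homogeneous a f \<longrightarrow> (\<Sum>i\<in>UNIV. a $ i) < int n \<longrightarrow> f \<in> JW" for n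
  proof (induction n)
    case 0
    have "f = 0" if h: "homogeneous a f" "(\<Sum>i\<in>UNIV. a $ i) < 0" for a and f :: "('n, 'k) S"
    proof -
      obtain i where "a $ i < 0" using h(2) by (meson not_le sum_nonneg)
      then show ?thesis using homogeneous_negative h(1) by blast
    qed
    then show ?case using J_JW[OF idl.subspace_0[OF ideal]] by auto
  next
    case (Suc n)
    show ?case
    proof (intro allI impI)
      fix a and f :: "('n, 'k) S" assume f: "homogeneous a f" and n: "(\<Sum>i\<in>UNIV. a $ i) < int (Suc n)"
      have lin_ideal_JW: "s \<in> JW" if "s \<in> lin_ideal UNIV" "homogeneous a s" for s
      proof -
        obtain t where t: "\<And>i. homogeneous (a - axis i 1) (t i)" "s = (\<Sum>i\<in>UNIV. l i * t i)"
          using homogeneous_lin_ideal_sum[OF _ \<open>s \<in> lin_ideal UNIV\<close> \<open>homogeneous a s\<close>] by auto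
        have "(\<Sum>j\<in>UNIV. (a - axis i 1) $ j) < int n" for i
        proof -
          have "(\<Sum>j\<in>UNIV. (a - axis i 1) $ j) = (\<Sum>j\<in>UNIV. a $ j) - 1"
            by (simp add: sum_subtractf axis_def)
          then show ?thesis using n by simp
        qed
        then have "t i \<in> JW" for i using Suc t(1) by blast
        then show ?thesis unfolding t(2) by (intro cv.subspace_sum[OF subspace_JW] JW_l)
      qed
      show "f \<in> JW"
      proof (cases "\<exists>i. a $ i < 0")
        case True
        then have "f = 0" using homogeneous_negative f by blast
        then show ?thesis using J_JW[OF idl.subspace_0[OF ideal]] by simp
      next
        case False
        then have a: "\<And>i. 0 \<le> a $ i" by (meson not_le)
        have "xm a \<in> JW"
        proof (cases "spanning (zeros a)")
          case True
          then show ?thesis using xm_W a W_JW by blast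
        next
          case False
          then obtain g where g: "g \<in> J" "homogeneous a g" "xm a - g \<in> lin_ideal UNIV" using xm_J_lin_ideal a by blast
          then have "xm a - g \<in> JW" by (intro lin_ideal_JW homogeneous_diff homogeneous_xm a)
          then show ?thesis using JW_add[OF _ J_JW[OF g(1)]] by force
        qed
        then have "const (ev f) * xm a \<in> JW" using JW_cscale by (simp add: cscale_def)
        moreover have "f - const (ev f) * xm a \<in> JW"
          by (intro lin_ideal_JW homogeneous_minus_xm_in_lin_ideal f homogeneous_diff homogeneous_const_mult homogeneous_xm a)
        ultimately show ?thesis using JW_add by force
      qed
    qed
  qed
  from this[of "Suc (nat (\<Sum>i\<in>UNIV. a $ i))"] assms show ?thesis by auto
qed

lemma decomposition: "\<exists>g\<in>J. s - g \<in> W"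
proof -
  have "(\<Sum>a\<in>mdeg ` keys s. hpart a s) \<in> JW"
    by (intro cv.subspace_sum[OF subspace_JW] homogeneous_JW[OF homogeneous_hpart])
  then have "s \<in> JW" by (simp add: sum_hpart)
  then show ?thesis by (simp add: JW_def)
qed

text \<open>A nontrivial relation would make one of the generators of \<open>W\<close> in degree \<open>a\<close> superfluous modulo \<open>J\<close>.
Then fewer elements would span \<open>S / J\<close> in degree \<open>a\<close> than its dimension allows.\<close>

lemma J_Int_Wgens:
  assumes f: "f \<in> J" "f \<in> cv.span (Wgens a)" shows "f = 0"
proof (rule ccontr)
  assume "f \<noteq> 0"
  obtain k where k: "f = (\<Sum>g\<in>Wgens a. cscale (k g) g)"
    using f(2) cv.span_finite[OF finite_Wgens] by auto
  have "\<exists>g\<in>Wgens a. k g \<noteq> 0"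
  proof (rule ccontr)
    assume "\<not> ?thesis"
    then have "f = 0" unfolding k by (intro sum.neutral) auto
    then show False using \<open>f \<noteq> 0\<close> by simp
  qed
  then obtain g0 where g0: "g0 \<in> Wgens a" "k g0 \<noteq> 0" by blast
  define R where "R = Wgens a - {g0}"
  have Wgens: "Wgens a = insert g0 R" using g0 by (auto simp: R_def)
  have "f - cscale (k g0) g0 = (\<Sum>g\<in>R. cscale (k g) g)"
    unfolding k R_def using g0 finite_Wgens by (simp add: sum.remove)
  also have "\<dots> \<in> cv.span R" by (intro cv.span_sum cv.span_scale cv.span_base)
  finally have fR: "f - cscale (k g0) g0 \<in> cv.span R" .
  have "\<exists>h\<in>cv.span R. s - h \<in> J" if s: "homogeneous a s" for s
  proof -
    obtain g where g: "g \<in> J" "s - g \<in> W" using decomposition by blast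
    then have "hpart a (s - g) \<in> cv.span (Wgens a)" by (intro hpart_W)
    then have "s - hpart a g \<in> cv.span (insert g0 R)" using s by (simp add: hpart_diff hpart_homogeneous Wgens)
    then obtain q where q: "s - hpart a g - cscale q g0 \<in> cv.span R" by (auto simp: cv.span_breakdown_eq)
    \<comment> \<open>The relation \<open>f\<close> is used to eliminate \<open>g0\<close>.\<close>
    let ?h = "s - hpart a g - cscale q g0 - cscale (q / k g0) (f - cscale (k g0) g0)"
    have "?h \<in> cv.span R" by (intro cv.span_diff q cv.span_scale fR)
    moreover have "s - ?h = hpart a g + cscale (q / k g0) f"
      using g0(2) by (simp add: cv.scale_right_diff_distrib)
    moreover have "hpart a g + cscale (q / k g0) f \<in> J"
      by (intro idl.subspace_add[OF ideal] graded g cscale_in_ideal ideal f)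
    ultimately show ?thesis by (intro bexI[of _ ?h]) (simp_all only:)
  qed
  then have "card {u. (\<forall>i. int (u i) \<le> a $ i) \<and> spanning {i. u i = 0}} \<le> card R"
    using finite_Wgens by (intro indep_mod_le_card[OF ideal count]) (auto simp: R_def)
  also have "\<dots> < card (Wgens a)" using finite_Wgens g0 unfolding R_def by (intro card_Diff1_less)
  finally show False using card_Wgens[of a] by simp
qed

lemma J_Int_W:
  assumes f: "f \<in> J" "f \<in> W" shows "f = 0"
proof -
  have "hpart a f = 0" for a using J_Int_Wgens[OF graded[OF f(1)] hpart_W[OF f(2)]] .
  then show ?thesis using sum_hpart[of "mdeg ` keys f" f] by simp
qed

text \<open>The decomposition of an element of the ideal of the \<open>l\<^sub>i\<close> can be made inside this ideal, because both
\<open>J\<close> and \<open>W\<close> are closed under multiplication by the \<open>l\<^sub>i\<close>.\<close>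

lemma lin_ideal_decomposition:
  assumes "s \<in> lin_ideal P" shows "\<exists>g\<in>J. s - g \<in> W \<and> s - g \<in> lin_ideal P"
proof -
  have "s \<in> idl.span (l ` P)" using assms by (simp add: lin_ideal_def)
  then show ?thesis
  proof (induction rule: idl.span_induct_alt)
    case base
    then show ?case
      using cv.subspace_0[OF subspace_W] idl.subspace_0[OF subspace_lin_ideal] idl.subspace_0[OF ideal]
      by (auto intro!: bexI[of _ 0])
  next
    case (step r x y)
    then obtain i where i: "i \<in> P" "x = l i" by blast
    obtain g where g: "g \<in> J" "r - g \<in> W" using decomposition by blast
    obtain h where h: "h \<in> J" "y - h \<in> W" "y - h \<in> lin_ideal P" using step by blast
    have "r * x + y - (l i * g + h) = l i * (r - g) + (y - h)" by (simp add: i algebra_simps)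
    moreover have "l i * (r - g) \<in> W" by (intro l_mult_W g)
    moreover have "l i * (r - g) \<in> lin_ideal P"
      using i(1) idl.subspace_scale[OF subspace_lin_ideal, of "l i" P "r - g"] by (simp add: lin_ideal_def idl.span_base mult.commute)
    moreover have "l i * g + h \<in> J" by (intro idl.subspace_add[OF ideal] idl.subspace_scale[OF ideal] g h)
    ultimately show ?case
      using h cv.subspace_add[OF subspace_W] idl.subspace_add[OF subspace_lin_ideal] by metis
  qed
qed

text \<open>\<open>l\<^sub>v\<close> is a nonzerodivisor on \<open>S / (J + lin_ideal P)\<close>.  After decomposing all elements, the parts in
\<open>W\<close> satisfy the same relation in \<open>S\<close> itself, since \<open>J \<inter> W = 0\<close>; and there the ideal of the \<open>l\<^sub>i\<close> is
prime.\<close>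

lemma regular:
  assumes "v \<notin> P" and g: "g \<in> J" "l v * s - g \<in> lin_ideal P"
  shows "\<exists>g\<in>J. s - g \<in> lin_ideal P"
proof -
  obtain h where h: "h \<in> J" "s - h \<in> W" using decomposition by blast
  obtain g' where g': "g' \<in> J" "l v * s - g - g' \<in> W" "l v * s - g - g' \<in> lin_ideal P"
    using lin_ideal_decomposition[OF g(2)] by blast
  let ?d = "l v * (s - h) - (l v * s - g - g')"
  have "?d = g + g' - l v * h" by (simp add: algebra_simps)
  then have "?d \<in> J"
    using idl.subspace_diff[OF ideal] idl.subspace_add[OF ideal] idl.subspace_scale[OF ideal] g g' h by metis
  moreover have "?d \<in> W" by (intro cv.subspace_diff[OF subspace_W] l_mult_W h g')
  ultimately have "?d = 0" by (rule J_Int_W)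
  then have "l v * (s - h) \<in> lin_ideal P" using g'(3) by simp
  then show ?thesis using lin_ideal_prime[OF assms(1)] h(1) by blast
qed

text \<open>Otherwise \<open>x\<^sup>a \<in> W\<close> would be congruent modulo \<open>J\<close> to an element of \<open>W\<close> in the ideal of the \<open>l\<^sub>i\<close>, hence equal
to it.\<close>

lemma ev_J:
  assumes a: "\<And>i. 0 \<le> a $ i" "spanning (zeros a)" and f: "f \<in> J" "homogeneous a f"
  shows "ev f = 0"
proof -
  obtain g where g: "g \<in> J" "f - const (ev f) * xm a - g \<in> W" "f - const (ev f) * xm a - g \<in> lin_ideal UNIV"
    using lin_ideal_decomposition[OF homogeneous_minus_xm_in_lin_ideal[OF f(2)]] by blast
  have "f - g = f - const (ev f) * xm a - g + cscale (ev f) (xm a)" by (simp add: cscale_def)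
  also have "\<dots> \<in> W" by (intro cv.subspace_add[OF subspace_W] cv.subspace_scale[OF subspace_W] g xm_W a)
  finally have "f - g = 0" using J_Int_W[of "f - g"] idl.subspace_diff[OF ideal f(1) g(1)] by blast
  then have "const (ev f) * xm a \<in> lin_ideal UNIV"
    using g(3) idl.subspace_neg[OF subspace_lin_ideal g(3)] by (simp add: algebra_simps)
  then have "ev (const (ev f) * xm a) = 0"
    using lin_ideal_UNIV_homogeneous[OF homogeneous_const_mult[OF homogeneous_xm[OF a(1)]]] by blast
  then show ?thesis by (simp add: ev.lift_mult ev_const ev_xm)
qed

end

section \<open>Graded resolutions\<close>

locale resolved_ideal = specialised_ideal \<rho> J c
  for \<rho> :: "'n::finite set \<Rightarrow> nat" and J :: "('n, 'k::field) S set" and c :: "'n \<Rightarrow> 'k" +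
  fixes F :: "('n, 'k) graded_complex"
  assumes res: "graded_free_resolution J F"
begin

lemmas res_conjs = res[unfolded graded_free_resolution_def]

lemma homogeneous_aug: "b \<in> basis F 0 \<Longrightarrow> homogeneous (bdeg F 0 b) (aug F b)"
  by (rule bspec[OF res_conjs[THEN conjunct1]])

lemma diff_free: "b \<in> basis F (Suc i) \<Longrightarrow> diff F i b \<in> free_on (basis F i)"
  and homogeneous_diff_entry: "b \<in> basis F (Suc i) \<Longrightarrow> e \<in> basis F i \<Longrightarrow>
        homogeneous (bdeg F (Suc i) b - bdeg F i e) (lookup (diff F i b) e)"
  using res_conjs[THEN conjunct2, THEN conjunct1, rule_format] by simp_all

lemma aug_onto: "\<exists>v\<in>free_on (basis F 0). s - aug_map F v \<in> J"
  by (rule spec[OF res_conjs[THEN conjunct2, THEN conjunct2, THEN conjunct1]])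

lemma aug_exact: "{v \<in> free_on (basis F 0). aug_map F v \<in> J} = lin_ext (diff F 0) ` free_on (basis F 1)"
  by (rule res_conjs[THEN conjunct2, THEN conjunct2, THEN conjunct2, THEN conjunct1])

lemma diff_exact: "{v \<in> free_on (basis F (Suc i)). lin_ext (diff F i) v = 0} =
        lin_ext (diff F (Suc i)) ` free_on (basis F (Suc (Suc i)))"
  by (rule spec[OF res_conjs[THEN conjunct2, THEN conjunct2, THEN conjunct2, THEN conjunct2]])

lemma diff_entry_0: "b \<in> basis F (Suc i) \<Longrightarrow> e \<notin> basis F i \<Longrightarrow> lookup (diff F i b) e = 0"
  using diff_free[of b i] by (auto simp: free_on_def in_keys_iff)

lemma d_free: "v \<in> free_on (basis F (Suc i)) \<Longrightarrow> lin_ext (diff F i) v \<in> free_on (basis F i)"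
  using keys_lin_ext[of "diff F i" v] diff_free[of _ i] unfolding free_on_def by blast

lemma dd: "v \<in> free_on (basis F (Suc (Suc i))) \<Longrightarrow> lin_ext (diff F i) (lin_ext (diff F (Suc i)) v) = 0"
  using diff_exact[of i] by blast

lemma aug_d: "v \<in> free_on (basis F 1) \<Longrightarrow> aug_map F (lin_ext (diff F 0) v) \<in> J"
  using aug_exact by blast

lemma aug_superset: "finite A \<Longrightarrow> keys v \<subseteq> A \<Longrightarrow> aug_map F v = (\<Sum>b\<in>A. lookup v b * aug F b)"
  unfolding aug_map_def by (intro sum.mono_neutral_left) (auto simp: in_keys_iff)

lemma aug_add: "aug_map F (v + w) = aug_map F v + aug_map F w"
  using keys_add[of v w]
  by (simp add: aug_superset[where A = "keys v \<union> keys w"] lookup_add distrib_right sum.distrib)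

lemma aug_fscale: "aug_map F (fscale r v) = r * aug_map F v"
proof -
  have "keys (fscale r v) \<subseteq> keys v" by (auto simp: in_keys_iff lookup_fscale)
  then show ?thesis by (simp add: aug_superset[where A = "keys v"] lookup_fscale sum_distrib_left mult.assoc)
qed

lemma aug_diff: "aug_map F (v - w) = aug_map F v - aug_map F w"
  using aug_add[of "v - w" w] by simp

definition lin_vecs :: "'n set \<Rightarrow> (nat \<Rightarrow>\<^sub>0 ('n, 'k) S) set" where
  "lin_vecs P = {v. \<forall>b. lookup v b \<in> lin_ideal P}"

lemma lin_vecs_add: "v \<in> lin_vecs P \<Longrightarrow> w \<in> lin_vecs P \<Longrightarrow> v + w \<in> lin_vecs P"
  by (simp add: lin_vecs_def lookup_add idl.subspace_add[OF subspace_lin_ideal])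

lemma lin_vecs_fscale: "v \<in> lin_vecs P \<Longrightarrow> fscale r v \<in> lin_vecs P"
  by (simp add: lin_vecs_def lookup_fscale idl.subspace_scale[OF subspace_lin_ideal])

lemma lin_ideal_mult_right: "s \<in> lin_ideal P \<Longrightarrow> s * r \<in> lin_ideal P"
  using idl.subspace_scale[OF subspace_lin_ideal, of s P r] by (simp add: mult.commute)

lemma aug_lin_vecs: "v \<in> lin_vecs P \<Longrightarrow> aug_map F v \<in> lin_ideal P"
  unfolding aug_map_def lin_vecs_def
  by (intro idl.subspace_sum[OF subspace_lin_ideal]) (simp add: lin_ideal_mult_right)

lemma lin_ext_lin_vecs: "v \<in> lin_vecs P \<Longrightarrow> lin_ext D v \<in> lin_vecs P"
  unfolding lin_ext_def lin_vecs_def mem_Collect_eq lookup_sum lookup_fscale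
  by (intro allI idl.subspace_sum[OF subspace_lin_ideal]) (simp add: lin_ideal_mult_right)

lemma l_in_lin_ideal: "p \<in> P \<Longrightarrow> l p * r \<in> lin_ideal P"
  using idl.subspace_scale[OF subspace_lin_ideal, of "l p" P r] by (simp add: lin_ideal_def idl.span_base mult.commute)

lemma lin_ideal_mono: "P \<subseteq> Q \<Longrightarrow> s \<in> lin_ideal P \<Longrightarrow> s \<in> lin_ideal Q"
  unfolding lin_ideal_def using idl.span_mono[of "l ` P" "l ` Q"] by blast

lemma lin_vecs_insert:
  assumes "v \<in> lin_vecs (insert p P)"
  shows "\<exists>t. keys t \<subseteq> keys v \<and> v - fscale (l p) t \<in> lin_vecs P"
proof -
  have "\<forall>b. \<exists>t. lookup v b - t * l p \<in> lin_ideal P" using assms by (simp add: lin_vecs_def lin_ideal_insert)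
  then obtain t where t: "\<And>b. lookup v b - t b * l p \<in> lin_ideal P" by metis
  define t' where "t' = Poly_Mapping.mapp (\<lambda>b _. t b) v"
  have t': "lookup t' b = (t b when b \<in> keys v)" for b by (simp add: t'_def lookup_mapp)
  have "lookup v b - l p * lookup t' b \<in> lin_ideal P" for b
    using t[of b] idl.subspace_0[OF subspace_lin_ideal]
    by (cases "b \<in> keys v") (simp_all add: t' mult.commute in_keys_iff)
  then have "v - fscale (l p) t' \<in> lin_vecs P" by (simp add: lin_vecs_def lookup_minus lookup_fscale)
  then show ?thesis using keys_mapp_subset[of "\<lambda>b _. t b" v] t'_def by blast
qed

lemma lin_ideal_lift:
  assumes "s \<in> lin_ideal P" shows "\<exists>w\<in>free_on (basis F 0). w \<in> lin_vecs P \<and> s - aug_map F w \<in> J"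
proof -
  have "s \<in> idl.span (l ` P)" using assms by (simp add: lin_ideal_def)
  then show ?thesis
  proof (induction rule: idl.span_induct_alt)
    case base
    then show ?case
      using idl.subspace_0[OF subspace_lin_ideal] idl.subspace_0[OF ideal]
      by (intro bexI[of _ 0]) (auto simp: lin_vecs_def aug_map_def free_on_def)
  next
    case (step r x y)
    then obtain p where p: "p \<in> P" "x = l p" by blast
    obtain w where w: "w \<in> free_on (basis F 0)" "r - aug_map F w \<in> J" using aug_onto by blast
    obtain w' where w': "w' \<in> free_on (basis F 0)" "w' \<in> lin_vecs P" "y - aug_map F w' \<in> J" using step by blast
    have "r * x + y - aug_map F (fscale (l p) w + w') = l p * (r - aug_map F w) + (y - aug_map F w')"
      by (simp add: p aug_add aug_fscale algebra_simps)
    also have "\<dots> \<in> J" by (intro idl.subspace_add[OF ideal] idl.subspace_scale[OF ideal] w w')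
    finally have "r * x + y - aug_map F (fscale (l p) w + w') \<in> J" .
    moreover have "fscale (l p) w + w' \<in> lin_vecs P"
      by (intro lin_vecs_add w') (simp add: lin_vecs_def lookup_fscale l_in_lin_ideal p)
    moreover have "fscale (l p) w + w' \<in> free_on (basis F 0)"
      by (intro fmod.subspace_add[OF subspace_free_on] fmod.subspace_scale[OF subspace_free_on] w w')
    ultimately show ?case by blast
  qed
qed

text \<open>Right exactness of the reduction modulo the \<open>l\<^sub>i\<close>.\<close>

lemma exact_mod_0:
  assumes v: "v \<in> free_on (basis F 0)" and "g \<in> J" "aug_map F v - g \<in> lin_ideal P"
  shows "\<exists>u\<in>free_on (basis F 1). v - lin_ext (diff F 0) u \<in> lin_vecs P"
proof -
  obtain w where w: "w \<in> free_on (basis F 0)" "w \<in> lin_vecs P" "aug_map F v - g - aug_map F w \<in> J"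
    using lin_ideal_lift[OF assms(3)] by blast
  have "aug_map F (v - w) = (aug_map F v - g - aug_map F w) + g" by (simp add: aug_diff)
  also have "\<dots> \<in> J" by (intro idl.subspace_add[OF ideal] w assms)
  finally obtain u where "u \<in> free_on (basis F 1)" "v - w = lin_ext (diff F 0) u"
    using aug_exact fmod.subspace_diff[OF subspace_free_on v w(1)] by blast
  moreover from this have "v - lin_ext (diff F 0) u = w" by (simp add: algebra_simps)
  ultimately show ?thesis using w(2) by auto
qed

text \<open>A resolution stays exact when a regular sequence is divided out.  In each step a vector with
\<open>d v = l\<^sub>p w\<close> modulo the previous forms is corrected by \<open>l\<^sub>p u\<close> where \<open>w = d u\<close>.  That such a \<open>u\<close> exists
follows from exactness before the step; at the last place \<open>i = 0\<close> this rests on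
\<open>l\<^sub>p\<close> being regular on \<open>S / J\<close> modulo the previous forms, and elsewhere on its being regular on \<open>S\<close>
modulo these forms.\<close>

lemma exact_mod_Suc:
  assumes "finite P" "v \<in> free_on (basis F (Suc i))" "lin_ext (diff F i) v \<in> lin_vecs P"
  shows "\<exists>u\<in>free_on (basis F (Suc (Suc i))). v - lin_ext (diff F (Suc i)) u \<in> lin_vecs P"
  using assms
proof (induction P arbitrary: i v rule: finite_induct)
  case empty
  then have "lin_ext (diff F i) v = 0" by (intro poly_mapping_eqI) (simp add: lin_vecs_def lin_ideal_def)
  then obtain u where "u \<in> free_on (basis F (Suc (Suc i)))" "v = lin_ext (diff F (Suc i)) u"
    using diff_exact empty by blast
  then show ?case using idl.subspace_0[OF subspace_lin_ideal] by (intro bexI[of _ u]) (auto simp: lin_vecs_def)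
next
  case (insert p P)
  obtain w where w: "keys w \<subseteq> keys (lin_ext (diff F i) v)" "lin_ext (diff F i) v - fscale (l p) w \<in> lin_vecs P"
    using lin_vecs_insert[OF insert.prems(2)] by blast
  have wf: "w \<in> free_on (basis F i)"
    using w(1) d_free[OF insert.prems(1)] by (auto simp: free_on_def)
  have "\<exists>u\<in>free_on (basis F (Suc i)). w - lin_ext (diff F i) u \<in> lin_vecs P"
  proof (cases i)
    case 0
    let ?g = "aug_map F (lin_ext (diff F i) v)"
    have g: "?g \<in> J" using aug_d insert.prems(1) 0 by simp
    have "?g - l p * aug_map F w \<in> lin_ideal P" using aug_lin_vecs[OF w(2)] by (simp add: aug_diff aug_fscale)
    then have "l p * aug_map F w - ?g \<in> lin_ideal P" using idl.subspace_neg[OF subspace_lin_ideal] by fastforce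
    from regular[OF insert.hyps(2) g this] obtain g' where "g' \<in> J" "aug_map F w - g' \<in> lin_ideal P" by blast
    then show ?thesis using exact_mod_0[of w g' P] wf 0 by simp
  next
    case (Suc j)
    have "lin_ext (diff F j) (lin_ext (diff F i) v - fscale (l p) w) = - fscale (l p) (lin_ext (diff F j) w)"
      using dd insert.prems(1) Suc by (simp add: lin_ext_diff lin_ext_fscale)
    then have "- fscale (l p) (lin_ext (diff F j) w) \<in> lin_vecs P" using lin_ext_lin_vecs[OF w(2)] by metis
    from lin_vecs_fscale[OF this, of "- 1"] have "l p * lookup (lin_ext (diff F j) w) b \<in> lin_ideal P" for b
      by (simp add: lin_vecs_def lookup_fscale)
    then have "lin_ext (diff F j) w \<in> lin_vecs P" using lin_ideal_prime[OF insert.hyps(2)] by (simp add: lin_vecs_def)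
    then show ?thesis using insert.IH[of w j] wf Suc by simp
  qed
  then obtain u where u: "u \<in> free_on (basis F (Suc i))" "w - lin_ext (diff F i) u \<in> lin_vecs P" by blast
  have vu: "v - fscale (l p) u \<in> free_on (basis F (Suc i))"
    by (intro fmod.subspace_diff[OF subspace_free_on] fmod.subspace_scale[OF subspace_free_on] u insert.prems)
  have "lin_ext (diff F i) (v - fscale (l p) u) =
      (lin_ext (diff F i) v - fscale (l p) w) + fscale (l p) (w - lin_ext (diff F i) u)"
    by (simp add: lin_ext_diff lin_ext_fscale fmod.scale_right_diff_distrib)
  also have "\<dots> \<in> lin_vecs P" by (intro lin_vecs_add lin_vecs_fscale w u)
  finally obtain t where t: "t \<in> free_on (basis F (Suc (Suc i)))"
      "v - fscale (l p) u - lin_ext (diff F (Suc i)) t \<in> lin_vecs P"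
    using insert.IH[OF vu] by blast
  have "v - lin_ext (diff F (Suc i)) t = (v - fscale (l p) u - lin_ext (diff F (Suc i)) t) + fscale (l p) u"
    by simp
  also have "\<dots> \<in> lin_vecs (insert p P)"
  proof (rule lin_vecs_add)
    show "v - fscale (l p) u - lin_ext (diff F (Suc i)) t \<in> lin_vecs (insert p P)"
      using t(2) lin_ideal_mono[of P "insert p P"] by (auto simp: lin_vecs_def)
    show "fscale (l p) u \<in> lin_vecs (insert p P)" by (simp add: lin_vecs_def lookup_fscale l_in_lin_ideal)
  qed
  finally show ?case using t(1) by blast
qed

subsection \<open>The complex obtained by specialising\<close>

text \<open>Over \<open>\<kk>[x]\<close>, the degree \<open>a\<close> part of the resolution has a basis consisting of the monomial multiples of the
basis elements \<open>b\<close> of degree at most \<open>a\<close>.  With these multiples named by \<open>b\<close>, the differential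
is given by the values of its entries under \<open>ev\<close> in all degrees.  \<open>spec_vec\<close> is the reduction to
degree \<open>a\<close>, and \<open>hlift\<close> a section of it.\<close>

definition spec_diff :: "nat \<Rightarrow> nat \<Rightarrow> (nat \<Rightarrow>\<^sub>0 'k)" where "spec_diff i b = Poly_Mapping.map ev (diff F i b)"

definition spec_vec :: "nat \<Rightarrow> int ^ 'n \<Rightarrow> (nat \<Rightarrow>\<^sub>0 ('n, 'k) S) \<Rightarrow> (nat \<Rightarrow>\<^sub>0 'k)" where
  "spec_vec i a w = Poly_Mapping.mapp (\<lambda>b s. ev_deg (a - bdeg F i b) s) w"

definition hlift :: "nat \<Rightarrow> int ^ 'n \<Rightarrow> (nat \<Rightarrow>\<^sub>0 'k) \<Rightarrow> (nat \<Rightarrow>\<^sub>0 ('n, 'k) S)" where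
  "hlift i a v = Poly_Mapping.mapp (\<lambda>b k. const k * xm (a - bdeg F i b)) v"

definition spec_aug :: "(nat \<Rightarrow>\<^sub>0 'k) \<Rightarrow> 'k" where
  "spec_aug v = (\<Sum>b\<in>keys v. lookup v b * ev (aug F b))"

lemma lookup_spec_diff: "lookup (spec_diff i b) e = ev (lookup (diff F i b) e)"
  by (simp add: spec_diff_def map.rep_eq when_def ev.lift_zero)

lemma lookup_spec_vec: "lookup (spec_vec i a w) b = ev_deg (a - bdeg F i b) (lookup w b)"
  by (simp add: spec_vec_def lookup_mapp when_def in_keys_iff ev_deg_zero)

lemma lookup_hlift: "lookup (hlift i a v) b = const (lookup v b) * xm (a - bdeg F i b)"
  by (simp add: hlift_def lookup_mapp when_def in_keys_iff)

lemma spec_vec_zero: "spec_vec i a 0 = 0"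
  by (rule poly_mapping_eqI) (simp add: lookup_spec_vec ev_deg_zero)

lemma spec_vec_lin_vecs:
  assumes "v - w \<in> lin_vecs UNIV" shows "spec_vec i a v = spec_vec i a w"
proof (rule poly_mapping_eqI)
  fix b
  have "lookup v b - lookup w b \<in> lin_ideal UNIV" using assms by (simp add: lin_vecs_def lookup_minus)
  then have "ev_deg (a - bdeg F i b) (lookup v b - lookup w b) = 0" by (rule ev_deg_lin_ideal)
  then show "lookup (spec_vec i a v) b = lookup (spec_vec i a w) b"
    using ev_deg_add[of "a - bdeg F i b" "lookup v b - lookup w b" "lookup w b"] by (simp add: lookup_spec_vec)
qed

text \<open>Taking the degree \<open>a\<close> part commutes with the differential, since its entries are homogeneous.\<close>

lemma spec_vec_d:
  assumes w: "w \<in> free_on (basis F (Suc i))"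
  shows "spec_vec i a (lin_ext (diff F i) w) = lin_ext (spec_diff i) (spec_vec (Suc i) a w)"
proof (rule poly_mapping_eqI)
  fix e
  have kE: "keys (spec_vec (Suc i) a w) \<subseteq> keys w" by (auto simp: in_keys_iff lookup_spec_vec ev_deg_zero)
  have "lookup (spec_vec i a (lin_ext (diff F i) w)) e =
      (\<Sum>b\<in>keys w. ev_deg (a - bdeg F i e) (lookup w b * lookup (diff F i b) e))"
    by (simp add: lookup_spec_vec lin_ext_def lookup_sum lookup_fscale ev_deg_sum)
  also have "\<dots> = (\<Sum>b\<in>keys w. ev_deg (a - bdeg F (Suc i) b) (lookup w b) * ev (lookup (diff F i b) e))"
  proof (rule sum.cong[OF refl])
    fix b assume "b \<in> keys w"
    then have b: "b \<in> basis F (Suc i)" using w by (auto simp: free_on_def)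
    show "ev_deg (a - bdeg F i e) (lookup w b * lookup (diff F i b) e) =
        ev_deg (a - bdeg F (Suc i) b) (lookup w b) * ev (lookup (diff F i b) e)"
    proof (cases "e \<in> basis F i")
      case True
      then show ?thesis by (simp add: ev_deg_mult[OF homogeneous_diff_entry[OF b]])
    qed (simp add: diff_entry_0[OF b] ev_deg_zero ev.lift_zero)
  qed
  also have "\<dots> = lookup (lin_ext (spec_diff i) (spec_vec (Suc i) a w)) e"
    by (simp add: lin_ext_superset[OF _ kE] lookup_sum lookup_fscale lookup_spec_vec lookup_spec_diff)
  finally show "lookup (spec_vec i a (lin_ext (diff F i) w)) e = lookup (lin_ext (spec_diff i) (spec_vec (Suc i) a w)) e" .
qed

lemma ev_deg_aug:
  assumes w: "w \<in> free_on (basis F 0)" shows "ev_deg a (aug_map F w) = spec_aug (spec_vec 0 a w)"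
proof -
  have kE: "keys (spec_vec 0 a w) \<subseteq> keys w" by (auto simp: in_keys_iff lookup_spec_vec ev_deg_zero)
  have "ev_deg a (aug_map F w) = (\<Sum>b\<in>keys w. ev_deg (a - bdeg F 0 b) (lookup w b) * ev (aug F b))"
    unfolding aug_map_def ev_deg_sum
    using w by (intro sum.cong refl ev_deg_mult homogeneous_aug) (auto simp: free_on_def)
  also have "\<dots> = spec_aug (spec_vec 0 a w)"
    unfolding spec_aug_def using kE by (intro sum.mono_neutral_cong_right) (auto simp: lookup_spec_vec in_keys_iff)
  finally show ?thesis .
qed

sublocale filtered_complex \<rho> "basis F" "bdeg F" spec_diff
proof
  fix b i e assume b: "b \<in> basis F (Suc i)" and e: "e \<in> keys (spec_diff i b)"
  have ne: "lookup (diff F i b) e \<noteq> 0" using e by (auto simp: in_keys_iff lookup_spec_diff ev.lift_zero)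
  then have eB: "e \<in> basis F i" using diff_entry_0[OF b] by blast
  have "bdeg F i e $ j \<le> bdeg F (Suc i) b $ j" for j
    using homogeneous_negative[OF homogeneous_diff_entry[OF b eB], of j] ne
    by (cases "bdeg F i e $ j \<le> bdeg F (Suc i) b $ j") auto
  then show "e \<in> basis F i \<and> (\<forall>j. bdeg F i e $ j \<le> bdeg F (Suc i) b $ j)" using eB by blast
next
  fix b i assume b: "b \<in> basis F (Suc (Suc i))"
  have 1: "single b 1 \<in> free_on (basis F (Suc (Suc i)))" using b by (simp add: free_on_def)
  have "lin_ext (diff F (Suc i)) (single b 1) = diff F (Suc i) b"
    by (simp add: lin_ext_single)
  with dd[OF 1] have 0: "lin_ext (diff F i) (diff F (Suc i) b) = 0" by simp
  have "spec_diff (Suc i) b = spec_vec (Suc i) (bdeg F (Suc (Suc i)) b) (diff F (Suc i) b)"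
  proof (rule poly_mapping_eqI)
    fix e show "lookup (spec_diff (Suc i) b) e = lookup (spec_vec (Suc i) (bdeg F (Suc (Suc i)) b) (diff F (Suc i) b)) e"
      using homogeneous_diff_entry[OF b] diff_entry_0[OF b]
      by (cases "e \<in> basis F (Suc i)") (simp_all add: lookup_spec_diff lookup_spec_vec ev_deg_homogeneous ev_deg_zero ev.lift_zero)
  qed
  then show "lin_ext (spec_diff i) (spec_diff (Suc i) b) = 0"
    using spec_vec_d[OF diff_free[OF b], of "bdeg F (Suc (Suc i)) b"] 0 by (simp add: spec_vec_zero)
qed

lemma spec_vec_Level:
  assumes "w \<in> free_on (basis F i)" shows "spec_vec i a w \<in> free_on (Level {} a i)"
proof -
  have "b \<in> basis F i \<and> (\<forall>j. bdeg F i b $ j \<le> a $ j)" if "b \<in> keys (spec_vec i a w)" for b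
  proof -
    have ne: "ev_deg (a - bdeg F i b) (lookup w b) \<noteq> 0" using that by (simp add: in_keys_iff lookup_spec_vec)
    then have "lookup w b \<noteq> 0" by (auto simp: ev_deg_zero)
    moreover have "bdeg F i b $ j \<le> a $ j" for j
      using ne ev_deg_negative[of "a - bdeg F i b" j] by (cases "bdeg F i b $ j \<le> a $ j") auto
    ultimately show ?thesis using assms by (auto simp: free_on_def in_keys_iff)
  qed
  then show ?thesis by (auto simp: free_on_def Level_def)
qed

lemma hlift_free: "v \<in> free_on (Level {} a i) \<Longrightarrow> hlift i a v \<in> free_on (basis F i)"
  using keys_mapp_subset[of _ v] by (fastforce simp: free_on_def Level_def hlift_def)

lemma homogeneous_hlift:
  assumes "v \<in> free_on (Level {} a i)" shows "homogeneous (a - bdeg F i b) (lookup (hlift i a v) b)"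
proof (cases "b \<in> keys v")
  case True
  then have "0 \<le> (a - bdeg F i b) $ j" for j using assms by (auto simp: free_on_def Level_def)
  then show ?thesis unfolding lookup_hlift by (intro homogeneous_const_mult homogeneous_xm)
qed (simp add: lookup_hlift in_keys_iff homogeneous_zero)

lemma spec_vec_hlift:
  assumes "v \<in> free_on (Level {} a i)" shows "spec_vec i a (hlift i a v) = v"
proof (rule poly_mapping_eqI)
  fix b
  have "lookup (spec_vec i a (hlift i a v)) b = ev (lookup (hlift i a v) b)"
    using homogeneous_hlift[OF assms] by (simp add: lookup_spec_vec ev_deg_homogeneous)
  then show "lookup (spec_vec i a (hlift i a v)) b = lookup v b"
    by (simp add: lookup_hlift ev.lift_mult ev_const ev_xm)
qed

lemma spec_diff_Level:
  assumes "v \<in> free_on (Level {} a (Suc i))"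
  shows "dX spec_diff (Level {} a) (Suc i) v = lin_ext (spec_diff i) v"
proof -
  have "lin_ext (spec_diff i) v = spec_vec i a (lin_ext (diff F i) (hlift (Suc i) a v))"
    using spec_vec_d[OF hlift_free[OF assms], of a] spec_vec_hlift[OF assms] by simp
  also have "\<dots> \<in> free_on (Level {} a i)" by (intro spec_vec_Level d_free hlift_free assms)
  finally show ?thesis by (simp add: dX_def restr_eq_self)
qed

lemma bnd_from_lift:
  assumes v: "v \<in> free_on (Level {} a i)" and u: "u \<in> free_on (basis F (Suc i))"
    and "hlift i a v - lin_ext (diff F i) u \<in> lin_vecs UNIV"
  shows "v \<in> bnd spec_diff (Level {} a) i"
proof -
  have "v = lin_ext (spec_diff i) (spec_vec (Suc i) a u)"
    using spec_vec_lin_vecs[OF assms(3), of i a] spec_vec_hlift[OF v] spec_vec_d[OF u, of a] by simp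
  also have "\<dots> = dX spec_diff (Level {} a) (Suc i) (spec_vec (Suc i) a u)"
    using spec_diff_Level[OF spec_vec_Level[OF u]] by simp
  finally show ?thesis unfolding bnd_def using spec_vec_Level[OF u] by blast
qed

lemma homogeneous_d_hlift:
  assumes v: "v \<in> free_on (Level {} a (Suc i))" and e: "e \<in> basis F i"
  shows "homogeneous (a - bdeg F i e) (lookup (lin_ext (diff F i) (hlift (Suc i) a v)) e)"
  unfolding lin_ext_def lookup_sum lookup_fscale
proof (rule homogeneous_sum)
  fix b assume "b \<in> keys (hlift (Suc i) a v)"
  then have b: "b \<in> basis F (Suc i)" using hlift_free[OF v] by (auto simp: free_on_def)
  show "homogeneous (a - bdeg F i e) (lookup (hlift (Suc i) a v) b * lookup (diff F i b) e)"
    using homogeneous_mult[OF homogeneous_hlift[OF v, of b] homogeneous_diff_entry[OF b e]] by simp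
qed

lemma homogeneous_aug_hlift:
  assumes v: "v \<in> free_on (Level {} a 0)"
  shows "homogeneous a (aug_map F (hlift 0 a v))"
  unfolding aug_map_def
proof (rule homogeneous_sum)
  fix b assume "b \<in> keys (hlift 0 a v)"
  then have b: "b \<in> basis F 0" using hlift_free[OF v] by (auto simp: free_on_def)
  show "homogeneous a (lookup (hlift 0 a v) b * aug F b)"
    using homogeneous_mult[OF homogeneous_hlift[OF v, of b] homogeneous_aug[OF b]] by simp
qed

lemma ev_deg_J: "H0_degree a \<Longrightarrow> f \<in> J \<Longrightarrow> ev_deg a f = 0"
  unfolding ev_deg_def using ev_J[OF _ _ graded homogeneous_hpart] by (auto simp: H0_degree_def)

text \<open>Cycles of the specialised complex are lifted to homogeneous vectors over \<open>S\<close>, whose differentials lie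
in the ideal of the \<open>l\<^sub>i\<close> as homogeneous elements with value \<open>0\<close> under \<open>ev\<close>.  So exactness modulo the
\<open>l\<^sub>i\<close> applies.\<close>

sublocale filtered_resolution \<rho> "basis F" "bdeg F" spec_diff spec_aug
proof
  have sup: "spec_aug v = (\<Sum>b\<in>A. lookup v b * ev (aug F b))" if "finite A" "keys v \<subseteq> A" for v A
    unfolding spec_aug_def using that by (intro sum.mono_neutral_left) (auto simp: in_keys_iff)
  show "spec_aug (x + y) = spec_aug x + spec_aug y" for x y
    using keys_add[of x y] by (simp add: sup[where A = "keys x \<union> keys y"] lookup_add distrib_right sum.distrib)
  show "spec_aug (fscale r x) = r * spec_aug x" for r x
  proof -
    have "keys (fscale r x) \<subseteq> keys x" by (auto simp: in_keys_iff lookup_fscale)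
    then show ?thesis by (simp add: sup[where A = "keys x"] lookup_fscale sum_distrib_left mult.assoc)
  qed
next
  fix a i
  show "exact_at spec_diff (Level {} a) (Suc i)"
  proof
    fix v assume "v \<in> cyc spec_diff (Level {} a) (Suc i)"
    then have v: "v \<in> free_on (Level {} a (Suc i))" "lin_ext (spec_diff i) v = 0"
      using spec_diff_Level by (auto simp: cyc_def)
    let ?w = "hlift (Suc i) a v"
    have 0: "spec_vec i a (lin_ext (diff F i) ?w) = 0"
      using spec_vec_d[OF hlift_free[OF v(1)], of a] spec_vec_hlift[OF v(1)] v(2) by simp
    have "lookup (lin_ext (diff F i) ?w) e \<in> lin_ideal UNIV" for e
    proof (cases "e \<in> basis F i")
      case True
      note h = homogeneous_d_hlift[OF v(1) True]
      have "lookup (spec_vec i a (lin_ext (diff F i) ?w)) e = 0" by (simp add: 0)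
      then show ?thesis using lin_ideal_UNIV_homogeneous[OF h] ev_deg_homogeneous[OF h] by (simp add: lookup_spec_vec)
    next
      case False
      then have "lookup (lin_ext (diff F i) ?w) e = 0"
        using d_free[OF hlift_free[OF v(1)]] by (auto simp: free_on_def in_keys_iff)
      then show ?thesis by (simp add: idl.subspace_0[OF subspace_lin_ideal])
    qed
    then have "lin_ext (diff F i) ?w \<in> lin_vecs UNIV" by (simp add: lin_vecs_def)
    then obtain u where "u \<in> free_on (basis F (Suc (Suc i)))" "?w - lin_ext (diff F (Suc i)) u \<in> lin_vecs UNIV"
      using exact_mod_Suc[OF finite hlift_free[OF v(1)]] by blast
    then show "v \<in> bnd spec_diff (Level {} a) (Suc i)" by (intro bnd_from_lift v)
  qed
next
  fix a assume nok: "\<not> H0_degree a"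
  show "exact_at spec_diff (Level {} a) 0"
  proof
    fix v assume "v \<in> cyc spec_diff (Level {} a) 0"
    then have v: "v \<in> free_on (Level {} a 0)" by (simp add: cyc_def)
    note h = homogeneous_aug_hlift[OF v]
    have "\<exists>g\<in>J. aug_map F (hlift 0 a v) - g \<in> lin_ideal UNIV"
    proof (cases "\<exists>i. a $ i < 0")
      case True
      then have "aug_map F (hlift 0 a v) = 0" using homogeneous_negative h by blast
      then show ?thesis using idl.subspace_0[OF ideal] idl.subspace_0[OF subspace_lin_ideal] by (intro bexI[of _ 0]) auto
    next
      case False
      then have a: "\<And>i. 0 \<le> a $ i" by (meson not_le)
      then have "\<not> spanning (zeros a)" using nok by (simp add: H0_degree_def)
      from xm_J_lin_ideal[OF a this] obtain g where g: "g \<in> J" "xm a - g \<in> lin_ideal UNIV" by blast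
      let ?k = "const (ev (aug_map F (hlift 0 a v)))"
      have "aug_map F (hlift 0 a v) - ?k * g = (aug_map F (hlift 0 a v) - ?k * xm a) + ?k * (xm a - g)"
        by (simp add: algebra_simps)
      also have "\<dots> \<in> lin_ideal UNIV"
        by (intro idl.subspace_add[OF subspace_lin_ideal] idl.subspace_scale[OF subspace_lin_ideal] g homogeneous_minus_xm_in_lin_ideal h)
      finally show ?thesis using idl.subspace_scale[OF ideal g(1)] by blast
    qed
    then obtain u where "u \<in> free_on (basis F 1)" "hlift 0 a v - lin_ext (diff F 0) u \<in> lin_vecs UNIV"
      using exact_mod_0[OF hlift_free[OF v]] by blast
    then show "v \<in> bnd spec_diff (Level {} a) 0" by (intro bnd_from_lift v) auto
  qed
next
  fix a and v :: "nat \<Rightarrow>\<^sub>0 'k" assume H0_degree: "H0_degree a" and v: "v \<in> free_on (Level {} a 0)"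
  note h = homogeneous_aug_hlift[OF v]
  show "v \<in> bnd spec_diff (Level {} a) 0 \<longleftrightarrow> spec_aug v = 0"
  proof
    assume "v \<in> bnd spec_diff (Level {} a) 0"
    then obtain u where u: "u \<in> free_on (Level {} a (Suc 0))" "v = lin_ext (spec_diff 0) u"
      using spec_diff_Level by (auto simp: bnd_def)
    let ?w = "lin_ext (diff F 0) (hlift 1 a u)"
    have w: "hlift 1 a u \<in> free_on (basis F 1)" using hlift_free[OF u(1)] by simp
    have "v = spec_vec 0 a ?w" using spec_vec_d[of "hlift 1 a u" 0 a] w spec_vec_hlift[OF u(1)] u(2) by simp
    then have "spec_aug v = ev_deg a (aug_map F ?w)" using ev_deg_aug[OF d_free[of "hlift 1 a u" 0]] w by simp
    also have "\<dots> = 0" by (rule ev_deg_J[OF H0_degree aug_d[OF w]])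
    finally show "spec_aug v = 0" .
  next
    assume "spec_aug v = 0"
    then have "ev (aug_map F (hlift 0 a v)) = 0"
      using ev_deg_aug[OF hlift_free[OF v], of a] spec_vec_hlift[OF v] ev_deg_homogeneous[OF h] by simp
    then have "aug_map F (hlift 0 a v) - 0 \<in> lin_ideal UNIV" using lin_ideal_UNIV_homogeneous[OF h] by simp
    then obtain u where "u \<in> free_on (basis F 1)" "hlift 0 a v - lin_ext (diff F 0) u \<in> lin_vecs UNIV"
      using exact_mod_0[OF hlift_free[OF v] idl.subspace_0[OF ideal]] by blast
    then show "v \<in> bnd spec_diff (Level {} a) 0" by (intro bnd_from_lift v) auto
  qed
next
  fix a assume H0_degree: "H0_degree a"
  then have a: "\<And>i. 0 \<le> a $ i" by (simp add: H0_degree_def)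
  obtain v where v: "v \<in> free_on (basis F 0)" "xm a - aug_map F v \<in> J" using aug_onto by blast
  have "ev_deg a (xm a) = ev_deg a (xm a - aug_map F v) + ev_deg a (aug_map F v)" by (simp add: ev_deg_add[symmetric])
  moreover have "ev_deg a (xm a - aug_map F v) = 0" by (rule ev_deg_J[OF H0_degree v(2)])
  moreover have "ev_deg a (xm a) = 1" using ev_deg_homogeneous[OF homogeneous_xm[OF a]] by (simp add: ev_xm)
  ultimately have "spec_aug (spec_vec 0 a v) = 1" using ev_deg_aug[OF v(1)] by simp
  then show "\<exists>v\<in>free_on (Level {} a 0). spec_aug v = 1" using spec_vec_Level[OF v(1)] by blast
qed

lemma tensor_part_Level: "tensor_part F i a = free_on (Level UNIV a i)"
proof -
  have "{b \<in> basis F i. bdeg F i b = a} = Level UNIV a i" by (auto simp: Level_def vec_eq_iff)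
  then show ?thesis by (simp add: tensor_part_def)
qed

text \<open>Between basis elements of the same degree, the entries of the differential are constants, on which
\<open>ev\<close> is the identity; between elements of different degrees they have no constant term.\<close>

lemma tensor_diff_Level:
  assumes v: "v \<in> free_on (Level UNIV a (Suc i))"
  shows "tensor_diff F i v = dX spec_diff (Level UNIV a) (Suc i) v"
proof (rule poly_mapping_eqI)
  fix e
  have "lookup (lookup (diff F i b) e) 0 = (ev (lookup (diff F i b) e) when e \<in> Level UNIV a i)"
    if "b \<in> keys v" for b
  proof -
    have b: "b \<in> basis F (Suc i)" "bdeg F (Suc i) b = a"
      using v that by (auto simp: free_on_def Level_def vec_eq_iff)
    show ?thesis
    proof (cases "e \<in> basis F i")
      case False
      then show ?thesis using diff_entry_0[OF b(1)] by (simp add: ev.lift_zero)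
    next
      case e: True
      note h = homogeneous_diff_entry[OF b(1) e, unfolded b(2)]
      show ?thesis
      proof (cases "bdeg F i e = a")
        case True
        have m0: "m = 0" if "mdeg m = 0" for m :: "'n mon"
        proof (rule poly_mapping_eqI)
          fix x
          have "int (lookup m (Inl i)) + int (lookup m (Inr i)) = 0" for i
            using that by (simp add: lookup_mdeg[symmetric])
          then have "lookup m (Inl i) = 0 \<and> lookup m (Inr i) = 0" for i
            using add_nonneg_eq_0_iff[of "int (lookup m (Inl i))" "int (lookup m (Inr i))"] by simp
          then show "lookup m x = lookup 0 x" by (cases x) auto
        qed
        have "keys (lookup (diff F i b) e) \<subseteq> {0}" using h True m0 by (auto simp: homogeneous_def)
        then have "ev (lookup (diff F i b) e) = lookup (lookup (diff F i b) e) 0"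
          by (subst ev.lift_superset[of "{0}"]) auto
        then show ?thesis using e True by (simp add: Level_def)
      next
        case False
        have "(0 :: 'n mon) \<notin> keys (lookup (diff F i b) e)"
        proof
          assume "(0 :: 'n mon) \<in> keys (lookup (diff F i b) e)"
          then have "mdeg (0 :: 'n mon) = a - bdeg F i e" using h by (simp add: homogeneous_def)
          then show False using False by (simp add: mdeg_zero)
        qed
        then have "lookup (lookup (diff F i b) e) 0 = 0" by (simp add: in_keys_iff)
        then show ?thesis using False by (auto simp: Level_def vec_eq_iff)
      qed
    qed
  qed
  then have "(\<Sum>b\<in>keys v. lookup v b * lookup (lookup (diff F i b) e) 0) =
      (\<Sum>b\<in>keys v. lookup v b * ev (lookup (diff F i b) e) when e \<in> Level UNIV a i)"
    by (intro sum.cong refl) (simp add: mult_when)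
  moreover have "lookup (Poly_Mapping.map (\<lambda>s. lookup s 0) w) e = lookup (lookup w e) 0" for w :: "nat \<Rightarrow>\<^sub>0 ('n, 'k) S"
    by (simp add: map.rep_eq when_def)
  ultimately show "lookup (tensor_diff F i v) e = lookup (dX spec_diff (Level UNIV a) (Suc i) v) e"
    by (cases "e \<in> Level UNIV a i")
      (simp_all add: tensor_diff_def lin_ext_def dX_def lookup_restr lookup_sum lookup_fscale lookup_spec_diff)
qed

lemma tor_cycles_eq: "tor_cycles F i a = cyc spec_diff (Level UNIV a) i"
  by (cases i) (auto simp: tor_cycles_def cyc_def tensor_part_Level tensor_diff_Level dX_def)

lemma tor_boundaries_eq: "tor_boundaries F i a = bnd spec_diff (Level UNIV a) i"
  unfolding tor_boundaries_def bnd_def tensor_part_Level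
  by (intro image_cong refl tensor_diff_Level)

lemma tor_dim:
  "quotient_dim (tor_cycles F i a) (tor_boundaries F i a) =
     (if flat (zeros a) \<and> a = indicator_vec (UNIV - zeros a) \<and> i = rk - \<rho> (zeros a)
      then nat \<bar>moebius {Z. flat Z} (zeros a) UNIV\<bar> else 0)"
  unfolding tor_cycles_eq tor_boundaries_eq
proof (rule rdim_quotient_dim[OF subspace_cyc subspace_bnd _ rdim_Level_UNIV])
  show "bnd spec_diff (Level UNIV a) i \<subseteq> cyc spec_diff (Level UNIV a) i"
    using Level_complex dX_in by (auto simp: bnd_def cyc_def)
qed

end

section \<open>Existence of graded resolutions\<close>

definition kscale :: "'k::field \<Rightarrow> (nat \<Rightarrow>\<^sub>0 ('n::finite, 'k) S) \<Rightarrow> (nat \<Rightarrow>\<^sub>0 ('n, 'k) S)" where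
  "kscale k v = fscale (const k) v"

global_interpretation kv: vector_space kscale
  by unfold_locales
    (simp_all add: kscale_def const_add const_mult fmod.scale_left_distrib fmod.scale_right_distrib)

definition hvec :: "(nat \<Rightarrow> int ^ 'n) \<Rightarrow> int ^ 'n \<Rightarrow> (nat \<Rightarrow>\<^sub>0 ('n::finite, 'k::field) S) \<Rightarrow> bool" where
  "hvec dg a v \<longleftrightarrow> (\<forall>b. homogeneous (a - dg b) (lookup v b))"

definition vcomp :: "(nat \<Rightarrow> int ^ 'n) \<Rightarrow> int ^ 'n \<Rightarrow> (nat \<Rightarrow>\<^sub>0 ('n::finite, 'k::field) S) \<Rightarrow> (nat \<Rightarrow>\<^sub>0 ('n, 'k) S)" where
  "vcomp dg a v = Poly_Mapping.mapp (\<lambda>b s. hpart (a - dg b) s) v"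

lemma lookup_vcomp: "lookup (vcomp dg a v) b = hpart (a - dg b) (lookup v b)"
  by (simp add: vcomp_def lookup_mapp when_def in_keys_iff hpart_zero)

lemma keys_vcomp: "keys (vcomp dg a v) \<subseteq> keys v"
  by (simp add: vcomp_def keys_mapp_subset)

lemma hvec_vcomp: "hvec dg a (vcomp dg a v)"
  by (simp add: hvec_def lookup_vcomp homogeneous_hpart)

lemma vcomp_lin_ext:
  assumes "\<And>b. b \<in> keys v \<Longrightarrow> hvec dg (dg' b) (D b)"
  shows "vcomp dg a (lin_ext D v) = lin_ext D (vcomp dg' a v)"
proof (rule poly_mapping_eqI)
  fix e
  have "lookup (vcomp dg a (lin_ext D v)) e = (\<Sum>b\<in>keys v. hpart (a - dg e) (lookup v b * lookup (D b) e))"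
    by (simp add: lookup_vcomp lin_ext_def lookup_sum lookup_fscale hpart_sum)
  also have "\<dots> = (\<Sum>b\<in>keys v. hpart (a - dg' b) (lookup v b) * lookup (D b) e)"
  proof (rule sum.cong[OF refl])
    fix b assume "b \<in> keys v"
    then have "homogeneous (dg' b - dg e) (lookup (D b) e)" using assms by (simp add: hvec_def)
    from hpart_mult[OF this, of "a - dg e"]
    show "hpart (a - dg e) (lookup v b * lookup (D b) e) = hpart (a - dg' b) (lookup v b) * lookup (D b) e"
      by simp
  qed
  also have "\<dots> = lookup (lin_ext D (vcomp dg' a v)) e"
    by (simp add: lin_ext_superset[OF _ keys_vcomp] lookup_sum lookup_fscale lookup_vcomp)
  finally show "lookup (vcomp dg a (lin_ext D v)) e = lookup (lin_ext D (vcomp dg' a v)) e" .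
qed

lemma sum_vcomp: "\<exists>A. finite A \<and> (\<Sum>a\<in>A. vcomp dg a v) = v"
proof -
  define A where "A = (\<Union>b\<in>keys v. (\<lambda>m. dg b + mdeg m) ` keys (lookup v b))"
  have fin: "finite A" by (simp add: A_def)
  have "(\<Sum>a\<in>A. vcomp dg a v) = v"
  proof (intro poly_mapping_eqI)
    fix b m
    have "lookup (lookup (\<Sum>a\<in>A. vcomp dg a v) b) m =
        (\<Sum>a\<in>A. if a = dg b + mdeg m then lookup (lookup v b) m else 0)"
      by (auto simp: lookup_sum lookup_vcomp hpart_def lookup_restr when_def algebra_simps intro!: sum.cong)
    also have "\<dots> = lookup (lookup v b) m"
    proof (cases "lookup (lookup v b) m = 0")
      case False
      then have "lookup v b \<noteq> 0" by auto
      then have "dg b + mdeg m \<in> A" using False by (force simp: A_def in_keys_iff)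
      then show ?thesis using fin by simp
    qed (simp cong: if_cong)
    finally show "lookup (lookup (\<Sum>a\<in>A. vcomp dg a v) b) m = lookup (lookup v b) m" .
  qed
  then show ?thesis using fin by blast
qed

lemma finite_box: "finite {a :: int ^ 'n::finite. \<forall>j. 0 \<le> a $ j \<and> a $ j \<le> d $ j}"
proof (rule finite_imageD)
  show "finite (vec_nth ` {a :: int ^ 'n. \<forall>j. 0 \<le> a $ j \<and> a $ j \<le> d $ j})"
    by (rule finite_subset[of _ "\<Pi>\<^sub>E j\<in>UNIV. {0..d $ j}"]) (auto intro!: finite_PiE)
qed (simp add: inj_on_def vec_eq_iff fun_eq_iff)

lemma finite_monomials: "finite {m :: 'n::finite mon. mdeg m = e}"
proof (rule finite_imageD)
  show "finite (lookup ` {m :: 'n mon. mdeg m = e})"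
  proof (rule finite_subset)
    show "lookup ` {m :: 'n mon. mdeg m = e} \<subseteq> (\<Pi>\<^sub>E v\<in>UNIV. {..nat (e $ (case v of Inl i \<Rightarrow> i | Inr i \<Rightarrow> i))})"
    proof (intro image_subsetI PiE_I)
      fix m :: "'n mon" and v :: "'n + 'n" assume "m \<in> {m. mdeg m = e}"
      then have "e = mdeg m" by simp
      then show "lookup m v \<in> {..nat (e $ (case v of Inl i \<Rightarrow> i | Inr i \<Rightarrow> i))}"
        by (cases v) (simp_all add: lookup_mdeg)
    qed simp
  qed (auto intro!: finite_PiE)
qed (simp add: inj_on_def lookup_inject)

lemma countable_vec: "countable (UNIV :: (int ^ 'n::finite) set)"
proof -
  have "countable (range (vec_nth :: int ^ 'n \<Rightarrow> _))" by (rule countableI_type)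
  then show ?thesis by (rule countable_image_inj_on) (simp add: inj_on_def vec_eq_iff fun_eq_iff)
qed

text \<open>With finitely many basis elements in each degree, and none in degrees with negative coordinates, the
graded pieces of the free module have finite dimension over \<open>\<kk>\<close>.\<close>

definition graded_submodule ::
    "nat set \<Rightarrow> (nat \<Rightarrow> int ^ 'n) \<Rightarrow> (nat \<Rightarrow>\<^sub>0 ('n::finite, 'k::field) S) set \<Rightarrow> bool" where
  "graded_submodule B dg K \<longleftrightarrow> (\<forall>a. finite {b \<in> B. dg b = a}) \<and> (\<forall>b\<in>B. \<forall>j. 0 \<le> dg b $ j) \<and>
     K \<subseteq> free_on B \<and> fmod.subspace K \<and> (\<forall>v\<in>K. \<forall>a. vcomp dg a v \<in> K)"

lemma kscale_in_submodule: "fmod.subspace K \<Longrightarrow> v \<in> K \<Longrightarrow> kscale k v \<in> K"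
  by (simp add: kscale_def fmod.subspace_scale)

text \<open>A basis over \<open>\<kk>\<close> of a graded piece.  Its finiteness comes from the finitely many monomial multiples of
basis elements in degree \<open>a\<close>.  As \<open>0\<close> is excluded, generators exist only
in degrees without negative coordinates.\<close>

lemma finite_generators:
  fixes K :: "(nat \<Rightarrow>\<^sub>0 ('n::finite, 'k::field) S) set"
  assumes K: "graded_submodule B dg K"
  shows "\<exists>G. finite G \<and> 0 \<notin> G \<and> G \<subseteq> {v \<in> K. hvec dg a v} \<and> {v \<in> K. hvec dg a v} \<subseteq> kv.span G"
proof -
  let ?K = "{v \<in> K. hvec dg a v}"
  obtain G where G: "G \<subseteq> ?K" "kv.independent G" "?K \<subseteq> kv.span G"
    by (rule kv.maximal_independent_subset)
  define Ba where "Ba = {b \<in> B. \<forall>j. dg b $ j \<le> a $ j}"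
  have "Ba \<subseteq> (\<Union>d\<in>{d. \<forall>j. 0 \<le> d $ j \<and> d $ j \<le> a $ j}. {b \<in> B. dg b = d})"
    using K by (auto simp: Ba_def graded_submodule_def)
  moreover have "finite \<dots>" using K by (intro finite_UN_I finite_box) (auto simp: graded_submodule_def)
  ultimately have finBa: "finite Ba" by (rule finite_subset)
  define M where "M = (\<Union>b\<in>Ba. (\<lambda>m. single b (single m (1::'k))) ` {m :: 'n mon. mdeg m = a - dg b})"
  have finM: "finite M" using finBa finite_monomials by (auto simp: M_def)
  have "?K \<subseteq> kv.span M"
  proof clarify
    fix v assume v: "v \<in> K" "hvec dg a v"
    have "v = (\<Sum>b\<in>keys v. \<Sum>m\<in>keys (lookup v b). kscale (lookup (lookup v b) m) (single b (single m 1)))"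
    proof (rule poly_mapping_eqI)
      fix e
      have "lookup (\<Sum>b\<in>keys v. \<Sum>m\<in>keys (lookup v b). kscale (lookup (lookup v b) m) (single b (single m 1))) e
          = (\<Sum>b\<in>keys v. if b = e then \<Sum>m\<in>keys (lookup v b). single m (lookup (lookup v b) m) else 0)"
        unfolding lookup_sum kscale_def lookup_fscale
      proof (rule sum.cong[OF refl])
        fix b
        show "(\<Sum>m\<in>keys (lookup v b). const (lookup (lookup v b) m) * lookup (single b (single m 1)) e) =
            (if b = e then \<Sum>m\<in>keys (lookup v b). single m (lookup (lookup v b) m) else 0)"
          by (cases "b = e") (simp_all add: lookup_single const_mult_single)
      qed
      also have "\<dots> = lookup v e" by (simp add: sum_monomials in_keys_iff)
      finally show "lookup v e = lookup (\<Sum>b\<in>keys v. \<Sum>m\<in>keys (lookup v b). kscale (lookup (lookup v b) m) (single b (single m 1))) e"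
        by simp
    qed
    also have "\<dots> \<in> kv.span M"
    proof (intro kv.span_sum kv.span_scale kv.span_base)
      fix b m assume b: "b \<in> keys v" and m: "m \<in> keys (lookup v b)"
      have h: "homogeneous (a - dg b) (lookup v b)" using v(2) by (simp add: hvec_def)
      have "b \<in> B" using v(1) K b by (auto simp: graded_submodule_def free_on_def)
      moreover have "dg b $ j \<le> a $ j" for j
        using homogeneous_negative[OF h, of j] b by (cases "dg b $ j \<le> a $ j") (auto simp: in_keys_iff)
      ultimately show "single b (single m 1) \<in> M" using h m by (auto simp: M_def Ba_def homogeneous_def)
    qed
    finally show "v \<in> kv.span M" .
  qed
  then have "finite G" using kv.independent_span_bound[OF finM G(2)] G(1) by blast
  moreover have "0 \<notin> G" using G(2) kv.dependent_zero by blast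
  ultimately show ?thesis using G by blast
qed

text \<open>The union over all degrees of \<open>\<kk>\<close>-bases of the graded pieces generates the module and is countable, so
that it can be indexed by natural numbers.  The generators again satisfy the finiteness conditions,
whence the construction can be iterated with the kernel.\<close>

lemma graded_presentation:
  fixes K :: "(nat \<Rightarrow>\<^sub>0 ('n::finite, 'k::field) S) set"
  assumes K: "graded_submodule B dg K"
  shows "\<exists>B' dg' D. graded_submodule B' dg' {v \<in> free_on B'. lin_ext D v = 0} \<and>
     (\<forall>b\<in>B'. hvec dg (dg' b) (D b)) \<and> K = lin_ext D ` free_on B'"
proof -
  have "\<exists>G. \<forall>a. finite (G a) \<and> 0 \<notin> G a \<and> G a \<subseteq> {v \<in> K. hvec dg a v} \<and> {v \<in> K. hvec dg a v} \<subseteq> kv.span (G a)"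
    by (intro choice allI finite_generators[OF K])
  then obtain G where G: "\<And>a. finite (G a)" "\<And>a. 0 \<notin> G a" "\<And>a. G a \<subseteq> {v \<in> K. hvec dg a v}"
      "\<And>a. {v \<in> K. hvec dg a v} \<subseteq> kv.span (G a)" by auto
  define I where "I = (SIGMA a:UNIV. G a)"
  have "countable I" unfolding I_def by (intro countable_SIGMA countable_vec countable_finite G)
  define \<phi> where "\<phi> = to_nat_on I"
  define \<psi> where "\<psi> = inv_into I \<phi>"
  have \<psi>: "\<psi> (\<phi> x) = x" if "x \<in> I" for x
    unfolding \<psi>_def \<phi>_def using that \<open>countable I\<close> by (intro inv_into_f_f inj_on_to_nat_on)
  define B' where "B' = \<phi> ` I"
  define dg' where "dg' b = fst (\<psi> b)" for b
  define D where "D b = snd (\<psi> b)" for b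
  have subK: "fmod.subspace K" using K by (simp add: graded_submodule_def)
  have B': "D b \<in> G (dg' b)" "D b \<in> K" "hvec dg (dg' b) (D b)" if b: "b \<in> B'" for b
  proof -
    obtain a g where ag: "b = \<phi> (a, g)" "(a, g) \<in> I" "g \<in> G a" using b by (auto simp: B'_def I_def)
    then have "D b = g" "dg' b = a" by (simp_all add: D_def dg'_def \<psi>)
    then show "D b \<in> G (dg' b)" "D b \<in> K" "hvec dg (dg' b) (D b)" using ag(3) G(3)[of a] by auto
  qed
  have fin: "finite {b \<in> B'. dg' b = a}" for a
    by (rule finite_subset[of _ "\<phi> ` ({a} \<times> G a)"]) (use G(1) in \<open>auto simp: B'_def \<psi> dg'_def I_def\<close>)
  have nonneg: "0 \<le> dg' b $ j" if "b \<in> B'" for b j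
  proof -
    have "D b \<noteq> 0" using B'(1)[OF that] G(2) by metis
    then obtain e where e: "e \<in> keys (D b)" by (metis ex_in_conv keys_eq_empty)
    then have "e \<in> B" using B'(2)[OF that] K by (auto simp: graded_submodule_def free_on_def)
    then have "0 \<le> dg e $ j" using K by (simp add: graded_submodule_def)
    moreover have "homogeneous (dg' b - dg e) (lookup (D b) e)" using B'(3)[OF that] by (simp add: hvec_def)
    ultimately show ?thesis using homogeneous_negative[of "dg' b - dg e" "lookup (D b) e" j] e
      by (cases "0 \<le> dg' b $ j") (auto simp: in_keys_iff)
  qed
  have image: "K = lin_ext D ` free_on B'"
  proof
    let ?I = "lin_ext D ` free_on B'"
    have subI: "fmod.subspace ?I"
      by (intro module_hom.subspace_image[OF module_hom_lin_ext] subspace_free_on)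
    show "K \<subseteq> ?I"
    proof
      fix v assume v: "v \<in> K"
      have GI: "G a \<subseteq> ?I" for a
      proof
        fix g assume "g \<in> G a"
        then have "(a, g) \<in> I" by (simp add: I_def)
        then have "\<phi> (a, g) \<in> B'" "D (\<phi> (a, g)) = g" by (auto simp: B'_def D_def \<psi>)
        then have "lin_ext D (single (\<phi> (a, g)) 1) = g" "single (\<phi> (a, g)) 1 \<in> free_on B'"
          by (auto simp: lin_ext_single free_on_def)
        then show "g \<in> ?I" by (metis imageI)
      qed
      have "kv.subspace ?I"
        using fmod.subspace_0[OF subI] fmod.subspace_add[OF subI] kscale_in_submodule[OF subI]
        by (intro kv.subspaceI)
      then have "kv.span (G a) \<subseteq> ?I" for a using GI by (intro kv.span_minimal)
      moreover have "vcomp dg a v \<in> kv.span (G a)" for a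
      proof -
        have "vcomp dg a v \<in> K" using v K by (simp add: graded_submodule_def)
        then show ?thesis using G(4)[of a] hvec_vcomp[of dg a v] by blast
      qed
      ultimately have "vcomp dg a v \<in> ?I" for a by blast
      then have "(\<Sum>a\<in>A. vcomp dg a v) \<in> ?I" for A by (intro fmod.subspace_sum[OF subI])
      then show "v \<in> ?I" using sum_vcomp[of dg v] by metis
    qed
    show "?I \<subseteq> K"
    proof (rule image_subsetI)
      fix v :: "nat \<Rightarrow>\<^sub>0 ('n, 'k) S" assume "v \<in> free_on B'"
      then show "lin_ext D v \<in> K"
        unfolding lin_ext_def
        by (intro fmod.subspace_sum[OF subK] fmod.subspace_scale[OF subK] B'(2)) (auto simp: free_on_def)
    qed
  qed
  let ?ker = "{v \<in> free_on B'. lin_ext D v = 0}"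
  have "fmod.subspace ?ker"
    by (intro fmod.subspaceI)
      (auto simp: lin_ext_add lin_ext_fscale lin_ext_zero fmod.subspace_0[OF subspace_free_on]
        fmod.subspace_add[OF subspace_free_on] fmod.subspace_scale[OF subspace_free_on])
  moreover have "vcomp dg' a v \<in> ?ker" if "v \<in> ?ker" for a v
  proof -
    have v: "v \<in> free_on B'" "lin_ext D v = 0" using that by auto
    have "lin_ext D (vcomp dg' a v) = vcomp dg a (lin_ext D v)"
      using v(1) B'(3) by (intro vcomp_lin_ext[symmetric]) (auto simp: free_on_def)
    also have "\<dots> = 0" unfolding v(2) by (intro poly_mapping_eqI) (simp add: lookup_vcomp hpart_zero)
    finally show ?thesis using v(1) keys_vcomp[of dg' a v] by (auto simp: free_on_def)
  qed
  ultimately have "graded_submodule B' dg' ?ker"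
    using fin nonneg by (auto simp: graded_submodule_def)
  then show ?thesis using B'(3) image by blast
qed

text \<open>The construction starts with \<open>J\<close> as a submodule of \<open>S\<close>, the free module on one generator of degree \<open>0\<close>.\<close>

lemma exists_graded_free_resolution:
  fixes J :: "('n::finite, 'k::field) S set"
  assumes J: "idl.subspace J" and graded: "\<And>f a. f \<in> J \<Longrightarrow> hpart a f \<in> J"
  shows "\<exists>F. graded_free_resolution J F"
proof -
  define K0 where "K0 = {v \<in> free_on {0}. lookup v 0 \<in> J}"
  define st where "st x \<longleftrightarrow> (case x of (B, dg, K :: (nat \<Rightarrow>\<^sub>0 ('n, 'k) S) set) \<Rightarrow> graded_submodule B dg K)" for x
  define nx where "nx x y D \<longleftrightarrow> (case (x, y) of ((B, dg, K), (B', dg', K')) \<Rightarrow>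
      (\<forall>b\<in>B'. hvec dg (dg' b) (D b)) \<and> K = lin_ext D ` free_on B' \<and> K' = {v \<in> free_on B'. lin_ext D v = 0})"
    for x y :: "nat set \<times> (nat \<Rightarrow> int ^ 'n) \<times> (nat \<Rightarrow>\<^sub>0 ('n, 'k) S) set" and D :: "nat \<Rightarrow> (nat \<Rightarrow>\<^sub>0 ('n, 'k) S)"
  let ?x0 = "({0}, \<lambda>_. 0, K0)"
  have "fmod.subspace K0"
    unfolding K0_def
    by (intro fmod.subspaceI)
      (auto simp: lookup_add lookup_fscale fmod.subspace_0[OF subspace_free_on]
        fmod.subspace_add[OF subspace_free_on] fmod.subspace_scale[OF subspace_free_on]
        idl.subspace_0[OF J] idl.subspace_add[OF J] idl.subspace_scale[OF J])
  then have st0: "st ?x0"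
    using keys_vcomp graded unfolding st_def graded_submodule_def
    by (fastforce simp: K0_def free_on_def lookup_vcomp)
  have "\<exists>f. \<forall>n. (st (f n) \<and> (n = 0 \<longrightarrow> f n = ?x0)) \<and> (\<exists>D. nx (f n) (f (Suc n)) D)"
  proof (rule dependent_nat_choice)
    show "\<exists>x. st x \<and> ((0::nat) = 0 \<longrightarrow> x = ?x0)" using st0 by blast
  next
    fix x and n :: nat assume "st x \<and> (n = 0 \<longrightarrow> x = ?x0)"
    then obtain B dg K where x: "x = (B, dg, K)" "graded_submodule B dg K" by (cases x) (auto simp: st_def)
    from graded_presentation[OF x(2)] obtain B' dg' D where
      "graded_submodule B' dg' {v \<in> free_on B'. lin_ext D v = 0}"
      "\<forall>b\<in>B'. hvec dg (dg' b) (D b)" "K = lin_ext D ` free_on B'" by blast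
    then show "\<exists>y. (st y \<and> (Suc n = 0 \<longrightarrow> y = ?x0)) \<and> (\<exists>D. nx x y D)"
      by (intro exI[of _ "(B', dg', {v \<in> free_on B'. lin_ext D v = 0})"]) (auto simp: st_def nx_def x(1))
  qed
  then obtain f where f: "\<And>n. st (f n)" "f 0 = ?x0" "\<And>n. \<exists>D. nx (f n) (f (Suc n)) D" by auto
  from f(3) obtain D where D: "\<And>n. nx (f n) (f (Suc n)) (D n)" by metis
  define B where "B n = fst (f n)" for n
  define dg where "dg n = fst (snd (f n))" for n
  define K where "K n = snd (snd (f n))" for n
  have f_eq: "f n = (B n, dg n, K n)" for n by (simp add: B_def dg_def K_def)
  have B0: "B 0 = {0}" "dg 0 = (\<lambda>_. 0)" "K 0 = K0" using f(2) by (auto simp: f_eq)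
  have st: "graded_submodule (B n) (dg n) (K n)" for n using f(1)[of n] by (simp add: st_def f_eq)
  have nx: "\<And>b. b \<in> B (Suc n) \<Longrightarrow> hvec (dg n) (dg (Suc n) b) (D n b)" "K n = lin_ext (D n) ` free_on (B (Suc n))"
      "K (Suc n) = {v \<in> free_on (B (Suc n)). lin_ext (D n) v = 0}" for n
    using D[of n] by (auto simp: nx_def f_eq)
  define F where "F = \<lparr>basis = B, bdeg = dg, diff = D, aug = \<lambda>_. 1 :: ('n, 'k) S\<rparr>"
  have aug: "aug_map F v = lookup v 0" if "v \<in> free_on {0}" for v
  proof -
    have "aug_map F v = (\<Sum>b\<in>{0}. lookup v b * aug F b)"
      unfolding aug_map_def using that by (intro sum.mono_neutral_left) (auto simp: free_on_def in_keys_iff)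
    then show ?thesis by (simp add: F_def)
  qed
  have DK: "D n b \<in> K n" if "b \<in> B (Suc n)" for n b
  proof -
    have "single b 1 \<in> free_on (B (Suc n))" "lin_ext (D n) (single b 1) = D n b"
      using that by (auto simp: free_on_def lin_ext_single)
    then show ?thesis using nx(2) by (metis imageI)
  qed
  have "graded_free_resolution J F"
    unfolding graded_free_resolution_def
  proof (intro conjI allI ballI)
    fix b assume "b \<in> basis F 0"
    then show "homogeneous (bdeg F 0 b) (aug F b)" by (simp add: F_def B0 homogeneous_one)
  next
    fix i b assume b: "b \<in> basis F (Suc i)"
    then show "diff F i b \<in> free_on (basis F i)"
      using DK[of b i] st[of i] by (auto simp: F_def graded_submodule_def)
    fix e
    show "homogeneous (bdeg F (Suc i) b - bdeg F i e) (lookup (diff F i b) e)"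
      using nx(1)[of b i] b by (simp add: F_def hvec_def)
  next
    fix s :: "('n, 'k) S"
    have v: "single 0 s \<in> free_on {0}" by (simp add: free_on_def)
    have "s - aug_map F (single 0 s) \<in> J"
      unfolding aug[OF v] using idl.subspace_0[OF J] by simp
    moreover have "basis F 0 = {0}" by (simp add: F_def B0)
    ultimately show "\<exists>v\<in>free_on (basis F 0). s - aug_map F v \<in> J"
      using v by (intro bexI[of _ "single 0 s"]) simp_all
  next
    show "{v \<in> free_on (basis F 0). aug_map F v \<in> J} = lin_ext (diff F 0) ` free_on (basis F 1)"
    proof -
      have "basis F 0 = {0}" "basis F 1 = B 1" "diff F 0 = D 0" by (simp_all add: F_def B0)
      moreover have "{v \<in> free_on {0}. aug_map F v \<in> J} = K0" unfolding K0_def using aug by auto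
      moreover have "K0 = lin_ext (D 0) ` free_on (B 1)" using nx(2)[of 0] B0(3) by simp
      ultimately show ?thesis by simp
    qed
  next
    fix i
    show "{v \<in> free_on (basis F (Suc i)). lin_ext (diff F i) v = 0} =
        lin_ext (diff F (Suc i)) ` free_on (basis F (Suc (Suc i)))"
      using nx(2)[of "Suc i"] nx(3)[of i] by (simp add: F_def)
  qed
  then show ?thesis ..
qed

context matroidal_ideal
begin

text \<open>By \<open>tor_dim\<close> every resolution gives the same value, so it holds for the one chosen in the definition of
\<open>betti\<close>.\<close>

theorem betti_matroidal:
  assumes "infinite (UNIV :: 'k set)"
  shows "betti J i a =
     (if flat (zeros a) \<and> a = indicator_vec (UNIV - zeros a) \<and> i = rk - \<rho> (zeros a)
      then nat \<bar>moebius {Z. flat Z} (zeros a) UNIV\<bar> else 0)"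
proof -
  obtain c where c: "specialised_ideal \<rho> J c" using exists_specialisation[OF assms] by blast
  have "graded_free_resolution J (SOME F. graded_free_resolution J F)"
    using exists_graded_free_resolution[OF ideal graded] by (rule someI_ex)
  then interpret resolved_ideal \<rho> J c "SOME F. graded_free_resolution J F"
    by (intro resolved_ideal.intro c resolved_ideal_axioms.intro)
  show ?thesis unfolding betti_def Let_def by (rule tor_dim)
qed

end

section \<open>The matroid of the columns of a matrix\<close>

text \<open>The columns are finitely supported families, so that linear independence, spans and bases of such
families are at hand.\<close>

definition col :: "nat \<Rightarrow> (nat \<Rightarrow> 'k::field ^ 'n::finite) \<Rightarrow> 'n \<Rightarrow> (nat \<Rightarrow>\<^sub>0 'k)" where
  "col r A j = (\<Sum>i<r. single i (A i $ j))"

lemma lookup_col: "lookup (col r A j) i = (A i $ j when i < r)"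
  by (simp add: col_def lookup_sum lookup_single when_def if_distrib cong: if_cong)

lemma col_sum_eq_0_iff: "(\<Sum>j\<in>T. fscale (c j) (col r A j)) = 0 \<longleftrightarrow> (\<forall>i<r. (\<Sum>j\<in>T. c j * A i $ j) = 0)"
proof -
  have "lookup (\<Sum>j\<in>T. fscale (c j) (col r A j)) i = ((\<Sum>j\<in>T. c j * A i $ j) when i < r)" for i
    by (simp add: lookup_sum lookup_fscale lookup_col when_def)
  then show ?thesis by (auto simp: poly_mapping_eq_iff fun_eq_iff when_def)
qed

lemma column_indep_iff:
  "column_indep r A T \<longleftrightarrow> inj_on (col r A) T \<and> fmod.independent (col r A ` T)"
proof
  assume ind: "column_indep r A T"
  have inj: "inj_on (col r A) T"
  proof (rule ccontr)
    assume "\<not> inj_on (col r A) T"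
    then obtain i j where ij: "i \<in> T" "j \<in> T" "i \<noteq> j" "col r A i = col r A j" by (auto simp: inj_on_def)
    define c where "c t = (if t = i then 1 else if t = j then - 1 else (0::'a))" for t
    have "(\<Sum>t\<in>T. fscale (c t) (col r A t)) = (\<Sum>t\<in>{i, j}. fscale (c t) (col r A t))"
      using ij by (intro sum.mono_neutral_right) (auto simp: c_def)
    also have "\<dots> = 0" using ij by (simp add: c_def)
    finally have "\<forall>i<r. (\<Sum>t\<in>T. c t * A i $ t) = 0" by (simp only: col_sum_eq_0_iff)
    then have "c i = 0" using ind[unfolded column_indep_def, THEN spec, of c] ij(1) by blast
    then show False by (simp add: c_def)
  qed
  moreover have "fmod.independent (col r A ` T)"
    unfolding fmod.dependent_finite[OF finite_imageI[OF finite]]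
  proof clarify
    fix u j assume u: "(\<Sum>v\<in>col r A ` T. fscale (u v) v) = 0" and j: "j \<in> T" "u (col r A j) \<noteq> 0"
    have "(\<Sum>t\<in>T. fscale (u (col r A t)) (col r A t)) = 0" using u inj by (simp add: sum.reindex)
    then have "\<forall>i<r. (\<Sum>t\<in>T. u (col r A t) * A i $ t) = 0" by (simp only: col_sum_eq_0_iff)
    then show False
      using ind[unfolded column_indep_def, THEN spec, of "\<lambda>t. u (col r A t)"] j by blast
  qed
  ultimately show "inj_on (col r A) T \<and> fmod.independent (col r A ` T)" by blast
next
  assume ind: "inj_on (col r A) T \<and> fmod.independent (col r A ` T)"
  show "column_indep r A T"
    unfolding column_indep_def col_sum_eq_0_iff[symmetric]
  proof (intro allI impI ballI)
    fix c j assume c: "(\<Sum>j\<in>T. fscale (c j) (col r A j)) = 0" and j: "j \<in> T"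
    define u where "u v = c (the_inv_into T (col r A) v)" for v
    have uc: "u (col r A t) = c t" if "t \<in> T" for t using that ind by (simp add: u_def the_inv_into_f_f)
    have "(\<Sum>v\<in>col r A ` T. fscale (u v) v) = (\<Sum>t\<in>T. fscale (c t) (col r A t))"
      using ind by (simp add: sum.reindex uc)
    then have "u (col r A j) = 0"
      using ind c j unfolding fmod.dependent_finite[OF finite_imageI[OF finite]] by auto
    then show "c j = 0" using uc j by simp
  qed
qed

lemma matroid_rank_ge: "U \<subseteq> T \<Longrightarrow> column_indep r A U \<Longrightarrow> card U \<le> matroid_rank r A T"
  unfolding matroid_rank_def by (intro Max_ge) auto

text \<open>An independent set of columns of maximal size spans, since any column outside of its span could be
added.\<close>

lemma matroid_rank_basis:
  obtains U where "U \<subseteq> T" "column_indep r A U" "card U = matroid_rank r A T"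
    "col r A ` T \<subseteq> fmod.span (col r A ` U)"
proof -
  have "column_indep r A {}" by (simp add: column_indep_def)
  then have "matroid_rank r A T \<in> {card U | U. U \<subseteq> T \<and> column_indep r A U}"
    unfolding matroid_rank_def by (intro Max_in) auto
  then obtain U where U: "U \<subseteq> T" "column_indep r A U" "card U = matroid_rank r A T" by auto
  have "col r A j \<in> fmod.span (col r A ` U)" if j: "j \<in> T" for j
  proof (rule ccontr)
    assume n: "col r A j \<notin> fmod.span (col r A ` U)"
    then have nU: "col r A j \<notin> col r A ` U" using fmod.span_base by blast
    then have "j \<notin> U" by blast
    have "fmod.independent (insert (col r A j) (col r A ` U))"
      using n U(2) by (intro fvs.independent_insertI) (auto simp: column_indep_iff)
    then have "column_indep r A (insert j U)"
      using U(2) nU \<open>j \<notin> U\<close> by (simp add: column_indep_iff)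
    then have "card (insert j U) \<le> matroid_rank r A T" using U(1) j by (intro matroid_rank_ge) auto
    then show False using U(3) \<open>j \<notin> U\<close> by simp
  qed
  then show ?thesis using U that by blast
qed

lemma matroid_rank_le:
  assumes "finite B" "\<And>j. j \<in> T \<Longrightarrow> col r A j \<in> fmod.span B"
  shows "matroid_rank r A T \<le> card B"
proof -
  obtain U where U: "U \<subseteq> T" "column_indep r A U" "card U = matroid_rank r A T"
    by (rule matroid_rank_basis)
  then have "card (col r A ` U) \<le> card B"
    using fvs.independent_span_bound[OF assms(1), of "col r A ` U"] assms(2) by (auto simp: column_indep_iff)
  then show ?thesis using U by (simp add: column_indep_iff card_image)
qed

lemma in_span_if_rank_eq:
  assumes "matroid_rank r A (insert w F) = matroid_rank r A F"
  shows "col r A w \<in> fmod.span (col r A ` F)"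
proof (rule ccontr)
  assume n: "col r A w \<notin> fmod.span (col r A ` F)"
  obtain U where U: "U \<subseteq> F" "column_indep r A U" "card U = matroid_rank r A F"
    by (rule matroid_rank_basis)
  have n': "col r A w \<notin> fmod.span (col r A ` U)" using n U(1) fmod.span_mono[of "col r A ` U" "col r A ` F"] by blast
  then have nU: "col r A w \<notin> col r A ` U" using fmod.span_base by blast
  then have "w \<notin> U" by blast
  have "fmod.independent (insert (col r A w) (col r A ` U))"
    using n' U(2) by (intro fvs.independent_insertI) (auto simp: column_indep_iff)
  then have "column_indep r A (insert w U)" using U(2) nU \<open>w \<notin> U\<close> by (simp add: column_indep_iff)
  then have "card (insert w U) \<le> matroid_rank r A (insert w F)" using U(1) by (intro matroid_rank_ge) auto
  then show False using assms U(3) \<open>w \<notin> U\<close> by simp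
qed

lemma matroid_rank_mono: "F \<subseteq> G \<Longrightarrow> matroid_rank r A F \<le> matroid_rank r A G"
  by (rule matroid_rank_basis[of F r A]) (metis matroid_rank_ge subset_trans)

lemma rank_function_matroid_rank: "rank_function (matroid_rank r A)"
proof
  show "F \<subseteq> G \<Longrightarrow> matroid_rank r A F \<le> matroid_rank r A G" for F G by (rule matroid_rank_mono)
  show "matroid_rank r A (insert w F) \<le> Suc (matroid_rank r A F)" for w F
  proof -
    obtain U where U: "U \<subseteq> insert w F" "column_indep r A U" "card U = matroid_rank r A (insert w F)"
      by (rule matroid_rank_basis)
    have "column_indep r A (U - {w})"
      using U(2) fmod.independent_mono[of "col r A ` U" "col r A ` (U - {w})"] inj_on_subset[of "col r A" U "U - {w}"]
      by (auto simp: column_indep_iff)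
    then have "card (U - {w}) \<le> matroid_rank r A F" using U(1) by (intro matroid_rank_ge) auto
    moreover have "card U \<le> Suc (card (U - {w}))" by (cases "w \<in> U") auto
    ultimately show ?thesis using U(3) by linarith
  qed
  show "matroid_rank r A (insert w G) = matroid_rank r A G"
    if "matroid_rank r A (insert w F) = matroid_rank r A F" "F \<subseteq> G" for w F G
  proof (rule antisym)
    obtain U where U: "U \<subseteq> G" "column_indep r A U" "card U = matroid_rank r A G"
        "col r A ` G \<subseteq> fmod.span (col r A ` U)"
      by (rule matroid_rank_basis)
    have "col r A w \<in> fmod.span (col r A ` F)" by (rule in_span_if_rank_eq[OF that(1)])
    also have "\<dots> \<subseteq> fmod.span (col r A ` U)"
      using U(4) that(2) by (intro fmod.span_minimal) auto
    finally have "matroid_rank r A (insert w G) \<le> card (col r A ` U)"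
      using U(4) by (intro matroid_rank_le) auto
    also have "\<dots> = matroid_rank r A G" using U by (simp add: column_indep_iff card_image)
    finally show "matroid_rank r A (insert w G) \<le> matroid_rank r A G" .
  qed (auto intro: matroid_rank_mono)
qed

lemma col_in_span_units: "col r A j \<in> fmod.span ((\<lambda>i. single i (1::'k::field)) ` {..<r})"
proof -
  have "col r A j = (\<Sum>i<r. fscale (A i $ j) (single i 1))"
    unfolding col_def by (intro sum.cong refl poly_mapping_eqI) (simp add: lookup_fscale lookup_single when_def)
  also have "\<dots> \<in> fmod.span ((\<lambda>i. single i (1::'k)) ` {..<r})"
    by (intro fmod.span_sum fmod.span_scale fmod.span_base) auto
  finally show ?thesis .
qed

lemma matroid_rank_le_rows: "matroid_rank r A F \<le> r"
proof -
  have "matroid_rank r A F \<le> card ((\<lambda>i. single i (1::'a)) ` {..<r})"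
    by (intro matroid_rank_le col_in_span_units) auto
  also have "\<dots> \<le> r" using card_image_le[of "{..<r}" "\<lambda>i. single i (1::'a)"] by simp
  finally show ?thesis .
qed

text \<open>For a basis \<open>U\<close> of the columns in \<open>F\<close>, the rows restricted to \<open>U\<close> are \<open>r\<close> vectors in a space of dimension
less than \<open>r\<close>.  A relation between them extends from \<open>U\<close> to the span of its columns.\<close>

lemma exists_row_relation:
  fixes A :: "nat \<Rightarrow> 'k::field ^ 'n::finite"
  assumes "matroid_rank r A F < r"
  shows "\<exists>w. (\<exists>i<r. w i \<noteq> 0) \<and> (\<forall>j\<in>F. (\<Sum>i<r. w i * A i $ j) = 0)"
proof -
  obtain U where U: "U \<subseteq> F" "card U = matroid_rank r A F" "col r A ` F \<subseteq> fmod.span (col r A ` U)"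
    by (rule matroid_rank_basis)
  \<comment> \<open>The columns are numbered to regard the restricted rows as finitely supported families.\<close>
  obtain f :: "'n \<Rightarrow> nat" where f: "inj f" using finite_imp_inj_to_nat_seg[of "UNIV :: 'n set"] by auto
  define h where "h i = (\<Sum>j\<in>U. single (f j) (A i $ j))" for i
  have lh: "lookup (h i) (f j) = A i $ j" if "j \<in> U" for i j
    using that f by (simp add: h_def lookup_sum lookup_single when_def inj_eq if_distrib cong: if_cong)
  let ?G = "(\<lambda>j. single (f j) (1::'k)) ` U"
  have "h i \<in> cv.span ?G" for i
  proof -
    have "h i = (\<Sum>j\<in>U. cscale (A i $ j) (single (f j) 1))"
      unfolding h_def by (intro sum.cong refl) (simp add: cscale_def const_mult_single)
    also have "\<dots> \<in> cv.span ?G" by (intro cv.span_sum cv.span_scale cv.span_base) auto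
    finally show ?thesis .
  qed
  moreover have "card ?G < r" using assms U(2) card_image_le[of U "\<lambda>j. single (f j) (1::'k)"] by simp
  ultimately obtain w where w: "\<exists>i<r. w i \<noteq> 0" "(\<Sum>i<r. cscale (w i) (h i)) = 0"
    using family_dependent[of ?G r h] by auto
  let ?X = "{v. (\<Sum>i<r. w i * lookup v i) = 0}"
  have "fmod.subspace ?X"
    by (intro fmod.subspaceI)
      (auto simp: lookup_add lookup_fscale distrib_left sum.distrib mult.left_commute[of _ "_ :: 'k"] sum_distrib_left[symmetric])
  moreover have "col r A ` U \<subseteq> ?X"
  proof clarsimp
    fix j assume j: "j \<in> U"
    have "lookup (\<Sum>i<r. cscale (w i) (h i)) (f j) = 0" using w(2) by simp
    then show "(\<Sum>i<r. w i * lookup (col r A j) i) = 0"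
      using j by (simp add: lookup_sum lookup_cscale lh lookup_col)
  qed
  ultimately have "fmod.span (col r A ` U) \<subseteq> ?X" by (intro fmod.span_minimal)
  then have "(\<Sum>i<r. w i * lookup (col r A j) i) = 0" if "j \<in> F" for j using U(3) that by blast
  then have "\<forall>j\<in>F. (\<Sum>i<r. w i * A i $ j) = 0" by (simp add: lookup_col)
  then show ?thesis using w(1) by blast
qed

text \<open>The columns in \<open>F\<close> span the whole space, as a further vector would be independent of a basis that
already has \<open>r\<close> elements.\<close>

lemma full_rank_solvable:
  fixes A :: "nat \<Rightarrow> 'k::field ^ 'n::finite"
  assumes "matroid_rank r A F = r"
  shows "\<exists>x. \<forall>i<r. (\<Sum>j\<in>F. x j * A i $ j) = y i"
proof -
  obtain U where U: "U \<subseteq> F" "column_indep r A U" "card U = r" "col r A ` F \<subseteq> fmod.span (col r A ` U)"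
    by (rule matroid_rank_basis[of F r A, unfolded assms])
  define v where "v = (\<Sum>i<r. single i (y i))"
  let ?E = "(\<lambda>i. single i (1::'k)) ` {..<r}"
  have "v = (\<Sum>i<r. fscale (y i) (single i 1))"
    unfolding v_def by (intro sum.cong refl poly_mapping_eqI) (simp add: lookup_fscale lookup_single when_def)
  also have "\<dots> \<in> fmod.span ?E" by (intro fmod.span_sum fmod.span_scale fmod.span_base) auto
  finally have vE: "v \<in> fmod.span ?E" .
  have "v \<in> fmod.span (col r A ` U)"
  proof (rule ccontr)
    assume n: "v \<notin> fmod.span (col r A ` U)"
    then have nU: "v \<notin> col r A ` U" using fmod.span_base by blast
    have "fmod.independent (insert v (col r A ` U))"
      using n U(2) by (intro fvs.independent_insertI) (auto simp: column_indep_iff)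
    then have "card (insert v (col r A ` U)) \<le> card ?E"
      using fvs.independent_span_bound[of ?E "insert v (col r A ` U)"] vE col_in_span_units by blast
    also have "\<dots> \<le> r" using card_image_le[of "{..<r}" "\<lambda>i. single i (1::'k)"] by simp
    finally show False using nU U by (simp add: column_indep_iff card_image)
  qed
  then have "v \<in> fmod.span (col r A ` F)"
    using U(1) fmod.span_mono[of "col r A ` U" "col r A ` F"] by blast
  then obtain x where x: "v = (\<Sum>j\<in>F. fscale (x j) (col r A j))"
    using span_image_sum[of F v "col r A"] by auto
  have "(\<Sum>j\<in>F. x j * A i $ j) = y i" if "i < r" for i
  proof -
    have "lookup v i = (\<Sum>j\<in>F. x j * A i $ j)"
      unfolding x using that by (simp add: lookup_sum lookup_fscale lookup_col)
    moreover have "lookup v i = y i"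
      using that by (simp add: v_def lookup_sum lookup_single when_def if_distrib cong: if_cong)
    ultimately show ?thesis by simp
  qed
  then show ?thesis by blast
qed

lemma rows_independent:
  fixes A :: "nat \<Rightarrow> 'k::field ^ 'n::finite"
  assumes "row_rank r A = r" and "\<And>j. (\<Sum>i<r. w i * A i $ j) = 0" and "i < r"
  shows "w i = 0"
proof -
  let ?V = "A ` {..<r}"
  have dim: "vec.dim ?V = r" using assms(1) by (simp add: row_rank_def)
  have "vec.dim ?V \<le> card ?V" by (intro vec.dim_le_card') auto
  then have card: "card ?V = r" using dim card_image_le[of "{..<r}" A] by simp
  then have inj: "inj_on A {..<r}" by (intro eq_card_imp_inj_on) auto
  have "vec.independent ?V"
    using vec.card_eq_dim[of ?V ?V] card dim vec.span_superset[of ?V] by simp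
  moreover have "(\<Sum>v\<in>?V. w (the_inv_into {..<r} A v) *s v) = 0"
  proof -
    have "(\<Sum>v\<in>?V. w (the_inv_into {..<r} A v) *s v) = (\<Sum>i<r. w i *s A i)"
      using inj by (simp add: sum.reindex the_inv_into_f_f)
    also have "\<dots> = 0" using assms(2) by (simp add: vec_eq_iff)
    finally show ?thesis .
  qed
  ultimately have "w (the_inv_into {..<r} A (A i)) = 0"
    using assms(3) by (intro vec.independentD[of ?V ?V "\<lambda>v. w (the_inv_into {..<r} A v)"]) auto
  then show ?thesis using inj assms(3) by (simp add: the_inv_into_f_f)
qed

lemma matroid_rank_UNIV:
  assumes "row_rank r A = r" shows "matroid_rank r A UNIV = r"
proof (rule antisym[OF matroid_rank_le_rows])
  show "r \<le> matroid_rank r A UNIV"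
  proof (rule ccontr)
    assume "\<not> ?thesis"
    then obtain w where w: "\<exists>i<r. w i \<noteq> 0" "\<And>j. (\<Sum>i<r. w i * A i $ j) = 0"
      using exists_row_relation[of r A UNIV] by auto
    then show False using rows_independent[OF assms w(2)] by blast
  qed
qed

section \<open>The ideal of the closure of an affine space\<close>

lemma xm_mult_eq_0: "xm a * s = 0 \<Longrightarrow> s = 0" for s :: "('n::finite, 'k::field) S"
proof -
  obtain n where n: "xm a = (single n 1 :: ('n, 'k) S)" by (simp add: xm_def X_power prod_single)
  assume "xm a * s = 0"
  then have "lookup s m = 0" for m using lookup_single_mult[of n s m] by (simp add: n)
  then show ?thesis by (intro poly_mapping_eqI) simp
qed

lemma monomial_hom_eval_at:
  "monomial_hom (\<lambda>k :: 'k::field. k) (\<lambda>m :: 'n::finite mon. \<Prod>i\<in>UNIV. (p :: 'k ^ 'n) $ i ^ lookup m (Inl i))"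
  by unfold_locales (simp_all add: lookup_add power_add prod.distrib)

text \<open>Evaluation at a point of affine space, embedded by \<open>y\<^sub>i = 1\<close>.\<close>

definition eval_at :: "'k::field ^ 'n::finite \<Rightarrow> ('n, 'k) S \<Rightarrow> 'k" where
  "eval_at p = monomial_hom.lift (\<lambda>k. k) (\<lambda>m. \<Prod>i\<in>UNIV. p $ i ^ lookup m (Inl i))"

lemmas eval_at_add = monomial_hom.lift_add[OF monomial_hom_eval_at, folded eval_at_def]
  and eval_at_mult = monomial_hom.lift_mult[OF monomial_hom_eval_at, folded eval_at_def]
  and eval_at_zero = monomial_hom.lift_zero[OF monomial_hom_eval_at, folded eval_at_def]
  and eval_at_sum = monomial_hom.lift_sum[OF monomial_hom_eval_at, folded eval_at_def]
  and eval_at_prod = monomial_hom.lift_prod[OF monomial_hom_eval_at, folded eval_at_def]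
  and eval_at_power = monomial_hom.lift_power[OF monomial_hom_eval_at, folded eval_at_def]
  and eval_at_single = monomial_hom.lift_single[OF monomial_hom_eval_at, folded eval_at_def]

lemma eval_at_const: "eval_at p (const k) = k"
  by (simp add: eval_at_single)

lemma eval_at_X: "eval_at p (X i) = p $ i"
proof -
  have "(\<Prod>j\<in>UNIV. p $ j ^ lookup (single (Inl i) (1::nat)) (Inl j)) = (\<Prod>j\<in>UNIV. if j = i then p $ i else 1)"
    by (intro prod.cong) (auto simp: lookup_single when_def)
  then show ?thesis unfolding X_def[of i] eval_at_single by simp
qed

lemma eval_at_Y: "eval_at p (Y i) = 1"
  by (simp add: Y_def eval_at_single lookup_single)

lemma eval_at_cscale: "eval_at p (cscale k s) = k * eval_at p s"
  by (simp add: cscale_def eval_at_mult eval_at_const)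

lemma lookup_hom_mon:
  "lookup (hom_mon D m) (Inl i) = lookup m i" "lookup (hom_mon D m) (Inr i) = D i - lookup m i"
  by (simp_all add: hom_mon_def lookup_sum lookup_add lookup_single sum.distrib when_def)

lemma var_degree_ge: "m \<in> keys f \<Longrightarrow> lookup m i \<le> var_degree f i"
  unfolding var_degree_def by (intro Max_ge) auto

lemma homogeneous_homogenize: "homogeneous (\<chi> i. int (var_degree f i)) (homogenize f)"
proof -
  have "homogeneous (\<chi> i. int (var_degree f i)) (single (hom_mon (var_degree f) m) k)" if "m \<in> keys f" for m and k :: 'b
  proof -
    have "mdeg (hom_mon (var_degree f) m) = (\<chi> i. int (var_degree f i))"
      using var_degree_ge[OF that] by (simp add: vec_eq_iff lookup_mdeg lookup_hom_mon of_nat_diff)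
    then show ?thesis using homogeneous_single by metis
  qed
  then show ?thesis unfolding homogenize_def by (intro homogeneous_sum)
qed

lemma eval_at_homogenize: "eval_at p (homogenize f) = peval f p"
  unfolding homogenize_def eval_at_sum eval_at_single peval_def by (simp add: lookup_hom_mon)

lemma homogenize_eq_0:
  assumes "homogenize f = 0" shows "f = 0"
proof (rule poly_mapping_eqI)
  fix m
  have inj: "hom_mon D m = hom_mon D m' \<longleftrightarrow> m = m'" for D :: "'a \<Rightarrow> nat" and m m'
  proof
    assume "hom_mon D m = hom_mon D m'"
    then have "lookup m i = lookup m' i" for i by (metis lookup_hom_mon(1))
    then show "m = m'" by (intro poly_mapping_eqI)
  qed simp
  have "lookup (homogenize f) (hom_mon (var_degree f) m) = (\<Sum>m'\<in>keys f. if m' = m then lookup f m' else 0)"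
    unfolding homogenize_def lookup_sum by (intro sum.cong) (auto simp: lookup_single when_def inj)
  also have "\<dots> = lookup f m" by (simp add: in_keys_iff)
  finally show "lookup f m = lookup 0 m" using assms by simp
qed

lemma subspace_closure_ideal: "idl.subspace (closure_ideal L)"
  by (simp add: closure_ideal_def)

lemma graded_closure_ideal: "f \<in> closure_ideal L \<Longrightarrow> hpart a f \<in> closure_ideal L"
  unfolding closure_ideal_def using homogeneous_homogenize by (intro graded_span) blast+

lemma eval_at_closure_ideal:
  assumes "f \<in> closure_ideal L" "p \<in> L" shows "eval_at p f = 0"
proof -
  have "f \<in> idl.span (homogenize ` vanishing_ideal L)" using assms(1) by (simp add: closure_ideal_def)
  then show ?thesis
    by (induction rule: idl.span_induct_alt)
      (use assms(2) in \<open>auto simp: eval_at_zero eval_at_add eval_at_mult eval_at_homogenize vanishing_ideal_def\<close>)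
qed

text \<open>The homogenization has at most the degree \<open>a\<close>, and a power product of the \<open>x\<^sub>i\<close> makes up for the
difference.\<close>

lemma closure_ideal_witness:
  assumes f: "f \<in> vanishing_ideal L" "f \<noteq> 0"
    and deg: "\<And>m i. m \<in> keys f \<Longrightarrow> int (lookup m i) \<le> a $ i"
  shows "\<exists>g\<in>closure_ideal L. g \<noteq> 0 \<and> homogeneous a g"
proof -
  let ?d = "\<chi> i. int (var_degree f i)"
  have "keys f \<noteq> {}" using f(2) by simp
  have le: "?d $ i \<le> a $ i" for i
  proof -
    have "var_degree f i \<in> (\<lambda>m. lookup m i) ` keys f"
      unfolding var_degree_def using \<open>keys f \<noteq> {}\<close> by (intro Max_in) auto
    then show ?thesis using deg by auto
  qed
  let ?g = "xm (a - ?d) * homogenize f"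
  have "homogeneous ((a - ?d) + ?d) ?g"
    using le by (intro homogeneous_mult homogeneous_xm homogeneous_homogenize) simp
  then have "homogeneous a ?g" by simp
  moreover have "?g \<noteq> 0" using xm_mult_eq_0 homogenize_eq_0 f(2) by blast
  moreover have "?g \<in> closure_ideal L"
    using f(1) unfolding closure_ideal_def by (intro idl.span_scale idl.span_base) auto
  ultimately show ?thesis by blast
qed

text \<open>The coordinates in \<open>T\<close> are linearly independent as functionals on \<open>V\<close>; these sets \<open>T\<close> are the
coindependent ones.\<close>

definition restricts_onto :: "('k::field ^ 'n::finite) set \<Rightarrow> 'n set \<Rightarrow> bool" where
  "restricts_onto V T \<longleftrightarrow> (\<forall>y. \<exists>x\<in>V. \<forall>i\<in>T. x $ i = y i)"

definition exps :: "('k::field ^ 'n::finite) set \<Rightarrow> ('n \<Rightarrow> nat) \<Rightarrow> ('n \<Rightarrow> nat) set" where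
  "exps V a = {u. (\<forall>i. u i \<le> a i) \<and> restricts_onto V {i. u i \<noteq> 0}}"

lemma finite_exps: "finite (exps V a)"
  by (rule finite_subset[of _ "\<Pi>\<^sub>E i\<in>UNIV. {..a i}"]) (auto simp: exps_def intro!: finite_PiE)

lemma eval_at_on_line: "\<exists>q. \<forall>t. eval_at (p + t *s v) s = poly q t"
proof -
  define q where "q = (\<Sum>m\<in>keys s. [:lookup s m:] * (\<Prod>i\<in>UNIV. [:p $ i, v $ i:] ^ lookup m (Inl i)))"
  have "eval_at (p + t *s v) s = poly q t" for t
    by (subst sum_monomials[of s, symmetric])
      (simp only: eval_at_sum eval_at_single, simp add: q_def poly_sum poly_prod poly_power mult.commute)
  then show ?thesis by blast
qed

text \<open>A polynomial function that vanishes outside of a hyperplane vanishes: on a line through a given point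
that is not parallel to the hyperplane, it is a polynomial in one variable with infinitely many zeros.\<close>

lemma eval_at_eq_0_if_coordinate_mult:
  fixes V :: "('k::field ^ 'n::finite) set"
  assumes inf: "infinite (UNIV :: 'k set)" and V: "vec.subspace V" and v: "v \<in> V" "v $ i \<noteq> 0"
    and zero: "\<And>x. x \<in> V \<Longrightarrow> (p + x) $ i * eval_at (p + x) s = 0" and x: "x \<in> V"
  shows "eval_at (p + x) s = 0"
proof -
  obtain q where q: "\<And>t. eval_at (p + x + t *s v) s = poly q t" using eval_at_on_line by metis
  have "poly q t = 0" if "t \<noteq> - (p + x) $ i / v $ i" for t
  proof -
    have "x + t *s v \<in> V" using V v(1) x by (intro vec.subspace_add vec.subspace_scale)
    from zero[OF this] have "(p + x + t *s v) $ i * poly q t = 0" by (simp add: q[symmetric] add.assoc)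
    moreover have "(p + x + t *s v) $ i \<noteq> 0"
    proof
      assume "(p + x + t *s v) $ i = 0"
      then have "t * v $ i + (p + x) $ i = 0" by (simp add: algebra_simps)
      then have "t * v $ i = - (p + x) $ i" by (simp only: eq_neg_iff_add_eq_0)
      then show False using that v(2) by (simp add: nonzero_eq_divide_eq)
    qed
    ultimately show ?thesis by simp
  qed
  then have "UNIV - {- (p + x) $ i / v $ i} \<subseteq> {t. poly q t = 0}" by auto
  moreover have "infinite (UNIV - {- (p + x) $ i / v $ i})" using inf by simp
  ultimately have "infinite {t. poly q t = 0}" by (meson finite_subset)
  then have "q = 0" using poly_roots_finite by blast
  then show ?thesis using q[of 0] by simp
qed

text \<open>A lower bound for the dimension of the space of functions on \<open>p + V\<close> that are polynomials of degree at
most \<open>a\<close>, by deletion and contraction.  If the coordinate \<open>x\<^sub>i\<close> is not constant on \<open>p + V\<close>, then the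
space contains \<open>x\<^sub>i\<close> times the functions of degree at most \<open>a - e\<^sub>i\<close>, all of which vanish on the
hyperplane \<open>x\<^sub>i = 0\<close>, and it maps onto the functions on this hyperplane.  On the side of the exponents,
those with \<open>u i < a i\<close> belong to the first part and those with \<open>u i = a i\<close> to the second.  In the
remaining case, \<open>u = 0\<close> is the only exponent.\<close>

lemma independent_monomials:
  fixes V :: "('k::field ^ 'n::finite) set"
  assumes inf: "infinite (UNIV :: 'k set)" and "vec.subspace V"
  shows "\<exists>s. (\<forall>u\<in>exps V a. homogeneous (\<chi> i. int (a i)) (s u)) \<and>
    (\<forall>k. (\<forall>x\<in>V. (\<Sum>u\<in>exps V a. k u * eval_at (p + x) (s u)) = 0) \<longrightarrow> (\<forall>u\<in>exps V a. k u = 0))"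
  using assms(2)
proof (induction "\<Sum>i\<in>UNIV. a i" arbitrary: a V p rule: less_induct)
  case (less a V p)
  note V = less.prems
  show ?case
  proof (cases "\<exists>i. a i > 0 \<and> (\<exists>v\<in>V. v $ i \<noteq> 0)")
    case False
    have "u = (\<lambda>_. 0)" if u: "u \<in> exps V a" for u
    proof (rule ccontr)
      assume "u \<noteq> (\<lambda>_. 0)"
      then obtain i where i: "u i \<noteq> 0" by auto
      then obtain x where "x \<in> V" "x $ i = 1"
        using u unfolding exps_def restricts_onto_def by (auto dest: spec[of _ "\<lambda>_. 1"])
      moreover have "a i > 0" using u i by (auto simp: exps_def dest: spec[of _ i])
      moreover have "x $ i \<noteq> 0" using \<open>x $ i = 1\<close> by simp
      ultimately show False using False by blast
    qed
    moreover have "(\<lambda>_. 0) \<in> exps V a" using vec.subspace_0[OF V] by (auto simp: exps_def restricts_onto_def)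
    ultimately have N: "exps V a = {\<lambda>_. 0}" by blast
    define s :: "('n, 'k) S" where "s = (\<Prod>i\<in>UNIV. Y i ^ a i)"
    have "homogeneous (\<Sum>i\<in>UNIV. \<chi> j. int (a i) * axis i 1 $ j) s"
      unfolding s_def by (intro homogeneous_prod homogeneous_power homogeneous_Y)
    moreover have "(\<Sum>i\<in>UNIV. \<chi> j. int (a i) * axis i 1 $ j) = (\<chi> i. int (a i))"
      by (simp add: vec_eq_iff axis_def if_distrib cong: if_cong)
    ultimately have "homogeneous (\<chi> i. int (a i)) s" by simp
    moreover have "eval_at q s = 1" for q by (simp add: s_def eval_at_prod eval_at_power eval_at_Y)
    ultimately show ?thesis
      using vec.subspace_0[OF V] by (intro exI[of _ "\<lambda>_. s"]) (auto simp: N)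
  next
    case True
    then obtain i v where i: "a i > 0" and v: "v \<in> V" "v $ i \<noteq> 0" by blast
    define a1 where "a1 = a(i := a i - 1)"
    define a2 where "a2 = a(i := 0)"
    define V0 where "V0 = V \<inter> {x. x $ i = 0}"
    \<comment> \<open>\<open>p + x0\<close> is a base point of the intersection with the hyperplane \<open>x\<^sub>i = 0\<close>, whose direction is \<open>V0\<close>.\<close>
    define x0 where "x0 = (- p $ i / v $ i) *s v"
    have x0: "x0 \<in> V" "(p + x0) $ i = 0" using v V by (auto simp: x0_def vec.subspace_scale vec.subspace_neg)
    have V0: "vec.subspace V0"
      using V unfolding V0_def vec.subspace_def by auto
    have lt: "(\<Sum>i\<in>UNIV. a1 i) < (\<Sum>i\<in>UNIV. a i)" "(\<Sum>i\<in>UNIV. a2 i) < (\<Sum>i\<in>UNIV. a i)"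
      using i by (intro sum_strict_mono_ex1; auto simp: a1_def a2_def)+
    obtain s1 where "(\<forall>u\<in>exps V a1. homogeneous (\<chi> i. int (a1 i)) (s1 u)) \<and>
        (\<forall>k. (\<forall>x\<in>V. (\<Sum>u\<in>exps V a1. k u * eval_at (p + x) (s1 u)) = 0) \<longrightarrow> (\<forall>u\<in>exps V a1. k u = 0))"
      using less.hyps[OF lt(1) V, of p] by (elim exE)
    note s1 = this[THEN conjunct1, rule_format] this[THEN conjunct2, rule_format]
    obtain s2 where "(\<forall>u\<in>exps V0 a2. homogeneous (\<chi> i. int (a2 i)) (s2 u)) \<and>
        (\<forall>k. (\<forall>x\<in>V0. (\<Sum>u\<in>exps V0 a2. k u * eval_at (p + x0 + x) (s2 u)) = 0) \<longrightarrow> (\<forall>u\<in>exps V0 a2. k u = 0))"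
      using less.hyps[OF lt(2) V0, of "p + x0"] by (elim exE)
    note s2 = this[THEN conjunct1, rule_format] this[THEN conjunct2, rule_format]
    define R where "R = {u \<in> exps V a. u i = a i}"
    have a1_iff: "(\<forall>j. u j \<le> a1 j) \<longleftrightarrow> (\<forall>j. u j \<le> a j) \<and> u i \<noteq> a i" for u
    proof (intro iffI conjI allI)
      assume h: "\<forall>j. u j \<le> a1 j"
      show "u j \<le> a j" for j using spec[OF h, of j] by (cases "j = i") (auto simp: a1_def)
      show "u i \<noteq> a i" using spec[OF h, of i] i by (simp add: a1_def)
    next
      fix j assume h: "(\<forall>j. u j \<le> a j) \<and> u i \<noteq> a i"
      then have "u j \<le> a j" "u i < a i" by (auto simp: order_less_le)
      then show "u j \<le> a1 j" by (auto simp: a1_def)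
    qed
    have N1: "exps V a1 = {u \<in> exps V a. u i \<noteq> a i}"
      unfolding exps_def a1_iff by blast
    have N: "exps V a = exps V a1 \<union> R" "exps V a1 \<inter> R = {}" by (auto simp: N1 R_def)
    have R2: "u(i := 0) \<in> exps V0 a2" if u: "u \<in> R" for u
    proof -
      have le: "\<And>j. u j \<le> a j" and on: "restricts_onto V {j. u j \<noteq> 0}" and ui: "u i \<noteq> 0"
        using u i by (auto simp: R_def exps_def)
      have "restricts_onto V0 {j. (u(i := 0)) j \<noteq> 0}"
        unfolding restricts_onto_def
      proof
        fix y
        obtain x where x: "x \<in> V" "\<And>j. u j \<noteq> 0 \<Longrightarrow> x $ j = (y(i := 0)) j"
          using spec[OF on[unfolded restricts_onto_def], of "y(i := 0)"] by blast
        then have "x \<in> V0" using x(2)[OF ui] by (simp add: V0_def)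
        then show "\<exists>x\<in>V0. \<forall>j\<in>{j. (u(i := 0)) j \<noteq> 0}. x $ j = y j" using x(2) by (intro bexI[of _ x]) auto
      qed
      then show ?thesis using le by (auto simp: exps_def a2_def)
    qed
    define s where "s u = (if u \<in> R then Y i ^ a i * s2 (u(i := 0)) else X i * s1 u)" for u
    have h: "homogeneous (\<chi> i. int (a i)) (s u)" if "u \<in> exps V a" for u
    proof (cases "u \<in> R")
      case True
      have "homogeneous ((\<chi> j. int (a i) * axis i 1 $ j) + (\<chi> i. int (a2 i))) (Y i ^ a i * s2 (u(i := 0)))"
        by (intro homogeneous_mult homogeneous_power homogeneous_Y s2 R2 True)
      moreover have "(\<chi> j. int (a i) * axis i 1 $ j) + (\<chi> i. int (a2 i)) = (\<chi> i. int (a i))"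
        by (simp add: vec_eq_iff axis_def a2_def)
      ultimately show ?thesis using True by (simp add: s_def)
    next
      case False
      have "homogeneous (axis i 1 + (\<chi> i. int (a1 i))) (X i * s1 u)"
        using False that N by (intro homogeneous_mult homogeneous_X s1) auto
      moreover have "axis i 1 + (\<chi> i. int (a1 i)) = (\<chi> i. int (a i))"
        using i by (simp add: vec_eq_iff axis_def a1_def)
      ultimately show ?thesis using False by (simp add: s_def)
    qed
    moreover have "\<forall>u\<in>exps V a. k u = 0"
      if k: "\<forall>x\<in>V. (\<Sum>u\<in>exps V a. k u * eval_at (p + x) (s u)) = 0" for k
    proof -
      have split: "(\<Sum>u\<in>exps V a1. k u * ((p + x) $ i * eval_at (p + x) (s1 u))) + (\<Sum>u\<in>R. k u * eval_at (p + x) (s2 (u(i := 0)))) = 0"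
        if x: "x \<in> V" for x
      proof -
        have "(\<Sum>u\<in>exps V a. k u * eval_at (p + x) (s u)) =
            (\<Sum>u\<in>exps V a1. k u * eval_at (p + x) (s u)) + (\<Sum>u\<in>R. k u * eval_at (p + x) (s u))"
          unfolding N(1) using N(2) finite_exps[of V a1] finite_exps[of V a]
          by (intro sum.union_disjoint) (auto simp: R_def)
        moreover have "(\<Sum>u\<in>exps V a1. k u * eval_at (p + x) (s u)) =
            (\<Sum>u\<in>exps V a1. k u * ((p + x) $ i * eval_at (p + x) (s1 u)))"
          using N(2) by (intro sum.cong) (auto simp: s_def eval_at_mult eval_at_X)
        moreover have "(\<Sum>u\<in>R. k u * eval_at (p + x) (s u)) = (\<Sum>u\<in>R. k u * eval_at (p + x) (s2 (u(i := 0))))"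
          by (intro sum.cong) (auto simp: s_def eval_at_mult eval_at_power eval_at_Y)
        ultimately show ?thesis using k x by simp
      qed
      have inj: "inj_on (\<lambda>u. u(i := 0)) R"
      proof
        fix u u' assume u: "u \<in> R" "u' \<in> R" "u(i := 0) = u'(i := 0)"
        show "u = u'"
        proof
          fix j show "u j = u' j" using u(1,2) fun_cong[OF u(3), of j] by (cases "j = i") (auto simp: R_def)
        qed
      qed
      \<comment> \<open>Restricting a relation to the hyperplane leaves only the terms with exponents in \<open>R\<close>.\<close>
      have kR: "k u = 0" if u: "u \<in> R" for u
      proof -
        \<comment> \<open>\<open>k'\<close> is \<open>k\<close> carried along the injection \<open>u \<mapsto> u(i := 0)\<close> and extended by \<open>0\<close>.\<close>
        define k' where "k' w = (if w \<in> (\<lambda>u. u(i := 0)) ` R then k (the_inv_into R (\<lambda>u. u(i := 0)) w) else 0)" for w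
        have k'u: "k' (u(i := 0)) = k u" if "u \<in> R" for u
          using that the_inv_into_f_f[OF inj that] by (simp add: k'_def)
        have "(\<Sum>w\<in>exps V0 a2. k' w * eval_at (p + x0 + x) (s2 w)) = 0" if x: "x \<in> V0" for x
        proof -
          have "(\<Sum>w\<in>exps V0 a2. k' w * eval_at (p + x0 + x) (s2 w)) =
              (\<Sum>w\<in>(\<lambda>u. u(i := 0)) ` R. k' w * eval_at (p + x0 + x) (s2 w))"
            using R2 finite_exps by (intro sum.mono_neutral_right) (auto simp: k'_def)
          also have "\<dots> = (\<Sum>u\<in>R. k u * eval_at (p + (x0 + x)) (s2 (u(i := 0))))"
            using inj by (simp add: sum.reindex k'u add.assoc cong: sum.cong)
          also have "\<dots> = 0"
          proof -
            have "x0 + x \<in> V" using x x0(1) V by (auto simp: V0_def vec.subspace_add)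
            moreover have "(p + (x0 + x)) $ i = 0" using x x0(2) by (simp add: V0_def)
            ultimately show ?thesis using split[of "x0 + x"] by simp
          qed
          finally show ?thesis .
        qed
        from s2(2)[of k', OF this R2[OF u]] show ?thesis using k'u[OF u] by simp
      qed
      define g where "g = (\<Sum>u\<in>exps V a1. cscale (k u) (s1 u))"
      have eval_g: "eval_at q g = (\<Sum>u\<in>exps V a1. k u * eval_at q (s1 u))" for q by (simp add: g_def eval_at_sum eval_at_cscale)
      have "(p + x) $ i * eval_at (p + x) g = 0" if "x \<in> V" for x
        using split[OF that] kR by (simp add: eval_g sum_distrib_left mult.left_commute)
      from eval_at_eq_0_if_coordinate_mult[OF inf V v this]
      have "(\<Sum>u\<in>exps V a1. k u * eval_at (p + x) (s1 u)) = 0" if "x \<in> V" for x using that by (simp add: eval_g)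
      then have "k u = 0" if "u \<in> exps V a1" for u using s1(2)[of k u] that by blast
      then show ?thesis using kR N(1) by blast
    qed
    ultimately show ?thesis by blast
  qed
qed

text \<open>If \<open>T\<close> is not coindependent, then some combination of the rows is supported in \<open>T\<close>; the corresponding
affine equation of \<open>L\<close> gives the element of degree \<open>e\<^sub>T\<close>.  If \<open>T\<close> is coindependent, then the columns
outside of \<open>T\<close> span, so the coordinates in \<open>T\<close> of a solution of the homogeneous system can be
prescribed.  As elements of the ideal vanish on \<open>L\<close>, elements of \<open>S\<close> that are linearly independent as
functions on \<open>L\<close> are so modulo the ideal.\<close>

lemma matroidal_closure_ideal:
  fixes L :: "('k::field ^ 'n::finite) set"
  assumes inf: "infinite (UNIV :: 'k set)" and rank: "row_rank r A = r"
    and L: "L = solutions r A b" "L \<noteq> {}"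
  shows "matroidal_ideal (matroid_rank r A) (closure_ideal L)"
proof -
  interpret rank_function "matroid_rank r A" by (rule rank_function_matroid_rank)
  have rk: "rk = r" using matroid_rank_UNIV[OF rank] by (simp add: rk_def)
  define V where "V = {x. \<forall>i<r. (\<Sum>j\<in>UNIV. A i $ j * x $ j) = 0}"
  obtain p where p: "p \<in> L" using L(2) by blast
  have V: "vec.subspace V"
    unfolding vec.subspace_def V_def
    by (auto simp: distrib_left sum.distrib mult.left_commute[of "_ :: 'k"] sum_distrib_left[symmetric])
  have pV: "p + x \<in> L" if "x \<in> V" for x
    using that p by (auto simp: L solutions_def V_def distrib_left sum.distrib)
  have onto: "restricts_onto V {i. u i \<noteq> 0}" if sp: "spanning {i. u i = 0}" for u :: "'n \<Rightarrow> nat"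
    unfolding restricts_onto_def
  proof
    fix y
    let ?F = "{i. u i = 0}"
    obtain x where x: "\<And>i. i < r \<Longrightarrow> (\<Sum>j\<in>?F. x j * A i $ j) = - (\<Sum>j\<in>-?F. y j * A i $ j)"
      using full_rank_solvable[of r A ?F "\<lambda>i. - (\<Sum>j\<in>-?F. y j * A i $ j)"] sp by (auto simp: spanning_def rk)
    define z where "z = (\<chi> j. if j \<in> ?F then x j else y j)"
    have "(\<Sum>j\<in>UNIV. A i $ j * z $ j) = 0" if "i < r" for i
    proof -
      have "(\<Sum>j\<in>UNIV. A i $ j * z $ j) = (\<Sum>j\<in>?F. A i $ j * z $ j) + (\<Sum>j\<in>-?F. A i $ j * z $ j)"
        by (subst sum.union_disjoint[symmetric]) (auto intro!: sum.cong)
      also have "\<dots> = (\<Sum>j\<in>?F. x j * A i $ j) + (\<Sum>j\<in>-?F. y j * A i $ j)"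
        by (intro arg_cong2[where f = "(+)"] sum.cong) (auto simp: z_def)
      finally show ?thesis using x[OF that] by simp
    qed
    then show "\<exists>x\<in>V. \<forall>i\<in>{i. u i \<noteq> 0}. x $ i = y i" by (intro bexI[of _ z]) (auto simp: V_def z_def)
  qed
  show ?thesis
  proof
    show "idl.subspace (closure_ideal L)" by (rule subspace_closure_ideal)
    show "f \<in> closure_ideal L \<Longrightarrow> hpart a f \<in> closure_ideal L" for f a by (rule graded_closure_ideal)
  next
    fix T assume "\<not> spanning (UNIV - T)"
    then have "matroid_rank r A (UNIV - T) < r" using le_rk[of "UNIV - T"] by (simp add: spanning_def rk)
    then obtain w where w: "\<exists>i<r. w i \<noteq> 0" "\<And>j. j \<notin> T \<Longrightarrow> (\<Sum>i<r. w i * A i $ j) = 0"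
      using exists_row_relation[of r A "UNIV - T"] by auto
    define z where "z j = (\<Sum>i<r. w i * A i $ j)" for j
    define f :: "('n, 'k) mpoly" where
      "f = (\<Sum>j\<in>UNIV. single (single j 1) (z j)) - single 0 (\<Sum>i<r. w i * b i)"
    have lf: "lookup f (single j 1) = z j" for j
    proof -
      have "single j' (1::nat) = single j 1 \<longleftrightarrow> j' = j" for j' :: 'n by (auto dest: arg_cong[where f = keys])
      moreover have "single j (1::nat) \<noteq> 0" by (metis keys_single keys_zero empty_not_insert zero_neq_one)
      ultimately show ?thesis
        by (simp add: f_def lookup_minus lookup_sum lookup_single when_def if_distrib cong: if_cong)
    qed
    obtain j where j: "z j \<noteq> 0" using rows_independent[OF rank, of w] w(1) unfolding z_def by blast
    have f0: "f \<noteq> 0" using lf[of j] j by auto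
    have "keys f \<subseteq> keys (\<Sum>j\<in>UNIV. single (single j (1::nat)) (z j)) \<union> keys (single (0 :: 'n \<Rightarrow>\<^sub>0 nat) (\<Sum>i<r. w i * b i))"
      unfolding f_def by (rule keys_diff)
    also have "\<dots> \<subseteq> (\<Union>j\<in>UNIV. keys (single (single j (1::nat)) (z j))) \<union> {0}"
      by (intro Un_mono keys_sum) auto
    finally have keys: "keys f \<subseteq> insert 0 ((\<lambda>j. single j 1) ` {j. z j \<noteq> 0})"
      by (auto split: if_splits)
    have "peval f q = 0" if q: "q \<in> L" for q
    proof -
      have mono: "(\<Prod>i\<in>UNIV. q $ i ^ lookup (single j (1::nat)) i) = q $ j" for j
      proof -
        have "(\<Prod>i\<in>UNIV. q $ i ^ lookup (single j (1::nat)) i) = (\<Prod>i\<in>UNIV. if i = j then q $ j else 1)"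
          by (intro prod.cong) (auto simp: lookup_single when_def)
        then show ?thesis by simp
      qed
      have hom: "monomial_hom (\<lambda>k :: 'k. k) (\<lambda>m :: 'n \<Rightarrow>\<^sub>0 nat. \<Prod>i\<in>UNIV. q $ i ^ lookup m i)"
        by unfold_locales (simp_all add: lookup_add power_add prod.distrib)
      have "peval f q = monomial_hom.lift (\<lambda>k. k) (\<lambda>m. \<Prod>i\<in>UNIV. q $ i ^ lookup m i) f"
        by (simp add: peval_def monomial_hom.lift_def[OF hom])
      also have "\<dots> = (\<Sum>j\<in>UNIV. z j * q $ j) - (\<Sum>i<r. w i * b i)"
        unfolding f_def
        by (simp add: monomial_hom.lift_diff[OF hom] monomial_hom.lift_sum[OF hom] monomial_hom.lift_single[OF hom]
              mono[unfolded One_nat_def])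
      also have "(\<Sum>j\<in>UNIV. z j * q $ j) = (\<Sum>i<r. w i * (\<Sum>j\<in>UNIV. A i $ j * q $ j))"
        unfolding z_def sum_distrib_left sum_distrib_right by (subst sum.swap) (simp add: mult.assoc)
      also have "\<dots> = (\<Sum>i<r. w i * b i)" using q by (simp add: L solutions_def)
      finally show ?thesis by simp
    qed
    then have "f \<in> vanishing_ideal L" by (simp add: vanishing_ideal_def)
    moreover have "int (lookup m i) \<le> indicator_vec T $ i" if "m \<in> keys f" for m i
    proof -
      have "j \<in> T" if "z j \<noteq> 0" for j using w(2)[of j] that by (auto simp: z_def)
      moreover have "m \<in> insert 0 ((\<lambda>j. single j 1) ` {j. z j \<noteq> 0})"
        using keys \<open>m \<in> keys f\<close> by (rule subsetD)
      ultimately show ?thesis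
        by (elim insertE imageE) (auto simp: indicator_vec_def lookup_single when_def)
    qed
    ultimately show "\<exists>f\<in>closure_ideal L. f \<noteq> 0 \<and> homogeneous (indicator_vec T) f"
      using f0 by (intro closure_ideal_witness)
  next
    fix a :: "int ^ 'n"
    define N where "N = {u :: 'n \<Rightarrow> nat. (\<forall>i. int (u i) \<le> a $ i) \<and> spanning {i. u i = 0}}"
    show "indep_mod (closure_ideal L) a (card N)"
    proof (cases "\<forall>i. 0 \<le> a $ i")
      case False
      then obtain i where "a $ i < 0" by (auto simp: not_le)
      then have "int n \<le> a $ i \<longleftrightarrow> False" for n by simp
      then have "N = {}" unfolding N_def by blast
      then show ?thesis by (simp add: indep_mod_def)
    next
      case True
      define a' where "a' i = nat (a $ i)" for i
      have a: "(\<chi> i. int (a' i)) = a" using True by (simp add: vec_eq_iff a'_def)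
      have NE: "N \<subseteq> exps V a'"
        using onto by (auto simp: N_def exps_def a'_def) (metis nat_int nat_mono)
      then have finN: "finite N" using finite_exps finite_subset by blast
      obtain s where "(\<forall>u\<in>exps V a'. homogeneous a (s u)) \<and>
          (\<forall>k. (\<forall>x\<in>V. (\<Sum>u\<in>exps V a'. k u * eval_at (p + x) (s u)) = 0) \<longrightarrow> (\<forall>u\<in>exps V a'. k u = 0))"
        using independent_monomials[OF inf V, of a' p] unfolding a by (elim exE)
      note s = this[THEN conjunct1, rule_format] this[THEN conjunct2, rule_format]
      obtain e where e: "bij_betw e {..<card N} N"
        using ex_bij_betw_nat_finite[OF finN] by (auto simp: atLeast0LessThan)
      show ?thesis
        unfolding indep_mod_def
      proof (intro exI[of _ "\<lambda>j. s (e j)"] conjI allI impI)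
        fix j assume "j < card N"
        then show "homogeneous a (s (e j))" using e NE s(1) by (auto simp: bij_betw_def)
      next
        fix k j assume k: "(\<Sum>j<card N. cscale (k j) (s (e j))) \<in> closure_ideal L" and j: "j < card N"
        define k' where "k' u = (if u \<in> N then k (the_inv_into {..<card N} e u) else 0)" for u
        have inj: "inj_on e {..<card N}" and im: "e ` {..<card N} = N" using e by (auto simp: bij_betw_def)
        have k'e: "k' (e j) = k j" if "j < card N" for j
          using that im the_inv_into_f_f[OF inj, of j] by (auto simp: k'_def)
        have "(\<Sum>u\<in>exps V a'. k' u * eval_at (p + x) (s u)) = 0" if x: "x \<in> V" for x
        proof -
          have "(\<Sum>u\<in>exps V a'. k' u * eval_at (p + x) (s u)) = (\<Sum>u\<in>e ` {..<card N}. k' u * eval_at (p + x) (s u))"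
            unfolding im using NE finite_exps by (intro sum.mono_neutral_right) (auto simp: k'_def)
          also have "\<dots> = (\<Sum>j<card N. k j * eval_at (p + x) (s (e j)))"
            using inj by (simp add: sum.reindex k'e)
          also have "\<dots> = eval_at (p + x) (\<Sum>j<card N. cscale (k j) (s (e j)))" by (simp add: eval_at_sum eval_at_cscale)
          also have "\<dots> = 0" by (rule eval_at_closure_ideal[OF k pV[OF x]])
          finally show ?thesis .
        qed
        moreover have "e j \<in> exps V a'" using im NE j by auto
        ultimately have "k' (e j) = 0" using s(2)[of k' "e j"] by blast
        then show "k j = 0" using k'e[OF j] by simp
      qed
    qed
  qed
qed

section \<open>Initial ideals\<close>

lemma exists_lead_mon:
  assumes lt: "term_order lt" and "f \<noteq> 0" shows "\<exists>m. is_lead_mon lt f m"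
proof -
  have max: "\<exists>m\<in>A. \<forall>m'\<in>A. m' \<noteq> m \<longrightarrow> lt m' m" if "finite A" "A \<noteq> {}" for A
    using that
  proof (induction A rule: finite_ne_induct)
    case (insert x A)
    then obtain m where m: "m \<in> A" "\<And>m'. m' \<in> A \<Longrightarrow> m' \<noteq> m \<Longrightarrow> lt m' m" by blast
    have tr: "lt s t \<Longrightarrow> lt t u \<Longrightarrow> lt s u" and tot: "s \<noteq> t \<Longrightarrow> lt s t \<or> lt t s" for s t u
      using lt unfolding term_order_def by blast+
    have "x \<noteq> m" using m(1) insert.hyps by blast
    then consider "lt x m" | "lt m x" using tot by blast
    then show ?case
    proof cases
      case 1
      then show ?thesis using m by blast
    next
      case 2
      then have "lt m' x" if "m' \<in> A" for m' using tr m(2)[OF that] by (cases "m' = m") auto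
      then show ?thesis by blast
    qed
  qed simp
  have "keys f \<noteq> {}" using assms(2) by simp
  from max[OF finite_keys this] show ?thesis by (auto simp: is_lead_mon_def)
qed

definition lead_mons :: "('n mon \<Rightarrow> 'n mon \<Rightarrow> bool) \<Rightarrow> ('n, 'k::field) S set \<Rightarrow> 'n mon set" where
  "lead_mons lt J = {m. \<exists>f\<in>J. is_lead_mon lt f m}"

lemma lead_mons_add:
  assumes lt: "term_order lt" and J: "idl.subspace J" and "m \<in> lead_mons lt J"
  shows "n + m \<in> lead_mons lt (J :: ('n, 'k::field) S set)"
proof -
  obtain f where f: "f \<in> J" "is_lead_mon lt f m" using assms(3) by (auto simp: lead_mons_def)
  let ?g = "single n 1 * f"
  have "n + m \<in> keys ?g" using f(2) by (simp add: in_keys_iff lookup_single_mult is_lead_mon_def)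
  moreover have "lt m' (n + m)" if m': "m' \<in> keys ?g" "m' \<noteq> n + m" for m'
  proof -
    obtain m'' where m'': "m'' \<in> keys f" "m' = n + m''" using m'(1) keys_mult[of "single n 1" f] by auto
    then have "lt m'' m" using f(2) that(2) by (auto simp: is_lead_mon_def)
    then have "lt (m'' + n) (m + n)" using lt unfolding term_order_def by blast
    then show ?thesis using m''(2) by (simp add: add.commute)
  qed
  moreover have "?g \<in> J" using f(1) by (rule idl.subspace_scale[OF J])
  ultimately show ?thesis unfolding lead_mons_def is_lead_mon_def by blast
qed

text \<open>The initial ideal is spanned by monomials, since the leading monomials of an ideal are closed under
multiplication by monomials.\<close>

lemma initial_ideal_eq:
  assumes lt: "term_order lt" and J: "idl.subspace J"
  shows "initial_ideal lt J = {s. keys s \<subseteq> lead_mons lt (J :: ('n, 'k::field) S set)}" (is "_ = ?R")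
proof
  have sub: "idl.subspace ?R"
  proof (rule idl.subspaceI)
    show "x + y \<in> ?R" if "x \<in> ?R" "y \<in> ?R" for x y using keys_add[of x y] that by blast
    show "c * x \<in> ?R" if "x \<in> ?R" for c x
    proof -
      have "n + m \<in> lead_mons lt J" if "m \<in> keys x" for n m
        using lead_mons_add[OF lt J] that \<open>x \<in> ?R\<close> by blast
      then show ?thesis using keys_mult[of c x] by auto
    qed
  qed simp
  have "single m (lookup f m) \<in> ?R" if "f \<in> J" "is_lead_mon lt f m" for f m
    using that by (auto simp: lead_mons_def)
  then show "initial_ideal lt J \<subseteq> ?R"
    unfolding initial_ideal_def by (intro idl.span_minimal sub) blast
  show "?R \<subseteq> initial_ideal lt J"
  proof
    fix s assume s: "s \<in> ?R"
    have "single m (lookup s m) \<in> initial_ideal lt J" if m: "m \<in> keys s" for m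
    proof -
      obtain f where f: "f \<in> J" "is_lead_mon lt f m" using s m by (auto simp: lead_mons_def)
      then have "lookup f m \<noteq> 0" by (simp add: is_lead_mon_def in_keys_iff)
      then have "single m (lookup s m) = const (lookup s m / lookup f m) * single m (lookup f m)"
        by (simp add: const_mult_single)
      also have "\<dots> \<in> initial_ideal lt J"
        unfolding initial_ideal_def using f by (intro idl.span_scale idl.span_base) blast
      finally show ?thesis .
    qed
    then have "(\<Sum>m\<in>keys s. single m (lookup s m)) \<in> initial_ideal lt J"
      unfolding initial_ideal_def by (intro idl.span_sum) blast
    then show "s \<in> initial_ideal lt J" by (simp add: sum_monomials)
  qed
qed

text \<open>The monomials of degree \<open>a\<close> that are not leading monomials are independent modulo the initial ideal.
They span \<open>S / J\<close> in degree \<open>a\<close>, as any other monomial can be replaced by smaller ones; so there are at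
least as many of them as the dimension of \<open>S / J\<close>.\<close>

lemma (in matroidal_ideal) matroidal_initial_ideal:
  assumes lt: "term_order lt" shows "matroidal_ideal \<rho> (initial_ideal lt J)"
proof -
  let ?I = "initial_ideal lt J"
  note I = initial_ideal_eq[OF lt ideal]
  have mono_I: "single m 1 \<in> ?I" if "is_lead_mon lt f m" "f \<in> J" for f m
    using that unfolding I by (auto simp: lead_mons_def)
  show ?thesis
  proof
    show "idl.subspace ?I" by (simp add: initial_ideal_def)
    show "hpart a f \<in> ?I" if "f \<in> ?I" for f a
      using that unfolding I hpart_def by (auto simp: keys_restr)
  next
    fix T assume "\<not> spanning (UNIV - T)"
    then obtain f where f: "f \<in> J" "f \<noteq> 0" "homogeneous (indicator_vec T) f" using witness by blast
    obtain m where m: "is_lead_mon lt f m" using exists_lead_mon[OF lt f(2)] by blast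
    then have "mdeg m = indicator_vec T" using f(3) by (simp add: is_lead_mon_def homogeneous_def)
    then have "homogeneous (indicator_vec T) (single m (1::'k))" using homogeneous_single by metis
    moreover have "single m (1::'k) \<noteq> 0" by (metis keys_single keys_zero empty_not_insert zero_neq_one)
    ultimately show "\<exists>f\<in>?I. f \<noteq> 0 \<and> homogeneous (indicator_vec T) f" using mono_I[OF m f(1)] by blast
  next
    fix a :: "int ^ 'n"
    define n where "n = card {u :: 'n \<Rightarrow> nat. (\<forall>i. int (u i) \<le> a $ i) \<and> spanning {i. u i = 0}}"
    define std where "std = {m. mdeg m = a \<and> m \<notin> lead_mons lt J}"
    define G where "G = (\<lambda>m. single m (1::'k)) ` std"
    have finstd: "finite std" unfolding std_def by (rule finite_subset[OF _ finite_monomials[of a]]) auto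
    have irr: "\<not> lt s s" and tr: "lt s t \<Longrightarrow> lt t u \<Longrightarrow> lt s u" for s t u
      using lt unfolding term_order_def by blast+
    define R where "R = {f. \<exists>h\<in>cv.span G. f - h \<in> J}"
    have subR: "cv.subspace R"
    proof (rule cv.subspaceI)
      show "0 \<in> R" using idl.subspace_0[OF ideal] cv.span_zero by (auto simp: R_def intro!: bexI[of _ 0])
      show "x + y \<in> R" if xy: "x \<in> R" "y \<in> R" for x y
      proof -
        obtain h h' where "h \<in> cv.span G" "x - h \<in> J" "h' \<in> cv.span G" "y - h' \<in> J" using xy by (auto simp: R_def)
        then have "h + h' \<in> cv.span G" "(x - h) + (y - h') \<in> J"
          using idl.subspace_add[OF ideal] cv.span_add by blast+
        then show ?thesis unfolding R_def by (intro CollectI bexI[of _ "h + h'"]) (simp_all add: algebra_simps)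
      qed
      show "cscale c x \<in> R" if x: "x \<in> R" for c x
      proof -
        obtain h where "h \<in> cv.span G" "x - h \<in> J" using x by (auto simp: R_def)
        then have "cscale c h \<in> cv.span G" "cscale c (x - h) \<in> J"
          using cscale_in_ideal[OF ideal] cv.span_scale by blast+
        then show ?thesis unfolding R_def by (intro CollectI bexI[of _ "cscale c h"]) (simp_all add: cv.scale_right_diff_distrib)
      qed
    qed
    have mono: "single m 1 \<in> R" if "mdeg m = a" for m
      using that
    proof (induction "card {m'. mdeg m' = a \<and> lt m' m}" arbitrary: m rule: less_induct)
      case less
      show ?case
      proof (cases "m \<in> lead_mons lt J")
        case False
        then have "single m 1 \<in> cv.span G" using less.prems by (auto simp: G_def std_def intro!: cv.span_base)
        then show ?thesis using idl.subspace_0[OF ideal] by (auto simp: R_def intro!: bexI[of _ "single m 1"])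
      next
        case True
        then obtain f where f: "f \<in> J" "is_lead_mon lt f m" by (auto simp: lead_mons_def)
        \<comment> \<open>The induction is on the number of smaller monomials of degree \<open>a\<close>, so the reduction has to stay in this degree.\<close>
        define g where "g = hpart a f"
        have g: "g \<in> J" "lookup g m \<noteq> 0" "\<And>m'. m' \<in> keys g \<Longrightarrow> mdeg m' = a \<and> (m' = m \<or> lt m' m)"
          using f graded less.prems
          by (auto simp: g_def hpart_def keys_restr lookup_restr is_lead_mon_def in_keys_iff)
        have low: "single m' 1 \<in> R" if "m' \<in> keys g - {m}" for m'
        proof (rule less.hyps)
          have m': "mdeg m' = a" "lt m' m" using g(3)[of m'] that by auto
          have "{m''. mdeg m'' = a \<and> lt m'' m'} \<subset> {m''. mdeg m'' = a \<and> lt m'' m}"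
            using m' tr[OF _ m'(2)] irr by blast
          moreover have "finite {m''. mdeg m'' = a \<and> lt m'' m}"
            by (rule finite_subset[OF _ finite_monomials[of a]]) auto
          ultimately show "card {m''. mdeg m'' = a \<and> lt m'' m'} < card {m''. mdeg m'' = a \<and> lt m'' m}"
            by (rule psubset_card_mono[rotated])
          show "mdeg m' = a" by fact
        qed
        have "m \<in> keys g" using g(2) by (simp add: in_keys_iff)
        then have "g = single m (lookup g m) + (\<Sum>m'\<in>keys g - {m}. single m' (lookup g m'))"
          by (subst sum_monomials[of g, symmetric]) (simp add: sum.remove)
        then have "cscale (lookup g m) (single m 1) = g - (\<Sum>m'\<in>keys g - {m}. cscale (lookup g m') (single m' 1))"
          unfolding cscale_def const_mult_single mult_1_right eq_diff_eq by (rule sym)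
        also have "\<dots> \<in> R"
        proof (intro cv.subspace_diff[OF subR] cv.subspace_sum[OF subR] cv.subspace_scale[OF subR] low)
          show "g \<in> R" using g(1) cv.span_zero by (auto simp: R_def intro!: bexI[of _ 0])
        qed
        finally have "cscale (inverse (lookup g m)) (cscale (lookup g m) (single m 1)) \<in> R"
          by (rule cv.subspace_scale[OF subR])
        then show ?thesis using g(2) by simp
      qed
    qed
    have "f \<in> R" if "homogeneous a f" for f
    proof -
      have "(\<Sum>m\<in>keys f. cscale (lookup f m) (single m 1)) \<in> R"
        using that by (intro cv.subspace_sum[OF subR] cv.subspace_scale[OF subR] mono) (simp add: homogeneous_def)
      moreover have "(\<Sum>m\<in>keys f. cscale (lookup f m) (single m 1)) = f"
        by (simp add: cscale_def const_mult_single sum_monomials)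
      ultimately show ?thesis by simp
    qed
    then have "n \<le> card G"
      unfolding n_def using finstd by (intro indep_mod_le_card[OF ideal count]) (auto simp: R_def G_def)
    also have "\<dots> \<le> card std" unfolding G_def by (rule card_image_le[OF finstd])
    finally have n: "n \<le> card std" .
    obtain e where e: "bij_betw e {..<card std} std"
      using ex_bij_betw_nat_finite[OF finstd] by (auto simp: atLeast0LessThan)
    have "indep_mod ?I a n"
      unfolding indep_mod_def
    proof (intro exI[of _ "\<lambda>j. single (e j) 1"] conjI allI impI)
      fix j assume "j < n"
      then have "e j \<in> std" using n e by (auto simp: bij_betw_def)
      then show "homogeneous a (single (e j) (1::'k))" using homogeneous_single[of "e j"] by (simp add: std_def)
    next
      fix k :: "nat \<Rightarrow> 'k" and j assume k: "(\<Sum>j<n. cscale (k j) (single (e j) 1)) \<in> ?I" and j: "j < n"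
      have inj: "e i = e j \<longleftrightarrow> i = j" if "i < n" for i
        using e n j that by (auto simp: bij_betw_def inj_on_def)
      have "lookup (\<Sum>j<n. cscale (k j) (single (e j) 1)) (e j) = (\<Sum>i<n. if i = j then k i else 0)"
        unfolding lookup_sum lookup_cscale by (intro sum.cong) (auto simp: lookup_single when_def inj)
      also have "\<dots> = k j" using j by simp
      finally have l: "lookup (\<Sum>j<n. cscale (k j) (single (e j) 1)) (e j) = k j" .
      have "e j \<notin> lead_mons lt J" using n e j by (auto simp: bij_betw_def std_def)
      then have "e j \<notin> keys (\<Sum>j<n. cscale (k j) (single (e j) 1))" using k unfolding I by blast
      then show "k j = 0" using l by (simp add: in_keys_iff)
    qed
    then show "indep_mod ?I a (card {u. (\<forall>i. int (u i) \<le> a $ i) \<and> spanning {i. u i = 0}})"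
      by (simp add: n_def)
  qed
qed

section \<open>The Betti numbers\<close>

theorem theorem7p5:
  fixes L :: "('k::field ^ 'n::finite) set"
    and d r :: nat
    and A :: "nat \<Rightarrow> 'k ^ 'n"
    and b :: "nat \<Rightarrow> 'k"
  assumes "infinite (UNIV :: 'k set)"
    and "affine_subspace L d"
    and "r = CARD('n) - d"
    and "row_rank r A = r"
    and "L = solutions r A b"
  shows "{(i, a). betti (closure_ideal L) i a \<noteq> 0} =
           {(r - matroid_rank r A F, indicator_vec (UNIV - F)) | F. F \<in> flats r A}
       \<and> (\<forall>F \<in> flats r A.
           int (betti (closure_ideal L) (r - matroid_rank r A F) (indicator_vec (UNIV - F)))
             = \<bar>moebius (flats r A) F UNIV\<bar>)
       \<and> (\<forall>lt. term_order lt \<longrightarrow>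
           (\<forall>i a. betti (closure_ideal L) i a = betti (initial_ideal lt (closure_ideal L)) i a))"
proof -
  have "L \<noteq> {}"
    using assms(2) vec.subspace_0 unfolding affine_subspace_def by blast
  then interpret matroidal_ideal "matroid_rank r A" "closure_ideal L"
    by (rule matroidal_closure_ideal[OF assms(1,4,5)])
  have flats: "flats r A = {Z. flat Z}" by (simp add: flats_def flat_def)
  have rk: "rk = r" using matroid_rank_UNIV[OF assms(4)] by (simp add: rk_def)
  note betti = betti_matroidal[OF assms(1), unfolded rk, folded flats]
  have pos: "moebius (flats r A) F UNIV \<noteq> 0" if "flat F" for F
  proof -
    have "\<forall>w\<in>UNIV - F. matroid_rank r A F < matroid_rank r A (insert w F)" using that by (simp add: flat_def)
    then have "span_sum F UNIV \<noteq> 0" using span_sum_pos[of F UNIV] by (auto simp: spanning_def rk_def)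
    then show ?thesis unfolding flats moebius_eq_span_sum[OF that] .
  qed
  have "{(i, a). betti (closure_ideal L) i a \<noteq> 0} =
      {(r - matroid_rank r A F, indicator_vec (UNIV - F)) | F. F \<in> flats r A}"
  proof (intro set_eqI iffI)
    fix x assume "x \<in> {(i, a). betti (closure_ideal L) i a \<noteq> 0}"
    then obtain i a where x: "x = (i, a)" "betti (closure_ideal L) i a \<noteq> 0" by blast
    from x(2) have "flat (zeros a)" "a = indicator_vec (UNIV - zeros a)" "i = r - matroid_rank r A (zeros a)"
      unfolding betti by presburger+
    then show "x \<in> {(r - matroid_rank r A F, indicator_vec (UNIV - F)) | F. F \<in> flats r A}"
      unfolding flats x(1) by blast
  next
    fix x assume "x \<in> {(r - matroid_rank r A F, indicator_vec (UNIV - F)) | F. F \<in> flats r A}"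
    then obtain F where F: "F \<in> flats r A" "x = (r - matroid_rank r A F, indicator_vec (UNIV - F))" by blast
    have "betti (closure_ideal L) (r - matroid_rank r A F) (indicator_vec (UNIV - F)) \<noteq> 0"
      using pos[of F] F(1) unfolding betti by (simp add: flats)
    then show "x \<in> {(i, a). betti (closure_ideal L) i a \<noteq> 0}" using F(2) by simp
  qed
  moreover have "\<forall>F \<in> flats r A.
      int (betti (closure_ideal L) (r - matroid_rank r A F) (indicator_vec (UNIV - F))) = \<bar>moebius (flats r A) F UNIV\<bar>"
    unfolding betti by (simp add: flats)
  moreover have "betti (closure_ideal L) i a = betti (initial_ideal lt (closure_ideal L)) i a" if "term_order lt" for lt i a
    unfolding betti_matroidal[OF assms(1)] matroidal_ideal.betti_matroidal[OF matroidal_initial_ideal[OF that] assms(1)] ..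
  ultimately show ?thesis by blast
qed

end
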